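(* Let $(a_n)_{n\ge1}$ satisfy $a_n-\log n-(k-1)\log\log n\to\infty$ and $a_n=o(n)$ as $n\to\infty$, and let $b_n=na_n^{k-1}e^{-a_n}$. Then, as $n\to\infty$, $$b_n^{-1}\,\mathbb{P}(L_{k,n}\in\cdot)\to\xi_k\quad\text{in }\mathcal{M}_0,$$ where $$\xi_k(\cdot)=\frac{1}{(k-1)!}\int_E\mathbf{1}\{\delta_{(x,u)}\in\cdot\}\,e^{-u}\,dx\,du .$$
   Context: Fix integers $d\ge1$, $k\ge1$. The unit cube $[0,1]^d$ is equipped with the toroidal metric $\mathsf{dist}(x,y)=\min_{z\in\mathbb{Z}^d}\|x-y+z\|$ ($\|\cdot\|$ Euclidean), so it is viewed as a flat torus; $B_r(x)=\{y\in[0,1]^d:\mathsf{dist}(x,y)\le r\}$. $\theta_d$ is the volume of the unit ball of $\mathbb{R}^d$. For a point measure $\omega$ on $[0,1]^d$ and $x\in[0,1]^d$, $R_k(x,\omega)=\inf\{r>0:\omega(B_r(x)\setminus\{x\})\ge k\}$. $\mathcal{P}_n$ is a homogeneous Poisson point process on $[0,1]^d$ with intensity $n$, and $|\mathcal{P}_n|$ is its number of points. $E=[0,1]^d\times(-\infty,\infty]$, and $M_p(E)$ is the space of point measures on $E$ with the vague topology, metrized by the vague metric. Define $L_{k,n}\in M_p(E)$ by $L_{k,n}=\sum_{X\in\mathcal{P}_n}\delta_{(X,\,n\theta_dR_k(X,\mathcal{P}_n)^d-a_n)}$ if $|\mathcal{P}_n|>k$, and $L_{k,n}=\emptyset$ (the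 null measure) if $|\mathcal{P}_n|\le k$. $\mathcal{M}_0$-topology: the origin of $M_p(E)$ is the null measure $\emptyset$, and $B_{\emptyset,r}$ is the open ball of radius $r$ around $\emptyset$ in the vague metric. $\mathcal{M}_0=\mathcal{M}_0(M_p(E))$ is the set of Borel measures on $M_p(E)$ whose restriction to $M_p(E)\setminus B_{\emptyset,r}$ is finite for every $r>0$. $\mathcal{C}_0$ is the set of bounded continuous real functions on $M_p(E)$ vanishing in a neighborhood of $\emptyset$. For $\xi_n,\xi\in\mathcal{M}_0$, $\xi_n\to\xi$ in $\mathcal{M}_0$ means $\int g\,d\xi_n\to\int g\,d\xi$ for all $g\in\mathcal{C}_0$. In the integral defining $\xi_k$, $dx\,du$ is Lebesgue measure (giving no mass to $u=\infty$). *)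

theory Defs
  imports "HOL-Probability.Probability" "HOL-Library.Landau_Symbols"
begin

section \<open>The flat torus\<close>

text \<open>The unit cube with opposite faces identified: the half-open cube contains exactly one
  representative of every point, so that the toroidal distance is a genuine metric on it.\<close>

definition torus :: "(real ^ 'd) set" where
  "torus = {x. \<forall>i. 0 \<le> x $ i \<and> x $ i < 1}"

text \<open>The infimum is attained, by discreteness of the integer lattice.\<close>

definition torus_dist :: "real ^ 'd \<Rightarrow> real ^ 'd \<Rightarrow> real" where
  "torus_dist x y = (INF z\<in>{z. \<forall>i. z $ i \<in> \<int>}. norm (x - y + z))"

lemma torus_dist_approx:
  fixes x y :: "real ^ 'd"
  assumes "torus_dist x y < e"
  obtains z where "\<forall>i. z $ i \<in> \<int>" "norm (x - y + z) < e"
proof -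
  have "(0 :: real ^ 'd) \<in> {z. \<forall>i. z $ i \<in> \<int>}"
    by simp
  then show thesis
    using assms cINF_less_iff[of "{z :: real ^ 'd. \<forall>i. z $ i \<in> \<int>}" "\<lambda>z. norm (x - y + z)" e] that
    unfolding torus_dist_def
    by (metis (mono_tags, lifting) bdd_belowI2 empty_iff mem_Collect_eq norm_ge_zero)
qed

lemma torus_dist_le:
  assumes "\<forall>i. z $ i \<in> \<int>"
  shows "torus_dist x y \<le> norm (x - y + z)"
  unfolding torus_dist_def
  by (rule cINF_lower) (use assms in \<open>auto intro: bdd_belowI2[where m = 0]\<close>)

lemma torus_dist_nonneg: "0 \<le> torus_dist x y"
  by (meson norm_ge_zero not_le order_le_less_trans torus_dist_approx)

lemma torus_dist_commute:
  fixes x y :: "real ^ 'd"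
  shows "torus_dist x y = torus_dist y x"
proof -
  have "torus_dist x y \<le> torus_dist y x" for x y :: "real ^ 'd"
  proof (rule field_le_epsilon)
    fix e :: real
    assume "e > 0"
    then obtain z where z: "\<forall>i. z $ i \<in> \<int>" "norm (y - x + z) < torus_dist y x + e"
      using torus_dist_approx[of y x "torus_dist y x + e"] by auto
    have "torus_dist x y \<le> norm (x - y + (- z))"
      using z by (intro torus_dist_le) auto
    also have "\<dots> = norm (y - x + z)"
      by (metis add_uminus_conv_diff minus_diff_eq norm_minus_cancel minus_add_distrib)
    finally show "torus_dist x y \<le> torus_dist y x + e"
      using z by simp
  qed
  then show ?thesis
    by (simp add: antisym)
qed

lemma torus_dist_triangle: "torus_dist x z \<le> torus_dist x y + torus_dist y z"
proof (rule field_le_epsilon)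
  fix e :: real
  assume "e > 0"
  obtain u where u: "\<forall>i. u $ i \<in> \<int>" "norm (x - y + u) < torus_dist x y + e / 2"
    using torus_dist_approx[of x y "torus_dist x y + e / 2"] \<open>e > 0\<close> by auto
  obtain v where v: "\<forall>i. v $ i \<in> \<int>" "norm (y - z + v) < torus_dist y z + e / 2"
    using torus_dist_approx[of y z "torus_dist y z + e / 2"] \<open>e > 0\<close> by auto
  have "torus_dist x z \<le> norm (x - z + (u + v))"
    using u v by (intro torus_dist_le) auto
  also have "x - z + (u + v) = (x - y + u) + (y - z + v)"
    by simp
  also have "norm \<dots> \<le> norm (x - y + u) + norm (y - z + v)"
    by (rule norm_triangle_ineq)
  finally show "torus_dist x z \<le> torus_dist x y + torus_dist y z + e"
    using u v by simp
qed

lemma torus_dist_eq_0: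
  assumes "x \<in> torus" "y \<in> torus"
  shows "torus_dist x y = 0 \<longleftrightarrow> x = y"
proof
  assume "x = y"
  then show "torus_dist x y = 0"
    using torus_dist_le[of 0 x y] torus_dist_nonneg[of x y] by simp
next
  assume 0: "torus_dist x y = 0"
  have "x $ i = y $ i" for i
  proof (rule ccontr)
    assume ne: "x $ i \<noteq> y $ i"
    define t where "t = \<bar>x $ i - y $ i\<bar>"
    have t: "0 < t" "t < 1"
      using ne assms unfolding t_def torus_def by (auto simp: abs_if) (smt (verit))+
    then obtain z where z: "\<forall>i. z $ i \<in> \<int>" "norm (x - y + z) < min t (1 - t)"
      using torus_dist_approx[of x y "min t (1 - t)"] 0 by auto
    obtain m where m: "z $ i = of_int m"
      using z(1) Ints_cases by metis
    have "\<bar>(x $ i - y $ i) + of_int m\<bar> < min t (1 - t)"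
      using component_le_norm_cart[of "x - y + z" i] z(2) m by simp
    then have lt: "\<bar>(x $ i - y $ i) + of_int m\<bar> < t" "\<bar>(x $ i - y $ i) + of_int m\<bar> < 1 - t"
      by auto
    then have "\<bar>of_int m :: real\<bar> < 1"
      unfolding t_def by linarith
    then have "m = 0"
      by linarith
    with lt show False
      unfolding t_def by simp
  qed
  then show "x = y"
    by (simp add: vec_eq_iff)
qed

interpretation torus: Metric_space "torus :: (real ^ 'd) set" torus_dist
  by standard (simp_all add: torus_dist_nonneg torus_dist_commute torus_dist_eq_0
      torus_dist_triangle)

abbreviation torus_topology :: "(real ^ 'd) topology" where
  "torus_topology \<equiv> torus.mtopology"


section \<open>Point measures and the vague topology\<close>

definition borel_of :: "'a topology \<Rightarrow> 'a measure" where
  "borel_of X = sigma (topspace X) {U. openin X U}"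

abbreviation dirac :: "'a topology \<Rightarrow> 'a \<Rightarrow> 'a measure" where
  "dirac X x \<equiv> return (borel_of X) x"

text \<open>The push-forward of the counting measure on \<open>I\<close> under \<open>x\<close> is the countable sum of the
  unit masses at the points \<open>x i\<close>, \<open>i \<in> I\<close>; repetitions are allowed.\<close>

definition point_measures :: "'a topology \<Rightarrow> 'a measure set" where
  "point_measures X =
     {\<mu>. (\<exists>(I :: nat set) x. x \<in> I \<rightarrow> topspace X \<and> \<mu> = distr (count_space I) (borel_of X) x) \<and>
         (\<forall>K. compactin X K \<longrightarrow> emeasure \<mu> K < \<infinity>)}"

definition Cc_nonneg :: "'a topology \<Rightarrow> ('a \<Rightarrow> real) set" where
  "Cc_nonneg X =
     {f. continuous_map X euclideanreal f \<and> (\<forall>x\<in>topspace X. 0 \<le> f x) \<and>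
         compactin X (X closure_of {x \<in> topspace X. f x \<noteq> 0})}"

definition vague_topology :: "'a topology \<Rightarrow> 'a measure topology" where
  "vague_topology X = topology_generated_by
     {{\<mu> \<in> point_measures X. (\<integral>x. f x \<partial>\<mu>) \<in> U} | f U. f \<in> Cc_nonneg X \<and> open U}"

text \<open>The vague metric matters only as a metric inducing the vague topology; any such
  metric is admitted.\<close>

definition vague_metric :: "'a topology \<Rightarrow> ('a measure \<Rightarrow> 'a measure \<Rightarrow> real) \<Rightarrow> bool" where
  "vague_metric X \<rho> \<longleftrightarrow>
     Metric_space (point_measures X) \<rho> \<and>
     Metric_space.mtopology (point_measures X) \<rho> = vague_topology X"


section \<open>Convergence in \<open>M\<^sub>0\<close>\<close>

definition M0 ::
    "'a topology \<Rightarrow> ('a measure \<Rightarrow> 'a measure \<Rightarrow> real) \<Rightarrow> 'a measure measure set" where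
  "M0 X \<rho> =
     {\<xi>. sets \<xi> = sets (borel_of (vague_topology X)) \<and>
         (\<forall>r>0. emeasure \<xi> (point_measures X -
             Metric_space.mball (point_measures X) \<rho> (null_measure (borel_of X)) r) < \<infinity>)}"

definition C0 :: "'a topology \<Rightarrow> ('a measure \<Rightarrow> real) set" where
  "C0 X =
     {g. continuous_map (vague_topology X) euclideanreal g \<and>
         (\<exists>B. \<forall>\<mu>\<in>point_measures X. \<bar>g \<mu>\<bar> \<le> B) \<and>
         (\<exists>U. openin (vague_topology X) U \<and> null_measure (borel_of X) \<in> U \<and> (\<forall>\<mu>\<in>U. g \<mu> = 0))}"

text \<open>Finitely many members of the sequence may lie outside \<open>M\<^sub>0\<close>, as the sequences of interest
  are meaningful for large indices only.\<close>

definition tendsto_M0 ::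
    "'a topology \<Rightarrow> ('a measure \<Rightarrow> 'a measure \<Rightarrow> real) \<Rightarrow>
     (nat \<Rightarrow> 'a measure measure) \<Rightarrow> 'a measure measure \<Rightarrow> bool" where
  "tendsto_M0 X \<rho> \<xi>s \<xi> \<longleftrightarrow>
     (\<forall>\<^sub>F n in sequentially. \<xi>s n \<in> M0 X \<rho>) \<and> \<xi> \<in> M0 X \<rho> \<and>
     (\<forall>g\<in>C0 X. (\<lambda>n. \<integral>\<mu>. g \<mu> \<partial>\<xi>s n) \<longlonglongrightarrow> (\<integral>\<mu>. g \<mu> \<partial>\<xi>))"


section \<open>Poisson processes\<close>

definition poisson_process ::
    "'w measure \<Rightarrow> 'a topology \<Rightarrow> 'a measure \<Rightarrow> ('w \<Rightarrow> 'a measure) \<Rightarrow> bool" where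
  "poisson_process \<Omega> X \<nu> P \<longleftrightarrow>
     (\<forall>\<omega>\<in>space \<Omega>. P \<omega> \<in> point_measures X) \<and>
     (\<forall>A\<in>sets (borel_of X). (\<lambda>\<omega>. emeasure (P \<omega>) A) \<in> borel_measurable \<Omega>) \<and>
     (\<forall>A\<in>sets (borel_of X). emeasure \<nu> A < \<infinity> \<longrightarrow>
        (\<forall>j :: nat. measure \<Omega> {\<omega> \<in> space \<Omega>. emeasure (P \<omega>) A = of_nat j} =
           exp (- measure \<nu> A) * measure \<nu> A ^ j / fact j)) \<and>
     (\<forall>(A :: nat \<Rightarrow> 'a set) m. (\<forall>i<m. A i \<in> sets (borel_of X)) \<and> disjoint_family_on A {..<m} \<longrightarrow>
        prob_space.indep_vars \<Omega> (\<lambda>_. borel) (\<lambda>i \<omega>. emeasure (P \<omega>) (A i)) {..<m})"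

definition lebesgue_torus :: "(real ^ 'd) measure" where
  "lebesgue_torus = restrict_space lborel torus"

definition homogeneous_poisson ::
    "'w measure \<Rightarrow> real \<Rightarrow> ('w \<Rightarrow> (real ^ 'd) measure) \<Rightarrow> bool" where
  "homogeneous_poisson \<Omega> t P \<longleftrightarrow>
     poisson_process \<Omega> torus_topology (scale_measure (ennreal t) lebesgue_torus) P"


section \<open>Nearest neighbour balls\<close>

text \<open>The value is \<open>\<infinity>\<close> (the infimum of the empty set) if there are fewer than \<open>k\<close> other points.\<close>

definition knn_radius :: "nat \<Rightarrow> real ^ 'd \<Rightarrow> (real ^ 'd) measure \<Rightarrow> ereal" where
  "knn_radius k x \<omega> =
     (INF r\<in>{r :: real. 0 < r \<and> emeasure \<omega> (torus.mcball x r - {x}) \<ge> of_nat k}. ereal r)"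

definition E_topology :: "((real ^ 'd) \<times> ereal) topology" where
  "E_topology = prod_topology torus_topology (top_of_set {-\<infinity><..})"

definition unit_ball_volume :: "'d::finite itself \<Rightarrow> real" where
  "unit_ball_volume _ = measure lborel (cball (0 :: real ^ 'd) 1)"

text \<open>Summing unit masses at \<open>h X\<close> over the points \<open>X\<close> of \<open>\<omega>\<close> (with multiplicity) amounts to
  taking the push-forward of \<open>\<omega>\<close> under \<open>h\<close>.\<close>

definition L_process ::
    "nat \<Rightarrow> (nat \<Rightarrow> real) \<Rightarrow> nat \<Rightarrow> (real ^ 'd) measure \<Rightarrow> ((real ^ 'd) \<times> ereal) measure" where
  "L_process k a n \<omega> =
     (if emeasure \<omega> torus > of_nat k
      then distr \<omega> (borel_of E_topology)
             (\<lambda>x. (x, ereal (real n * unit_ball_volume TYPE('d)) * knn_radius k x \<omega> ^ CARD('d)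
                        - ereal (a n)))
      else null_measure (borel_of E_topology))"

definition xi_limit :: "nat \<Rightarrow> ((real ^ 'd) \<times> ereal) measure measure" where
  "xi_limit k =
     scale_measure (ennreal (1 / fact (k - 1)))
       (distr (density (lebesgue_torus \<Otimes>\<^sub>M lborel) (\<lambda>(x, u). ennreal (exp (- u))))
              (borel_of (vague_topology E_topology))
              (\<lambda>(x, u :: real). dirac E_topology (x, ereal u)))"

end

theory Submission
  imports Defs
begin

text \<open>
Call a point of a finite configuration isolated at radius \<open>r\<close> if the open ball of radius \<open>r\<close> around it
contains fewer than \<open>k\<close> other points. Its mark \<open>n \<theta> R\<^sub>k\<^sup>d - a\<^sub>n\<close> is at least \<open>u\<close> if and only if the point
is isolated at the radius with \<open>n \<theta> r\<^sup>d = a\<^sub>n + u\<close>. Because \<open>a\<^sub>n = o(n)\<close>, this radius tends to zero;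
then the volume of a torus ball is exactly \<open>\<theta> r\<^sup>d\<close>, and the number of other points in the ball is
Poisson with mean \<open>a\<^sub>n + u\<close>. The mean number of isolated points in a set \<open>A\<close> is therefore
\<open>n \<bar>A\<bar> P(Poisson(a\<^sub>n + u) < k)\<close>, which is asymptotically \<open>b\<^sub>n \<bar>A\<bar> e\<^sup>-\<^sup>u / (k - 1)!\<close>
(\<open>mean_isolated_count\<close>, \<open>mean_count_above_limit\<close>). Up to the factor \<open>b\<^sub>n\<close>, this is the mass that the
limit gives to unit masses at points of \<open>A \<times> [u, \<infinity>]\<close>.

Two isolated points are much rarer (\<open>mean_isolated_pairs\<close>, \<open>mean_multiple_limit\<close>). A partner at a
distance below \<open>e r\<close> uses up one of the \<open>k - 1\<close> neighbours that are allowed, which costs a factor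
\<open>a\<^sub>n\<close>, while there are about \<open>e\<^sup>d a\<^sub>n\<close> possible partners: the contribution is of order \<open>e\<^sup>d b\<^sub>n\<close>, and
\<open>e\<close> is arbitrary. For a partner between \<open>e r\<close> and \<open>2 r\<close>, the second ball has a part outside the first
whose expected number of points is at least \<open>e (a\<^sub>n + u) / 4\<close>, and the probability that this part is
almost empty decays exponentially in \<open>a\<^sub>n\<close>. Farther partners are independent and contribute
\<open>O(b\<^sub>n\<^sup>2)\<close>, and the first assumption on \<open>a\<^sub>n\<close> forces \<open>b\<^sub>n \<longlonglongrightarrow> 0\<close> (\<open>b_tendsto_0\<close>).

On the topological side, a function \<open>g\<close> of the class \<open>C0\<close> vanishes on the point measures without atoms
in a certain strip (\<open>vague_nbhd_null\<close>). If a point measure has exactly one atom \<open>y\<close> in a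
sufficiently large strip, then \<open>g\<close> takes almost the same value there as at the unit mass at \<open>y\<close>,
uniformly in \<open>y\<close>, by compactness of strips (\<open>uniform_locality\<close>). Hence \<open>g(L\<^sub>n)\<close> may be replaced by the
sum of \<open>g(\<delta>\<^sub>y)\<close> over the atoms \<open>y\<close> of \<open>L\<^sub>n\<close>, up to an error that is small or supported by paths with
several atoms (\<open>pathwise_bound\<close>). Step functions on rectangles (\<open>step_approximation\<close>) reduce the
mean of this sum to the mean numbers of isolated points.

The expectations are computed from counts in finitely many disjoint sets. The torus is cut into small
cells, and isolation of the points of a cell is replaced by a condition on a ball around a
representative of the cell with the cell removed; this condition is independent of the count in the
cell. For a given finite configuration the replacement is exact once the cells are small enough
(\<open>discretized_count\<close>). This takes the place of the Mecke formula, and also shows that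
the counts are measurable. That \<open>L\<^sub>n\<close> is a random element of the space of point measures then follows
because the vague topology, being metrizable and separable, is second countable
(\<open>measurable_vagueI\<close>).
\<close>

section \<open>Geometry of the flat torus\<close>

definition frac_vec :: "real ^ 'd \<Rightarrow> real ^ 'd" where
  "frac_vec x = (\<chi> i. frac (x $ i))"

definition lattice :: "(real ^ 'd) set" where
  "lattice = {z. \<forall>i. z $ i \<in> \<int>}"

lemma lattice_closed [simp, intro]:
  "0 \<in> lattice" "z \<in> lattice \<Longrightarrow> w \<in> lattice \<Longrightarrow> z + w \<in> lattice"
  "z \<in> lattice \<Longrightarrow> - z \<in> lattice" "z \<in> lattice \<Longrightarrow> w \<in> lattice \<Longrightarrow> z - w \<in> lattice"
  by (auto simp: lattice_def)

lemma countable_lattice: "countable (lattice :: (real ^ 'd) set)"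
proof -
  have "lattice \<subseteq> range (\<lambda>m :: int ^ 'd. \<chi> i. real_of_int (m $ i))"
  proof
    fix z :: "real ^ 'd" assume z: "z \<in> lattice"
    have "z = (\<chi> i. real_of_int ((\<chi> i. \<lfloor>z $ i\<rfloor>) $ i))"
      using z by (auto simp: lattice_def vec_eq_iff)
    then show "z \<in> range (\<lambda>m :: int ^ 'd. \<chi> i. real_of_int (m $ i))" by blast
  qed
  moreover have "countable (UNIV :: (int ^ 'd) set)"
  proof -
    have "inj (vec_nth :: int ^ 'd \<Rightarrow> 'd \<Rightarrow> int)"
      by (simp add: inj_def vec_eq_iff fun_eq_iff)
    moreover have "countable (UNIV :: ('d \<Rightarrow> int) set)"
      by (rule countableI_type)
    ultimately show ?thesis
      by (metis countable_image_inj_on countable_subset subset_UNIV)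
  qed
  ultimately show ?thesis
    by (meson countable_image countable_subset)
qed

lemma frac_vec_in_torus [simp]: "frac_vec x \<in> torus"
  by (simp add: torus_def frac_vec_def frac_lt_1)

lemma frac_vec_torus [simp]: "x \<in> torus \<Longrightarrow> frac_vec x = x"
  by (simp add: torus_def frac_vec_def vec_eq_iff frac_eq)

lemma diff_frac_vec_lattice: "x - frac_vec x \<in> lattice"
  by (simp add: lattice_def frac_vec_def frac_def)

lemma frac_vec_eq_iff: "frac_vec x = frac_vec y \<longleftrightarrow> x - y \<in> lattice"
proof
  assume "frac_vec x = frac_vec y"
  then have "x - y = (x - frac_vec x) - (y - frac_vec y)" by simp
  then show "x - y \<in> lattice" using diff_frac_vec_lattice lattice_closed(4) by metis
next
  assume "x - y \<in> lattice"
  have "frac (x $ i) = frac (y $ i)" for i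
  proof -
    from \<open>x - y \<in> lattice\<close> obtain m where "x $ i - y $ i = of_int m"
      unfolding lattice_def by (auto elim: Ints_cases)
    then have "x $ i = y $ i + of_int m" by simp
    then show ?thesis by (simp add: frac_def)
  qed
  then show "frac_vec x = frac_vec y" by (simp add: frac_vec_def vec_eq_iff)
qed

lemma torus_dist_less_iff:
  "torus_dist x y < e \<longleftrightarrow> (\<exists>z\<in>lattice. norm (x - y + z) < e)"
proof
  assume "torus_dist x y < e"
  then obtain z where "\<forall>i. z $ i \<in> \<int>" "norm (x - y + z) < e" by (rule torus_dist_approx)
  then show "\<exists>z\<in>lattice. norm (x - y + z) < e" by (auto simp: lattice_def)
next
  assume "\<exists>z\<in>lattice. norm (x - y + z) < e"
  then obtain z where "z \<in> lattice" "norm (x - y + z) < e" by blast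
  then show "torus_dist x y < e" using torus_dist_le[of z x y] by (simp add: lattice_def)
qed

lemma torus_dist_frac_vec: "torus_dist (frac_vec x) (frac_vec y) = torus_dist x y"
proof -
  have *: "torus_dist (frac_vec x) (frac_vec y) < e \<longleftrightarrow> torus_dist x y < e" for e
  proof
    assume "torus_dist (frac_vec x) (frac_vec y) < e"
    then obtain z where "z \<in> lattice" "norm (frac_vec x - frac_vec y + z) < e"
      by (auto simp: torus_dist_less_iff)
    moreover have "frac_vec x - frac_vec y + z = x - y + (z - (x - frac_vec x) + (y - frac_vec y))"
      by simp
    ultimately show "torus_dist x y < e"
      unfolding torus_dist_less_iff using diff_frac_vec_lattice lattice_closed by metis
  next
    assume "torus_dist x y < e"
    then obtain z where "z \<in> lattice" "norm (x - y + z) < e"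
      by (auto simp: torus_dist_less_iff)
    moreover have "x - y + z = frac_vec x - frac_vec y + (z + (x - frac_vec x) - (y - frac_vec y))"
      by simp
    ultimately show "torus_dist (frac_vec x) (frac_vec y) < e"
      unfolding torus_dist_less_iff using diff_frac_vec_lattice lattice_closed by metis
  qed
  then show ?thesis by (metis linorder_neq_iff)
qed

lemma torus_dist_le_norm: "torus_dist x y \<le> norm (x - y)"
  using torus_dist_le[of 0 x y] by simp

lemma continuous_map_frac_vec: "continuous_map euclidean torus_topology frac_vec"
  unfolding torus.continuous_map_to_metric
proof (intro ballI allI impI)
  fix x :: "real ^ 'd" and e :: real assume "0 < e"
  show "\<exists>U. openin euclidean U \<and> x \<in> U \<and> (\<forall>y\<in>U. frac_vec y \<in> torus.mball (frac_vec x) e)"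
  proof (intro exI[of _ "ball x e"] conjI ballI)
    fix y assume "y \<in> ball x e"
    then have "torus_dist (frac_vec x) (frac_vec y) < e"
      using torus_dist_le_norm[of x y] by (simp add: torus_dist_frac_vec dist_norm)
    then show "frac_vec y \<in> torus.mball (frac_vec x) e" by simp
  qed (use \<open>0 < e\<close> in auto)
qed

lemma compact_torus: "compactin torus_topology (torus :: (real ^ 'd) set)"
proof -
  have "frac_vec ` cbox 0 1 = (torus :: (real ^ 'd) set)"
  proof (intro equalityI subsetI)
    fix x :: "real ^ 'd" assume x: "x \<in> torus"
    then have "x \<in> cbox 0 1" by (auto simp: torus_def mem_box_cart less_imp_le)
    then show "x \<in> frac_vec ` cbox 0 1" using frac_vec_torus[OF x] by force
  qed auto
  moreover have "compactin torus_topology (frac_vec ` cbox 0 (1 :: real ^ 'd))"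
    by (rule image_compactin[OF _ continuous_map_frac_vec]) (simp add: compactin_euclidean_iff)
  ultimately show ?thesis by simp
qed

lemma openin_torus_imp_euclidean:
  assumes "openin torus_topology U" shows "\<exists>T. open T \<and> U = torus \<inter> T"
proof (intro exI conjI)
  show "open {x. frac_vec x \<in> U}"
    using continuous_map_frac_vec assms unfolding continuous_map by auto
  show "U = torus \<inter> {x. frac_vec x \<in> U}"
    using openin_subset[OF assms] by auto
qed

lemma torus_borel [measurable, simp]: "torus \<in> sets borel"
proof -
  have "(torus :: (real ^ 'd) set) = (\<Inter>i\<in>UNIV. {x. 0 \<le> x $ i} \<inter> {x. x $ i < 1})"
    by (auto simp: torus_def)
  also have "\<dots> \<in> sets borel"
    by (rule sets.finite_INT)
       (auto intro!: sets.Int borel_closed borel_open closed_Collect_le open_Collect_less continuous_intros)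
  finally show ?thesis .
qed

lemma space_borel_of [simp]: "space (borel_of X) = topspace X"
  unfolding borel_of_def by (intro space_measure_of) (auto dest: openin_subset)

lemma sets_borel_of: "sets (borel_of X) = sigma_sets (topspace X) {U. openin X U}"
  unfolding borel_of_def by (intro sets_measure_of) (auto dest: openin_subset)

lemma openin_sets_borel_of: "openin X U \<Longrightarrow> U \<in> sets (borel_of X)"
  by (auto simp: sets_borel_of)

lemma closedin_sets_borel_of: "closedin X U \<Longrightarrow> U \<in> sets (borel_of X)"
  using sets.compl_sets[OF openin_sets_borel_of[of X "topspace X - U"]]
  by (auto simp: closedin_def double_diff)

lemma borel_torus_imp_borel:
  assumes "A \<in> sets (borel_of torus_topology)" shows "A \<in> sets borel"
proof -
  have "A \<in> sigma_sets torus {U. openin torus_topology U}" using assms by (simp add: sets_borel_of)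
  then show ?thesis
  proof induction
    case (Basic a) then obtain T where "open T" "a = torus \<inter> T" using openin_torus_imp_euclidean by blast
    then show ?case by auto
  next
    case (Compl a) then show ?case by auto
  qed auto
qed

lemma borel_torus_subset: "A \<in> sets (borel_of torus_topology) \<Longrightarrow> A \<subseteq> torus"
  using sets.sets_into_space by fastforce

lemma emeasure_lebesgue_torus:
  "A \<in> sets (borel_of torus_topology) \<Longrightarrow> emeasure lebesgue_torus A = emeasure lborel A"
  unfolding lebesgue_torus_def
  by (subst emeasure_restrict_space) (auto dest: borel_torus_subset borel_torus_imp_borel)

lemma mball_borel [simp]: "torus.mball x r \<in> sets (borel_of torus_topology)"
  by (intro openin_sets_borel_of) simp

text \<open>Reduction modulo the lattice cuts \<open>B\<close> into countably many pieces and translates each of them;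
injectivity keeps the translated pieces disjoint. This is how Euclidean volumes are transferred to
the torus.\<close>

lemma emeasure_frac_vec_image:
  fixes B :: "(real ^ 'd) set"
  assumes B: "B \<in> sets borel" and inj: "inj_on frac_vec B"
  shows "frac_vec ` B \<in> sets borel" "emeasure lborel (frac_vec ` B) = emeasure lborel B"
proof -
  define C where "C z = {v \<in> B. v - z \<in> torus}" for z :: "real ^ 'd"
  have C: "C z \<in> sets borel" for z
  proof -
    have "C z = B \<inter> ((\<lambda>v. v - z) -` torus \<inter> space borel)" by (auto simp: C_def)
    also have "\<dots> \<in> sets borel"
      by (intro sets.Int B measurable_sets[OF _ torus_borel]) measurable
    finally show ?thesis .
  qed
  have fC: "frac_vec v = v - z" if "v \<in> C z" "z \<in> lattice" for v z
    using frac_vec_eq_iff[of v "v - z"] that by (simp add: C_def)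
  have img: "frac_vec ` C z = (+) (- z) ` C z" if "z \<in> lattice" for z
    using fC[OF _ that] by (auto simp: image_iff)
  have img': "(+) (- z) ` C z = (\<lambda>v. v + z) -` C z \<inter> space borel" for z
    by (auto simp: image_iff algebra_simps intro!: bexI[of _ "_ + z"])
  have mimg: "frac_vec ` C z \<in> sets borel" if "z \<in> lattice" for z
    unfolding img[OF that] img' by (intro measurable_sets[OF _ C]) measurable
  have eimg: "emeasure lborel (frac_vec ` C z) = emeasure lborel (C z)" if "z \<in> lattice" for z
  proof -
    have "emeasure lborel (C z) = emeasure (distr lborel borel ((+) z)) (C z)"
      by (metis lborel_distr_plus)
    also have "\<dots> = emeasure lborel ((+) z -` C z \<inter> space lborel)"
      by (rule emeasure_distr) (use C in auto)
    also have "(+) z -` C z \<inter> space lborel = frac_vec ` C z"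
      unfolding img[OF that] img' by (auto simp: add.commute)
    finally show ?thesis by simp
  qed
  have UB: "B = (\<Union>z\<in>lattice. C z)"
  proof (intro equalityI subsetI)
    fix v assume "v \<in> B"
    then have "v \<in> C (v - frac_vec v)" by (simp add: C_def)
    then show "v \<in> (\<Union>z\<in>lattice. C z)" using diff_frac_vec_lattice by blast
  qed (auto simp: C_def)
  have Ui: "frac_vec ` B = (\<Union>z\<in>lattice. frac_vec ` C z)"
    by (subst UB) blast
  have disj: "disjoint_family_on C lattice"
    unfolding disjoint_family_on_def
  proof (intro ballI impI equals0I)
    fix z w v assume "z \<in> lattice" "w \<in> lattice" "z \<noteq> w" "v \<in> C z \<inter> C w"
    then show False using fC[of v z] fC[of v w] by auto
  qed
  have disj': "disjoint_family_on (\<lambda>z. frac_vec ` C z) lattice"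
    unfolding disjoint_family_on_def
  proof (intro ballI impI equals0I)
    fix z w y assume zw: "z \<in> lattice" "w \<in> lattice" "z \<noteq> w" "y \<in> frac_vec ` C z \<inter> frac_vec ` C w"
    then obtain v v' where "v \<in> C z" "v' \<in> C w" "frac_vec v = y" "frac_vec v' = y" by auto
    moreover from this have "v = v'" using inj by (auto simp: C_def inj_on_def)
    ultimately show False using disj zw by (auto simp: disjoint_family_on_def)
  qed
  show "frac_vec ` B \<in> sets borel"
    unfolding Ui by (rule sets.countable_UN'[OF countable_lattice]) (use mimg in auto)
  have "emeasure lborel (frac_vec ` B) = (\<integral>\<^sup>+z. emeasure lborel (frac_vec ` C z) \<partial>count_space lattice)"
    unfolding Ui using mimg by (intro emeasure_UN_countable countable_lattice disj') auto
  also have "\<dots> = (\<integral>\<^sup>+z. emeasure lborel (C z) \<partial>count_space lattice)"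
    by (intro nn_integral_cong) (simp add: eimg)
  also have "\<dots> = emeasure lborel B"
    by (subst UB, rule emeasure_UN_countable[symmetric]) (auto simp: C countable_lattice disj)
  finally show "emeasure lborel (frac_vec ` B) = emeasure lborel B" .
qed

lemma norm_lattice_ge_1:
  fixes z :: "real ^ 'd"
  assumes "z \<in> lattice" "norm z < 1" shows "z = 0"
proof -
  have "z $ i = 0" for i
  proof -
    have "\<bar>z $ i\<bar> < 1" using component_le_norm_cart[of z i] assms by simp
    moreover have "z $ i \<in> \<int>" using assms by (simp add: lattice_def)
    ultimately show ?thesis using Ints_nonzero_abs_less1 by blast
  qed
  then show ?thesis by (simp add: vec_eq_iff)
qed

lemma inj_on_frac_vec_ball:
  fixes x :: "real ^ 'd"
  assumes "r \<le> 1 / 2" shows "inj_on frac_vec (ball x r)"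
proof (rule inj_onI)
  fix v w assume vw: "v \<in> ball x r" "w \<in> ball x r" "frac_vec v = frac_vec w"
  have "norm (v - w) < 1"
    using vw assms dist_triangle_less_add[of v x r w r] by (simp add: dist_norm norm_minus_commute)
  then show "v = w" using vw norm_lattice_ge_1[of "v - w"] by (simp add: frac_vec_eq_iff)
qed

lemma mball_eq_frac_vec_image:
  assumes "x \<in> torus" shows "torus.mball x r = frac_vec ` ball x r"
proof (intro equalityI subsetI)
  fix y assume "y \<in> torus.mball x r"
  then have y: "y \<in> torus" "torus_dist x y < r" by auto
  then obtain z where z: "z \<in> lattice" "norm (x - y + z) < r" by (auto simp: torus_dist_less_iff)
  have "frac_vec (y - z) = y" using y z frac_vec_eq_iff[of "y - z" y] by simp
  moreover have "y - z \<in> ball x r" using z by (simp add: dist_norm algebra_simps)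
  ultimately show "y \<in> frac_vec ` ball x r" by force
next
  fix y assume "y \<in> frac_vec ` ball x r"
  then obtain v where v: "y = frac_vec v" "norm (x - v) < r" by (auto simp: dist_norm)
  have "torus_dist x y = torus_dist x v" using torus_dist_frac_vec[of x v] assms v by simp
  then show "y \<in> torus.mball x r"
    using torus_dist_le_norm[of x v] v assms by simp
qed

lemma emeasure_ball_cart:
  assumes "0 \<le> r"
  shows "emeasure lborel (ball (x :: real ^ 'd) r) = ennreal (unit_ball_volume TYPE('d) * r ^ CARD('d))"
  using assms emeasure_ball[of r x] content_cball[of 1 "0 :: real ^ 'd"] by (simp add: unit_ball_volume_def)

lemma unit_ball_volume_pos: "0 < unit_ball_volume TYPE('d::finite)"
  using content_cball[of 1 "0 :: real ^ 'd"] by (simp add: unit_ball_volume_def unit_ball_vol_pos)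

lemma emeasure_mball:
  fixes x :: "real ^ 'd"
  assumes "x \<in> torus" "0 \<le> r" "r \<le> 1 / 2"
  shows "emeasure lborel (torus.mball x r) = ennreal (unit_ball_volume TYPE('d) * r ^ CARD('d))"
  using emeasure_frac_vec_image[of "ball x r"] assms inj_on_frac_vec_ball[of r x] emeasure_ball_cart[of r x]
  by (simp add: mball_eq_frac_vec_image)

lemma emeasure_torus: "emeasure lborel (torus :: (real ^ 'd) set) = 1"
proof -
  have "torus \<subseteq> cbox (0 :: real ^ 'd) 1" "box 0 1 \<subseteq> (torus :: (real ^ 'd) set)"
    by (auto simp: torus_def mem_box_cart less_imp_le)
  then have "emeasure lborel (torus :: (real ^ 'd) set) \<le> emeasure lborel (cbox (0 :: real ^ 'd) 1)"
    "emeasure lborel (box (0 :: real ^ 'd) 1) \<le> emeasure lborel (torus :: (real ^ 'd) set)"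
    by (auto intro!: emeasure_mono)
  moreover have "emeasure lborel (cbox (0 :: real ^ 'd) 1) = 1" "emeasure lborel (box (0 :: real ^ 'd) 1) = 1"
  proof -
    have one: "b \<in> Basis \<Longrightarrow> (1 :: real ^ 'd) \<bullet> b = 1" for b
      by (auto simp: Basis_vec_def inner_axis)
    then have "(\<Prod>b\<in>Basis. (1 - 0 :: real ^ 'd) \<bullet> b) = 1" by (intro prod.neutral) simp
    then show "emeasure lborel (cbox (0 :: real ^ 'd) 1) = 1" "emeasure lborel (box (0 :: real ^ 'd) 1) = 1"
      using one by (simp_all add: emeasure_lborel_cbox_eq emeasure_lborel_box_eq)
  qed
  ultimately show ?thesis by simp
qed

text \<open>By translation invariance, each further move of the second ball by \<open>w\<close> uncovers at most as much of
the first ball as the first move did. After about \<open>2 * r / norm w\<close> moves the two balls are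
disjoint, so a single move uncovers at least the corresponding fraction. This bounds the volume of
the lune from below, linearly in \<open>norm w\<close>, without computing it.\<close>

lemma measure_ball_diff_ball:
  fixes x w :: "'a :: euclidean_space"
  assumes "0 < r" "w \<noteq> 0"
  shows "measure lborel (ball x r) \<le> (2 * r / norm w + 1) * measure lborel (ball x r - ball (x + w) r)"
proof -
  define f where "f j = measure lborel (ball x r - ball (x + real j *\<^sub>R w) r)" for j :: nat
  have fin: "ball y r - C \<in> fmeasurable lborel" if "C \<in> sets borel" for y :: 'a and C
    using that by (intro fmeasurable_Diff) (auto simp: fmeasurable_def emeasure_ball less_imp_le[OF \<open>0 < r\<close>])
  have shift: "measure lborel (ball (x + v) r - ball (x + v + w) r) = f 1" for v
  proof -
    have "measure lborel (ball (x + v) r - ball (x + v + w) r)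
        = measure (distr lborel borel ((+) v)) (ball (x + v) r - ball (x + v + w) r)"
      by (metis lborel_distr_plus)
    also have "\<dots> = measure lborel ((+) v -` (ball (x + v) r - ball (x + v + w) r) \<inter> space lborel)"
      by (rule measure_distr) auto
    also have "(+) v -` (ball (x + v) r - ball (x + v + w) r) \<inter> space lborel = ball x r - ball (x + w) r"
      by (auto simp: dist_norm algebra_simps)
    finally show ?thesis by (simp add: f_def)
  qed
  have lin: "f j \<le> real j * f 1" for j
  proof (induction j)
    case (Suc j)
    have "f (Suc j) \<le> measure lborel ((ball x r - ball (x + real j *\<^sub>R w) r)
       \<union> (ball (x + real j *\<^sub>R w) r - ball (x + real j *\<^sub>R w + w) r))"
      unfolding f_def
      by (intro measure_mono_fmeasurable fmeasurable.Un fin) (auto simp: algebra_simps)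
    also have "\<dots> \<le> f j + f 1"
      using measure_Un_le[of "ball x r - ball (x + real j *\<^sub>R w) r" lborel
          "ball (x + real j *\<^sub>R w) r - ball (x + real j *\<^sub>R w + w) r"] shift[of "real j *\<^sub>R w"]
      by (simp add: f_def)
    finally show ?case using Suc by (simp add: algebra_simps)
  qed (simp add: f_def)
  define j where "j = nat \<lceil>2 * r / norm w\<rceil>"
  have "2 * r / norm w > 0" using assms by simp
  then have j: "2 * r / norm w \<le> real j" "real j \<le> 2 * r / norm w + 1"
    unfolding j_def by linarith+
  have "ball x r \<inter> ball (x + real j *\<^sub>R w) r = {}"
  proof (rule equals0I)
    fix y assume "y \<in> ball x r \<inter> ball (x + real j *\<^sub>R w) r"
    then have "dist x (x + real j *\<^sub>R w) < 2 * r"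
      using dist_triangle_less_add[of x y r "x + real j *\<^sub>R w" r] by (simp add: dist_commute)
    then show False using j(1) assms by (simp add: dist_norm field_simps)
  qed
  then have "measure lborel (ball x r) = f j" unfolding f_def by (simp add: Diff_triv)
  also have "\<dots> \<le> real j * f 1" by (rule lin)
  also have "\<dots> \<le> (2 * r / norm w + 1) * f 1"
    using j(2) by (intro mult_right_mono) (auto simp: f_def)
  finally show ?thesis by (simp add: f_def)
qed

text \<open>Two balls that meet are lifted to Euclidean balls whose centres differ by a vector of length less
than \<open>2 * r\<close>. Since \<open>r \<le> 1 / 4\<close>, no other lattice translate of the second ball meets the first
one, so the torus lune contains a copy of the Euclidean lune.\<close>

lemma emeasure_mball_diff_mball:
  fixes x y :: "real ^ 'd"
  assumes xy: "x \<in> torus" "y \<in> torus" and r: "0 < r" "r \<le> 1 / 4" and e: "0 < e" "e \<le> 1"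
    and d: "e * r \<le> torus_dist x y"
  shows "ennreal (unit_ball_volume TYPE('d) * r ^ CARD('d) * e / 4)
           \<le> emeasure lborel (torus.mball x r - torus.mball y r)"
proof (cases "torus_dist x y < 2 * r")
  case False
  have "torus.mball x r \<inter> torus.mball y r = {}"
    using False torus.triangle[of x _ y] xy by (force simp: torus.commute)
  then have "torus.mball x r - torus.mball y r = torus.mball x r" by blast
  moreover have "unit_ball_volume TYPE('d) * r ^ CARD('d) * e / 4 \<le> unit_ball_volume TYPE('d) * r ^ CARD('d)"
    using e r unit_ball_volume_pos[where 'd = 'd]
    by (intro mult_left_le[of "e / 4", simplified times_divide_eq_right]) auto
  ultimately show ?thesis using xy r by (simp add: emeasure_mball ennreal_leI)
next
  case True
  then obtain z where z: "z \<in> lattice" "norm (x - y + z) < 2 * r" by (auto simp: torus_dist_less_iff)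
  define w where "w = (y - z) - x"
  have nw: "norm w < 2 * r" "e * r \<le> norm w"
    using z d torus_dist_le[of z x y] unfolding w_def lattice_def
    by (auto simp: norm_minus_commute algebra_simps)
  have er: "0 < e * r" using r e by simp
  then have w0: "0 < norm w" using nw by linarith
  let ?A = "ball x r - ball (x + w) r"
  have sub: "frac_vec ` ?A \<subseteq> torus.mball x r - torus.mball y r"
  proof (intro subsetI DiffI)
    fix u assume u: "u \<in> frac_vec ` ?A"
    then show "u \<in> torus.mball x r" using xy by (auto simp: mball_eq_frac_vec_image)
    show "u \<notin> torus.mball y r"
    proof
      assume "u \<in> torus.mball y r"
      then have "u \<in> frac_vec ` ball y r" using xy by (simp add: mball_eq_frac_vec_image)
      then obtain v v' where v: "v \<in> ?A" "v' \<in> ball y r" "frac_vec v = frac_vec v'"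
        using u by auto
      have l: "v - (v' - z) \<in> lattice" using v(3) z(1) frac_vec_eq_iff[of v v']
        by (metis diff_diff_eq2 lattice_closed(2) add_diff_eq diff_add_eq)
      have "norm (v - (v' - z)) = norm ((v - x) + (x - (y - z)) + (y - v'))" by (simp add: algebra_simps)
      also have "\<dots> \<le> norm (v - x) + norm (x - (y - z)) + norm (y - v')"
        by (intro norm_triangle_le add_right_mono norm_triangle_ineq) simp
      also have "\<dots> < 1" using v(1,2) z(2) r by (simp add: dist_norm norm_minus_commute algebra_simps)
      finally have "v = v' - z" using norm_lattice_ge_1[OF l] by simp
      then have "v \<in> ball (x + w) r" using v(2) by (simp add: w_def dist_norm algebra_simps)
      then show False using v(1) by simp
    qed
  qed
  have inj: "inj_on frac_vec ?A"
    by (rule inj_on_subset[OF inj_on_frac_vec_ball[of r x]]) (use r in auto)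
  let ?V = "unit_ball_volume TYPE('d) * r ^ CARD('d)"
  have V: "0 < ?V" using unit_ball_volume_pos[where 'd = 'd] r by auto
  have mV: "measure lborel (ball x r) = ?V"
    using emeasure_ball_cart[of r x] r V by (simp add: measure_def)
  have "2 * r / norm w + 1 \<le> 2 * r / (e * r) + 1"
    using nw r er by (intro add_right_mono divide_left_mono mult_pos_pos) (use w0 er e in auto)
  also have "\<dots> \<le> 4 / e" using e r by (simp add: field_simps)
  finally have "2 * r / norm w + 1 \<le> 4 / e" .
  then have "?V \<le> 4 / e * measure lborel ?A"
    using measure_ball_diff_ball[of r w x] w0 r mV
    by (smt (verit) mult_right_mono measure_nonneg zero_less_norm_iff)
  then have "?V * e / 4 \<le> measure lborel ?A" using e by (simp add: field_simps)
  then have "ennreal (?V * e / 4) \<le> ennreal (measure lborel ?A)" by (rule ennreal_leI)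
  also have "\<dots> = emeasure lborel ?A"
    by (rule emeasure_eq_ennreal_measure[symmetric])
       (use emeasure_mono[of ?A "ball x r" lborel] emeasure_ball_cart[of r x] r in \<open>auto simp: top_unique\<close>)
  also have "\<dots> = emeasure lborel (frac_vec ` ?A)"
    by (rule emeasure_frac_vec_image(2)[symmetric]) (use inj in auto)
  also have "\<dots> \<le> emeasure lborel (torus.mball x r - torus.mball y r)"
    using borel_torus_imp_borel[OF sets.Diff[OF mball_borel[of x r] mball_borel[of y r]]]
    by (intro emeasure_mono sub) simp
  finally show ?thesis .
qed

text \<open>By compactness finitely many balls of radius \<open>\<delta>\<close> cover the torus; \<open>\<kappa>\<close> sends a point to the first
centre, in a fixed order, whose ball contains it.\<close>

lemma torus_partition:
  assumes "0 < \<delta>"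
  obtains \<kappa> :: "real ^ 'd \<Rightarrow> real ^ 'd" where
    "finite (\<kappa> ` torus)" "\<And>x. x \<in> torus \<Longrightarrow> \<kappa> x \<in> torus"
    "\<And>c. {x \<in> torus. \<kappa> x = c} \<in> sets (borel_of torus_topology)"
    "\<And>x. x \<in> torus \<Longrightarrow> torus_dist (\<kappa> x) x < \<delta>"
proof -
  have "\<exists>\<F>. finite \<F> \<and> \<F> \<subseteq> (\<lambda>c. torus.mball c \<delta>) ` torus \<and> (torus :: (real ^ 'd) set) \<subseteq> \<Union>\<F>"
    using compact_torus assms unfolding compactin_def
    by (intro compactinD[OF compact_torus]) force+
  then obtain C :: "(real ^ 'd) set" where C: "finite C" "C \<subseteq> torus" "torus \<subseteq> (\<Union>c\<in>C. torus.mball c \<delta>)"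
    by (metis finite_subset_image)
  then obtain cs where cs: "set cs = C" using finite_list by blast
  define \<kappa> where "\<kappa> x = the (find (\<lambda>c. x \<in> torus.mball c \<delta>) cs)" for x
  have k: "find (\<lambda>c. x \<in> torus.mball c \<delta>) cs = Some (\<kappa> x)" if x: "x \<in> torus" for x
  proof (cases "find (\<lambda>c. x \<in> torus.mball c \<delta>) cs")
    case None
    then have "\<not> (\<exists>c\<in>C. x \<in> torus.mball c \<delta>)" using cs by (auto simp: find_None_iff)
    moreover have "\<exists>c\<in>C. x \<in> torus.mball c \<delta>" using C(3) x by blast
    ultimately show ?thesis by contradiction
  qed (simp add: \<kappa>_def)
  have k2: "\<kappa> x \<in> C \<and> x \<in> torus.mball (\<kappa> x) \<delta>" if x: "x \<in> torus" for x
  proof -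
    from k[OF x] obtain i where "i < length cs" "x \<in> torus.mball (cs ! i) \<delta>" "\<kappa> x = cs ! i"
      unfolding find_Some_iff by auto
    then show ?thesis using cs by auto
  qed
  show thesis
  proof
    show "finite (\<kappa> ` torus)" using k2 C(1) by (meson finite_subset image_subsetI)
    show "\<kappa> x \<in> torus" if "x \<in> torus" for x using k2 that C by auto
    show "torus_dist (\<kappa> x) x < \<delta>" if "x \<in> torus" for x using k2[OF that] by auto
    show "{x \<in> torus. \<kappa> x = c} \<in> sets (borel_of torus_topology)" for c
    proof -
      have "{x \<in> torus. \<kappa> x = c} =
        (\<Union>i\<in>{i. i < length cs \<and> cs ! i = c}. torus.mball (cs ! i) \<delta> - (\<Union>j\<in>{..<i}. torus.mball (cs ! j) \<delta>))"
        (is "?L = ?R")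
      proof (intro equalityI subsetI)
        fix x assume "x \<in> ?L"
        then have "find (\<lambda>c. x \<in> torus.mball c \<delta>) cs = Some c" using k by auto
        then show "x \<in> ?R" unfolding find_Some_iff by auto
      next
        fix x assume x: "x \<in> ?R"
        then have xt: "x \<in> torus" by auto
        from x have "find (\<lambda>c. x \<in> torus.mball c \<delta>) cs = Some c" unfolding find_Some_iff by auto
        then show "x \<in> ?L" using k[OF xt] xt by simp
      qed
      also have "\<dots> \<in> sets (borel_of torus_topology)"
        by (intro sets.finite_UN sets.Diff) auto
      finally show ?thesis .
    qed
  qed
qed

section \<open>Point measures on \<open>E\<close>\<close>

text \<open>The strips are cofinal among the compact subsets of \<open>E\<close>: compactness amounts to the marks being
bounded away from \<open>-\<infinity>\<close>.\<close>

definition strip :: "real \<Rightarrow> ((real ^ 'd) \<times> ereal) set" where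
  "strip t = torus \<times> {ereal t..}"

lemma topspace_E [simp]: "topspace E_topology = torus \<times> {-\<infinity><..}"
  by (simp add: E_topology_def)

lemma strip_subset: "strip t \<subseteq> torus \<times> {-\<infinity><..}"
  by (auto simp: strip_def)

lemma strip_mono: "s \<le> t \<Longrightarrow> strip t \<subseteq> strip s"
  by (auto simp: strip_def intro: order_trans[of "ereal s" "ereal t"])

lemma closedin_strip: "closedin E_topology (strip t)"
proof -
  have "closedin (top_of_set {-\<infinity><..}) {ereal t..}"
    unfolding closedin_closed by (intro exI[of _ "{ereal t..}"]) auto
  moreover have "closedin torus_topology (torus :: (real ^ 'd) set)"
    using closedin_topspace[of torus_topology] by simp
  ultimately show ?thesis unfolding strip_def E_topology_def by (simp add: closedin_prod_Times_iff)
qed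

lemma compactin_strip: "compactin E_topology (strip t)"
proof -
  have "compact {ereal t..}"
    using compact_Int_closed[OF compact_UNIV, of "{ereal t..}"] by simp
  then have "compactin (top_of_set {-\<infinity><..}) {ereal t..}"
    by (auto simp: compactin_subtopology compactin_euclidean_iff)
  then show ?thesis unfolding strip_def E_topology_def by (simp add: compactin_Times compact_torus)
qed

lemma strip_borel [simp]: "strip t \<in> sets (borel_of E_topology)"
  by (rule closedin_sets_borel_of[OF closedin_strip])

lemma compactin_E_subset_strip:
  assumes K: "compactin E_topology K"
  shows "\<exists>t. K \<subseteq> strip t"
proof (cases "K = {}")
  case False
  have KE: "K \<subseteq> torus \<times> {-\<infinity><..}" using compactin_subset_topspace[OF K] by simp
  have "compactin (top_of_set {-\<infinity><..}) (snd ` K)"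
    using image_compactin[OF K[unfolded E_topology_def]] continuous_map_snd by blast
  then have "compact (snd ` K)" by (simp add: compactin_subtopology compactin_euclidean_iff)
  then obtain s where s: "s \<in> snd ` K" "\<And>u. u \<in> snd ` K \<Longrightarrow> s \<le> u"
    using compact_attains_inf[of "snd ` K"] False by auto
  then have "s \<noteq> -\<infinity>" using KE by auto
  then obtain t where "ereal t \<le> s" by (cases s) auto
  have "K \<subseteq> strip t"
  proof
    fix y assume y: "y \<in> K"
    then have "s \<le> snd y" using s(2) by blast
    then show "y \<in> strip t" using \<open>ereal t \<le> s\<close> y KE by (cases y) (auto simp: strip_def)
  qed
  then show ?thesis by blast
qed simp

lemma borel_measurable_continuous_map:
  assumes "continuous_map X euclideanreal f" shows "f \<in> borel_measurable (borel_of X)"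
proof (rule borel_measurableI)
  fix S :: "real set" assume "open S"
  then have "openin X {x \<in> topspace X. f x \<in> S}"
    using assms openin_continuous_map_preimage by fastforce
  moreover have "f -` S \<inter> space (borel_of X) = {x \<in> topspace X. f x \<in> S}" by auto
  ultimately show "f -` S \<inter> space (borel_of X) \<in> sets (borel_of X)" by (simp add: openin_sets_borel_of)
qed

lemma measurable_continuous_map:
  assumes "continuous_map X Y f" shows "f \<in> measurable (borel_of X) (borel_of Y)"
  unfolding borel_of_def[of Y]
proof (rule measurable_measure_of)
  show "f \<in> space (borel_of X) \<rightarrow> topspace Y" using assms by (auto simp: continuous_map_def)
  fix U assume "U \<in> {U. openin Y U}"
  then have "openin X {x \<in> topspace X. f x \<in> U}" using assms by (auto simp: continuous_map_def)
  moreover have "f -` U \<inter> space (borel_of X) = {x \<in> topspace X. f x \<in> U}" by auto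
  ultimately show "f -` U \<inter> space (borel_of X) \<in> sets (borel_of X)" by (simp add: openin_sets_borel_of)
qed (auto dest: openin_subset)

lemma Cc_nonneg_continuous: "f \<in> Cc_nonneg X \<Longrightarrow> continuous_map X euclideanreal f"
  by (simp add: Cc_nonneg_def)

lemma Cc_nonneg_support_strip:
  assumes "f \<in> Cc_nonneg E_topology"
  shows "\<exists>t. \<forall>y\<in>topspace E_topology - strip t. f y = 0"
proof -
  obtain t where t: "E_topology closure_of {x \<in> topspace E_topology. f x \<noteq> 0} \<subseteq> strip t"
    using assms compactin_E_subset_strip unfolding Cc_nonneg_def by blast
  have "{x \<in> topspace E_topology. f x \<noteq> 0} \<subseteq> E_topology closure_of {x \<in> topspace E_topology. f x \<noteq> 0}"
    by (rule closure_of_subset) auto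
  then show ?thesis using t by blast
qed

lemma point_measures_sets:
  "\<mu> \<in> point_measures X \<Longrightarrow> sets \<mu> = sets (borel_of X)"
  by (auto simp: point_measures_def)

lemma point_measures_space:
  "\<mu> \<in> point_measures X \<Longrightarrow> space \<mu> = topspace X"
  by (auto simp: point_measures_def)

lemma point_measures_compact_finite:
  "\<mu> \<in> point_measures X \<Longrightarrow> compactin X K \<Longrightarrow> emeasure \<mu> K < \<infinity>"
  by (simp add: point_measures_def)

lemma point_measuresE:
  assumes "\<mu> \<in> point_measures X"
  obtains p and I :: "nat set" where "p \<in> I \<rightarrow> topspace X" "\<mu> = distr (count_space I) (borel_of X) p"
  using assms unfolding point_measures_def by blast

lemma emeasure_point_sum:
  assumes "p \<in> I \<rightarrow> topspace X" "A \<in> sets (borel_of X)"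
  shows "emeasure (distr (count_space I) (borel_of X) p) A = emeasure (count_space I) {i \<in> I. p i \<in> A}"
proof -
  have "p -` A \<inter> I = {i \<in> I. p i \<in> A}" by auto
  then show ?thesis using assms by (subst emeasure_distr) auto
qed

lemma finite_points_in:
  assumes "distr (count_space I) (borel_of X) p \<in> point_measures X" "p \<in> I \<rightarrow> topspace X"
    "A \<in> sets (borel_of X)" "emeasure (distr (count_space I) (borel_of X) p) A < \<infinity>"
  shows "finite {i \<in> I. p i \<in> A}"
proof (rule ccontr)
  assume "infinite {i \<in> I. p i \<in> A}"
  then have "emeasure (count_space I) {i \<in> I. p i \<in> A} = \<infinity>"
    by (intro emeasure_count_space_infinite) auto
  then show False using assms(4) emeasure_point_sum[OF assms(2,3)] by simp
qed

lemma integral_point_sum: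
  fixes f :: "'a \<Rightarrow> real"
  assumes p: "p \<in> I \<rightarrow> topspace X" and f: "f \<in> borel_measurable (borel_of X)"
    and J: "finite J" "J \<subseteq> I" "\<And>i. i \<in> I - J \<Longrightarrow> f (p i) = 0"
  shows "(\<integral>y. f y \<partial>distr (count_space I) (borel_of X) p) = (\<Sum>i\<in>J. f (p i))"
proof -
  have "(\<integral>y. f y \<partial>distr (count_space I) (borel_of X) p) = (\<integral>i. f (p i) \<partial>count_space I)"
    using p f by (subst integral_distr) auto
  also have "\<dots> = (\<Sum>i | i \<in> I \<and> f (p i) \<noteq> 0. f (p i))"
    using J by (intro lebesgue_integral_count_space_finite_support finite_subset[OF _ J(1)]) auto
  also have "\<dots> = (\<Sum>i\<in>J. f (p i))"
    using J by (intro sum.mono_neutral_cong_left) auto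
  finally show ?thesis .
qed

lemma finite_point_sum_in_point_measures:
  fixes I :: "nat set"
  assumes "finite I" "p \<in> I \<rightarrow> topspace X"
  shows "distr (count_space I) (borel_of X) p \<in> point_measures X"
  unfolding point_measures_def
proof (intro CollectI conjI allI impI exI[of _ I] exI[of _ p] assms refl)
  fix K assume "compactin X K"
  have "emeasure (distr (count_space I) (borel_of X) p) K \<le> emeasure (distr (count_space I) (borel_of X) p) (topspace X)"
    using emeasure_space[of "distr (count_space I) (borel_of X) p" K] by simp
  also have "\<dots> < \<infinity>"
    using assms sets.top[of "borel_of X"] by (subst emeasure_point_sum) (auto simp: of_nat_less_top)
  finally show "emeasure (distr (count_space I) (borel_of X) p) K < \<infinity>" .
qed

lemma dirac_eq_point_sum:
  assumes "y \<in> topspace X"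
  shows "dirac X y = distr (count_space {0 :: nat}) (borel_of X) (\<lambda>_. y)"
proof (rule measure_eqI)
  fix A assume "A \<in> sets (dirac X y)"
  then have A: "A \<in> sets (borel_of X)" by simp
  have "{i \<in> {0 :: nat}. y \<in> A} = (if y \<in> A then {0} else {})" by auto
  then show "emeasure (dirac X y) A = emeasure (distr (count_space {0 :: nat}) (borel_of X) (\<lambda>_. y)) A"
    using assms A by (subst emeasure_point_sum) auto
qed simp

lemma dirac_in_point_measures: "y \<in> topspace X \<Longrightarrow> dirac X y \<in> point_measures X"
  by (simp add: dirac_eq_point_sum finite_point_sum_in_point_measures)

lemma null_eq_point_sum: "null_measure (borel_of X) = distr (count_space {}) (borel_of X) (\<lambda>_ :: nat. undefined)"
  by (rule measure_eqI) (auto simp: emeasure_point_sum)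

lemma null_in_point_measures: "null_measure (borel_of X) \<in> point_measures X"
  unfolding null_eq_point_sum by (rule finite_point_sum_in_point_measures) auto

lemma topspace_vague: "topspace (vague_topology X) = point_measures X"
proof -
  have "(\<lambda>_. 0) \<in> Cc_nonneg X" by (simp add: Cc_nonneg_def)
  then show ?thesis unfolding vague_topology_def topology_generated_by_topspace
    by (auto intro!: exI[of _ "point_measures X"] exI[of _ "\<lambda>_. 0"] exI[of _ UNIV])
qed

section \<open>Neighbourhoods in the vague topology\<close>

text \<open>Above the level \<open>t\<close>, the measure \<open>\<mu>\<close> looks like the sum of the unit masses at the points \<open>p i\<close>,
\<open>i \<in> I\<close>, each moved within its set \<open>W i\<close>; the points \<open>p i\<close> below \<open>t\<close> may be kept or dropped. The
condition is phrased by integrals, so that it can be checked for measures that are given by an atom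
and a strip of measure zero as well as for explicit sums.\<close>

definition vague_close :: "nat set \<Rightarrow> (nat \<Rightarrow> (real ^ 'd) \<times> ereal) \<Rightarrow> (nat \<Rightarrow> ((real ^ 'd) \<times> ereal) set) \<Rightarrow>
    real \<Rightarrow> ((real ^ 'd) \<times> ereal) measure \<Rightarrow> bool" where
  "vague_close I p W t \<mu> \<longleftrightarrow> \<mu> \<in> point_measures E_topology \<and>
     (\<exists>J q. finite J \<and> J \<subseteq> I \<and> {i \<in> I. p i \<in> strip t} \<subseteq> J \<and> (\<forall>i\<in>J. q i \<in> W i) \<and>
       (\<forall>f :: (real ^ 'd) \<times> ereal \<Rightarrow> real. f \<in> borel_measurable (borel_of E_topology) \<longrightarrow>
          (\<forall>y\<in>topspace E_topology - strip t. f y = 0) \<longrightarrow> (\<integral>y. f y \<partial>\<mu>) = (\<Sum>i\<in>J. f (q i))))"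

lemma vague_close_mono:
  fixes \<mu> :: "((real ^ 'd) \<times> ereal) measure"
  assumes "vague_close I p W t \<mu>" "t \<le> s" "\<And>i. i \<in> I \<Longrightarrow> W i \<subseteq> V i"
  shows "vague_close I p V s \<mu>"
proof -
  from assms(1) obtain J q where J: "\<mu> \<in> point_measures E_topology"
    "finite J" "J \<subseteq> I" "{i \<in> I. p i \<in> strip t} \<subseteq> J" "\<forall>i\<in>J. q i \<in> W i"
    "\<And>f :: (real ^ 'd) \<times> ereal \<Rightarrow> real. f\<in>borel_measurable (borel_of E_topology) \<Longrightarrow>
          (\<forall>y\<in>topspace E_topology - strip t. f y = 0) \<Longrightarrow> (\<integral>y. f y \<partial>\<mu>) = (\<Sum>i\<in>J. f (q i))"
    unfolding vague_close_def by blast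
  have sub: "strip s \<subseteq> (strip t :: ((real ^ 'd) \<times> ereal) set)" using strip_mono assms(2) by blast
  show ?thesis unfolding vague_close_def
  proof (intro conjI exI[of _ J] exI[of _ q] ballI allI impI J(1-3))
    show "{i \<in> I. p i \<in> strip s} \<subseteq> J" using J(4) sub by blast
    show "q i \<in> V i" if "i \<in> J" for i
      using subsetD[OF assms(3)[OF subsetD[OF J(3) that]] bspec[OF J(5) that]] .
    show "(\<integral>y. f y \<partial>\<mu>) = (\<Sum>i\<in>J. f (q i))"
      if "f \<in> borel_measurable (borel_of E_topology)" "\<forall>y\<in>topspace E_topology - strip s. f y = 0"
      for f :: "(real ^ 'd) \<times> ereal \<Rightarrow> real"
    proof (rule J(6)[OF that(1)])
      show "\<forall>y\<in>topspace E_topology - strip t. f y = 0" using that(2) sub by blast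
    qed
  qed
qed

text \<open>The vague topology is generated by conditions on \<open>\<integral>f d\<mu>\<close> with \<open>f\<close> of compact support. Such an
\<open>f\<close> vanishes below some level, and above that level a locally finite \<open>\<mu>\<close> has finitely many atoms,
which may be moved a little. Finite intersections and arbitrary unions preserve the property.
The cases of interest are that \<open>I\<close> is empty (\<open>vague_nbhd_null\<close>), a singleton (\<open>vague_nbhd_dirac\<close>)
or arbitrary (\<open>countable_dense_vague\<close>).\<close>

lemma vague_open_imp_vague_close:
  fixes V :: "((real ^ 'd) \<times> ereal) measure set"
  assumes "openin (vague_topology E_topology) V"
    and p: "p \<in> I \<rightarrow> topspace E_topology"
    and "distr (count_space I) (borel_of E_topology) p \<in> V"
  shows "\<exists>t W. (\<forall>i\<in>I. openin E_topology (W i) \<and> p i \<in> W i) \<and> (\<forall>\<mu>. vague_close I p W t \<mu> \<longrightarrow> \<mu> \<in> V)"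
proof -
  let ?S = "{{\<mu> \<in> point_measures E_topology. (\<integral>x. f x \<partial>\<mu>) \<in> U} | f U.
      f \<in> Cc_nonneg (E_topology :: ((real ^ 'd) \<times> ereal) topology) \<and> open U}"
  let ?\<nu> = "distr (count_space I) (borel_of E_topology) p"
  have "generate_topology_on ?S V"
    using assms(1) unfolding vague_topology_def by (rule openin_topology_generated_by)
  then show ?thesis using assms(3)
  proof induction
    case Empty then show ?case by simp
  next
    case (Int V1 V2)
    obtain t1 W1 where 1: "\<forall>i\<in>I. openin E_topology (W1 i) \<and> p i \<in> W1 i"
      "\<forall>\<mu>. vague_close I p W1 t1 \<mu> \<longrightarrow> \<mu> \<in> V1"
      using Int(3,5) by blast
    obtain t2 W2 where 2: "\<forall>i\<in>I. openin E_topology (W2 i) \<and> p i \<in> W2 i"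
      "\<forall>\<mu>. vague_close I p W2 t2 \<mu> \<longrightarrow> \<mu> \<in> V2"
      using Int(4,5) by blast
    show ?case
    proof (intro exI[of _ "min t1 t2"] exI[of _ "\<lambda>i. W1 i \<inter> W2 i"] conjI ballI allI impI)
      fix \<mu> assume "vague_close I p (\<lambda>i. W1 i \<inter> W2 i) (min t1 t2) \<mu>"
      then have "vague_close I p W1 t1 \<mu>" "vague_close I p W2 t2 \<mu>"
        by (auto elim!: vague_close_mono)
      then show "\<mu> \<in> V1 \<inter> V2" using 1 2 by blast
    qed (use 1 2 in auto)
  next
    case (UN K)
    from UN.prems obtain V' where V': "V' \<in> K" "?\<nu> \<in> V'" by blast
    from UN.IH[OF this] obtain t W where "\<forall>i\<in>I. openin E_topology (W i) \<and> p i \<in> W i"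
      "\<forall>\<mu>. vague_close I p W t \<mu> \<longrightarrow> \<mu> \<in> V'" by blast
    then show ?case using V'(1) by (intro exI[of _ t] exI[of _ W]) blast
  next
    case (Basis V)
    then obtain f U where V: "V = {\<mu> \<in> point_measures E_topology. (\<integral>x. f x \<partial>\<mu>) \<in> U}"
      and f: "f \<in> Cc_nonneg E_topology" and U: "open U" by blast
    have pm: "?\<nu> \<in> point_measures E_topology" and inU: "(\<integral>x. f x \<partial>?\<nu>) \<in> U"
      using Basis V by auto
    note fm = borel_measurable_continuous_map[OF Cc_nonneg_continuous[OF f]]
    obtain t where t: "\<forall>y\<in>topspace E_topology - strip t. f y = 0"
      using Cc_nonneg_support_strip[OF f] by blast
    define J0 where "J0 = {i \<in> I. p i \<in> strip t}"
    have fin: "finite J0" unfolding J0_def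
      using point_measures_compact_finite[OF pm compactin_strip[of t]]
      by (intro finite_points_in[OF pm p]) simp_all
    have int: "(\<integral>x. f x \<partial>?\<nu>) = (\<Sum>i\<in>J0. f (p i))"
      using fin p t by (intro integral_point_sum fm) (auto simp: J0_def)
    obtain e where e: "0 < e" "ball (\<integral>x. f x \<partial>?\<nu>) e \<subseteq> U" using U inU openE by blast
    \<comment> \<open>The tolerance is shared by the atoms; adding one avoids division by zero.\<close>
    define e' where "e' = e / (real (card J0) + 1)"
    have e': "0 < e'" "real (card J0) * e' < e" using e(1) by (auto simp: e'_def field_simps)
    define W where "W i = (if i \<in> J0 then {y \<in> topspace E_topology. f y \<in> ball (f (p i)) e'}
       else topspace E_topology - strip t)" for i
    show ?case
    proof (intro exI[of _ t] exI[of _ W] conjI ballI allI impI)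
      fix i assume i: "i \<in> I"
      show "openin E_topology (W i)"
        using openin_diff[OF openin_topspace closedin_strip[where 'a = 'd, of t]] openin_continuous_map_preimage[OF Cc_nonneg_continuous[OF f], of "ball (f (p i)) e'"]
        unfolding W_def by simp
      show "p i \<in> W i" using i p e'(1) by (auto simp: W_def J0_def)
    next
      fix \<mu> assume cl: "vague_close I p W t \<mu>"
      then obtain J q where J: "\<mu> \<in> point_measures E_topology" "finite J" "J \<subseteq> I" "J0 \<subseteq> J"
        "\<And>i. i \<in> J \<Longrightarrow> q i \<in> W i" "(\<integral>y. f y \<partial>\<mu>) = (\<Sum>i\<in>J. f (q i))"
        unfolding vague_close_def J0_def using fm t by blast
      have q0: "f (q i) = 0" if "i \<in> J - J0" for i
        using J(5)[of i] that t unfolding W_def by auto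
      have "(\<Sum>i\<in>J. f (q i)) = (\<Sum>i\<in>J0. f (q i))"
        using J(2,4) q0 by (intro sum.mono_neutral_right) auto
      then have "\<bar>(\<integral>y. f y \<partial>\<mu>) - (\<integral>x. f x \<partial>?\<nu>)\<bar> = \<bar>\<Sum>i\<in>J0. f (q i) - f (p i)\<bar>"
        unfolding J(6) int by (simp add: sum_subtractf)
      also have "\<dots> \<le> (\<Sum>i\<in>J0. \<bar>f (q i) - f (p i)\<bar>)" by (rule sum_abs)
      also have "\<dots> \<le> (\<Sum>i\<in>J0. e')"
        using J(4,5) by (intro sum_mono) (force simp: W_def dist_real_def)
      also have "\<dots> < e" using e' by simp
      finally have "(\<integral>y. f y \<partial>\<mu>) \<in> ball (\<integral>x. f x \<partial>?\<nu>) e" by (simp add: dist_real_def)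
      then show "\<mu> \<in> V" using J(1) e(2) V by blast
    qed
  qed
qed

text \<open>A continuous function that vanishes near the null measure vanishes on all point measures without
atoms in a certain strip: this is what ties the class \<open>C0\<close> to exceedances of a level.\<close>

lemma vague_nbhd_null:
  fixes V :: "((real ^ 'd) \<times> ereal) measure set"
  assumes "openin (vague_topology E_topology) V" "null_measure (borel_of E_topology) \<in> V"
  shows "\<exists>t. \<forall>\<mu>\<in>point_measures E_topology. emeasure \<mu> (strip t) = 0 \<longrightarrow> \<mu> \<in> V"
proof -
  obtain t W where tW: "\<And>\<mu>. vague_close {} (\<lambda>_. undefined) W t \<mu> \<Longrightarrow> \<mu> \<in> V"
    using vague_open_imp_vague_close[OF assms(1), of "\<lambda>_. undefined" "{}"] assms(2)
    unfolding null_eq_point_sum by auto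
  show ?thesis
  proof (intro exI[of _ t] ballI impI)
    fix \<mu> :: "((real ^ 'd) \<times> ereal) measure"
    assume \<mu>: "\<mu> \<in> point_measures E_topology" "emeasure \<mu> (strip t) = 0"
    have "(\<integral>y. f y \<partial>\<mu>) = 0" if "\<forall>y\<in>topspace E_topology - strip t. f y = 0" for f :: "(real ^ 'd) \<times> ereal \<Rightarrow> real"
    proof (rule integral_eq_zero_AE, rule AE_I[of _ _ "strip t"])
      show "{x \<in> space \<mu>. f x \<noteq> 0} \<subseteq> strip t" using that \<mu>(1) by (auto simp: point_measures_space)
    qed (use \<mu> in \<open>auto simp: point_measures_sets\<close>)
    then have "vague_close {} (\<lambda>_. undefined) W t \<mu>"
      unfolding vague_close_def using \<mu> by (intro conjI exI[of _ "{}"]) auto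
    then show "\<mu> \<in> V" by (rule tW)
  qed
qed

lemma Hausdorff_E: "Hausdorff_space (E_topology :: ((real ^ 'd) \<times> ereal) topology)"
proof -
  have "Hausdorff_space (euclidean :: ereal topology)"
    unfolding Hausdorff_space_def using hausdorff by (fastforce simp: disjnt_def)
  then show ?thesis unfolding E_topology_def
    by (simp add: Hausdorff_space_prod_topology torus.Hausdorff_space_mtopology Hausdorff_space_subtopology)
qed

lemma singleton_borel_E [simp]: "y \<in> torus \<times> {-\<infinity><..} \<Longrightarrow> {y} \<in> sets (borel_of E_topology)"
  by (intro closedin_sets_borel_of) (simp add: Hausdorff_E closedin_Hausdorff_singleton)

lemma integral_single_point:
  fixes f :: "(real ^ 'd) \<times> ereal \<Rightarrow> real"
  assumes \<mu>: "sets \<mu> = sets (borel_of E_topology)" and y: "y \<in> topspace E_topology"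
    and 1: "emeasure \<mu> {y} = 1" and 0: "emeasure \<mu> (strip t - {y}) = 0"
    and f: "\<forall>y\<in>topspace E_topology - strip t. f y = 0"
    and fm: "f \<in> borel_measurable (borel_of E_topology)"
  shows "(\<integral>z. f z \<partial>\<mu>) = f y"
proof -
  have sp: "space \<mu> = topspace E_topology" using sets_eq_imp_space_eq[OF \<mu>] by simp
  have y1: "{y} \<in> sets \<mu>" using y \<mu> by simp
  have "(\<integral>z. f z \<partial>\<mu>) = (\<integral>z. indicator {y} z * f y \<partial>\<mu>)"
  proof (rule integral_cong_AE)
    have "strip t - {y} \<in> sets \<mu>" by (rule sets.Diff[OF _ y1]) (simp add: \<mu>)
    then have "AE z in \<mu>. z \<notin> strip t - {y}"
      using 0 by (intro AE_not_in) (simp add: null_sets_def)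
    then show "AE z in \<mu>. f z = indicator {y} z * f y"
      using AE_space
    proof eventually_elim
      case (elim z)
      then show ?case using f by (cases "z = y") (auto simp: sp)
    qed
  qed (use y1 fm \<mu> in \<open>auto cong: measurable_cong_sets\<close>)
  also have "\<dots> = f y" using y1 1 by (simp add: measure_def)
  finally show ?thesis .
qed

lemma vague_nbhd_dirac:
  fixes V :: "((real ^ 'd) \<times> ereal) measure set"
  assumes "openin (vague_topology E_topology) V" "y0 \<in> topspace E_topology" "dirac E_topology y0 \<in> V"
  shows "\<exists>t W. openin E_topology W \<and> y0 \<in> W \<and>
           (\<forall>y\<in>W. \<forall>\<mu>\<in>point_measures E_topology.
              emeasure \<mu> {y} = 1 \<and> emeasure \<mu> (strip t - {y}) = 0 \<longrightarrow> \<mu> \<in> V)"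
proof -
  obtain t W where W: "openin E_topology (W 0)" "y0 \<in> W 0"
    and tW: "\<And>\<mu>. vague_close {0} (\<lambda>_. y0) W t \<mu> \<Longrightarrow> \<mu> \<in> V"
    using vague_open_imp_vague_close[OF assms(1), of "\<lambda>_. y0" "{0}"] assms(2,3)
    unfolding dirac_eq_point_sum[OF assms(2)] by auto
  show ?thesis
  proof (intro exI[of _ t] exI[of _ "W 0"] conjI ballI impI W)
    fix y \<mu> assume y: "y \<in> W 0" and \<mu>: "\<mu> \<in> point_measures E_topology"
      "emeasure \<mu> {y} = 1 \<and> emeasure \<mu> (strip t - {y}) = 0"
    have "y \<in> topspace E_topology" using openin_subset[OF W(1)] y by blast
    then have "vague_close {0} (\<lambda>_. y0) W t \<mu>"
      unfolding vague_close_def using \<mu> y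
      by (intro conjI exI[of _ "{0}"] exI[of _ "\<lambda>_. y"])
         (auto intro!: integral_single_point simp: point_measures_sets)
    then show "\<mu> \<in> V" by (rule tW)
  qed
qed

lemma continuous_map_dirac:
  "continuous_map E_topology (vague_topology E_topology)
     (dirac (E_topology :: ((real ^ 'd) \<times> ereal) topology))"
  unfolding continuous_map_def
proof (intro conjI allI impI)
  show "dirac E_topology \<in> topspace E_topology \<rightarrow> topspace (vague_topology E_topology)"
    unfolding topspace_vague by (intro Pi_I dirac_in_point_measures)
  fix V :: "((real ^ 'd) \<times> ereal) measure set" assume V: "openin (vague_topology E_topology) V"
  let ?U = "{y \<in> topspace E_topology. dirac E_topology y \<in> V}"
  show "openin E_topology ?U"
  proof (subst openin_subopen, intro ballI)
    fix y0 assume "y0 \<in> ?U"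
    then obtain t W where W: "openin E_topology W" "y0 \<in> W"
      "\<forall>y\<in>W. \<forall>\<mu>\<in>point_measures E_topology.
         emeasure \<mu> {y} = 1 \<and> emeasure \<mu> (strip t - {y}) = 0 \<longrightarrow> \<mu> \<in> V"
      using vague_nbhd_dirac[OF V, of y0] by auto
    have "W \<subseteq> ?U"
    proof
      fix y assume y: "y \<in> W"
      then have yE: "y \<in> topspace E_topology" using openin_subset[OF W(1)] by blast
      then have "dirac E_topology y \<in> V"
        using y by (intro W(3)[rule_format, of y] dirac_in_point_measures) (auto simp: sets.Diff)
      then show "y \<in> ?U" using yE by simp
    qed
    then show "\<exists>T. openin E_topology T \<and> y0 \<in> T \<and> T \<subseteq> ?U" using W by blast
  qed
qed

section \<open>Separability of the vague topology\<close>

lemma countable_dense_E: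
  obtains Q :: "((real ^ 'd) \<times> ereal) set" where "countable Q" "Q \<subseteq> topspace E_topology"
    "\<forall>W. openin E_topology W \<longrightarrow> W \<noteq> {} \<longrightarrow> W \<inter> Q \<noteq> {}"
proof -
  obtain D1 :: "(real ^ 'd) set" where D1: "countable D1" "\<And>X. open X \<Longrightarrow> X \<noteq> {} \<Longrightarrow> \<exists>d\<in>D1. d \<in> X"
    using countable_dense_exists by metis
  obtain D2 :: "ereal set" where D2: "countable D2" "\<And>X. open X \<Longrightarrow> X \<noteq> {} \<Longrightarrow> \<exists>d\<in>D2. d \<in> X"
    using countable_dense_exists by metis
  let ?Q = "frac_vec ` D1 \<times> (D2 \<inter> {-\<infinity><..})"
  show thesis
  proof
    show "countable ?Q" using D1 D2 by auto
    show "?Q \<subseteq> topspace E_topology" by auto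
    show "\<forall>W. openin E_topology W \<longrightarrow> W \<noteq> {} \<longrightarrow> W \<inter> ?Q \<noteq> {}"
      proof (intro allI impI)
      fix W :: "((real ^ 'd) \<times> ereal) set" assume W: "openin E_topology W" "W \<noteq> {}"
      then obtain x u where xu: "(x, u) \<in> W" by auto
      obtain A B where AB: "openin torus_topology A" "openin (top_of_set {-\<infinity><..}) B"
        "x \<in> A" "u \<in> B" "A \<times> B \<subseteq> W"
        using openin_prod_topology_alt[THEN iffD1, OF W(1)[unfolded E_topology_def], rule_format, OF xu]
        by metis
      have "open {v. frac_vec v \<in> A}"
        using openin_continuous_map_preimage[OF continuous_map_frac_vec AB(1)] by simp
      moreover have "x \<in> {v. frac_vec v \<in> A}"
        using AB(3) subsetD[OF openin_subset[OF AB(1)] AB(3)] by simp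
      ultimately obtain d where d: "d \<in> D1" "frac_vec d \<in> A" using D1(2) by blast
      have "open B" using AB(2) by (simp add: openin_open_eq)
      then obtain e where e: "e \<in> D2" "e \<in> B" using D2(2) AB(4) by blast
      moreover have "e \<in> {-\<infinity><..}" using e(2) openin_subset[OF AB(2)] by auto
      ultimately show "W \<inter> ?Q \<noteq> {}" using d AB(5) by blast
    qed
  qed
qed

text \<open>To approximate a point measure, keep the finitely many atoms in a strip, move them into a countable
dense set and drop the other atoms.\<close>

lemma countable_dense_vague:
  obtains D :: "((real ^ 'd) \<times> ereal) measure set" where "countable D" "D \<subseteq> point_measures E_topology"
    "\<forall>V. openin (vague_topology E_topology) V \<longrightarrow> V \<noteq> {} \<longrightarrow> V \<inter> D \<noteq> {}"
proof -
  obtain Q :: "((real ^ 'd) \<times> ereal) set" where Q: "countable Q" "Q \<subseteq> topspace E_topology"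
    "\<forall>W. openin E_topology W \<longrightarrow> W \<noteq> {} \<longrightarrow> W \<inter> Q \<noteq> {}"
    by (rule countable_dense_E)
  define m where "m xs = distr (count_space {..<length xs}) (borel_of E_topology) (nth xs)"
    for xs :: "((real ^ 'd) \<times> ereal) list"
  show thesis
  proof
    show "countable (m ` lists Q)" using Q(1) by auto
    have m: "nth xs \<in> {..<length xs} \<rightarrow> topspace E_topology" if "xs \<in> lists Q" for xs
      using that Q(2) nth_mem by fastforce
    then have mpm: "m xs \<in> point_measures E_topology" if "xs \<in> lists Q" for xs
      using that unfolding m_def by (intro finite_point_sum_in_point_measures) auto
    then show "m ` lists Q \<subseteq> point_measures E_topology" by blast
    show "\<forall>V. openin (vague_topology E_topology) V \<longrightarrow> V \<noteq> {} \<longrightarrow> V \<inter> m ` lists Q \<noteq> {}"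
      proof (intro allI impI)
      fix V :: "((real ^ 'd) \<times> ereal) measure set"
      assume V: "openin (vague_topology E_topology) V" "V \<noteq> {}"
      then obtain \<mu> where \<mu>: "\<mu> \<in> V" "\<mu> \<in> point_measures E_topology"
        using openin_subset[OF V(1)] by (auto simp: topspace_vague)
      obtain p and I :: "nat set" where p: "p \<in> I \<rightarrow> topspace E_topology" "\<mu> = distr (count_space I) (borel_of E_topology) p"
        by (rule point_measuresE[OF \<mu>(2)])
      obtain t W where W: "\<And>i. i \<in> I \<Longrightarrow> openin E_topology (W i) \<and> p i \<in> W i"
        and tW: "\<And>\<mu>. vague_close I p W t \<mu> \<Longrightarrow> \<mu> \<in> V"
        using vague_open_imp_vague_close[OF V(1) p(1)] \<mu>(1) p(2) by metis
      define J where "J = {i \<in> I. p i \<in> strip t}"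
      have fin: "finite J" unfolding J_def
        using point_measures_compact_finite[OF \<mu>(2) compactin_strip[of t]] \<mu>(2) unfolding p(2)
        by (intro finite_points_in[OF _ p(1)]) simp_all
      have "\<exists>z. z \<in> W i \<inter> Q" if "i \<in> I" for i using Q(3)[rule_format, of "W i"] W[OF that] by blast
      then obtain q where q: "\<And>i. i \<in> I \<Longrightarrow> q i \<in> W i \<and> q i \<in> Q" by (metis IntE)
      define xs where "xs = map q (sorted_list_of_set J)"
      have xs: "xs \<in> lists Q" using q fin by (auto simp: xs_def J_def)
      have "vague_close I p W t (m xs)"
        unfolding vague_close_def
      proof (intro conjI exI[of _ J] exI[of _ q] ballI allI impI fin)
        fix f :: "(real ^ 'd) \<times> ereal \<Rightarrow> real" assume f: "f \<in> borel_measurable (borel_of E_topology)"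
        have "(\<integral>y. f y \<partial>m xs) = (\<Sum>i<length xs. f (xs ! i))"
          unfolding m_def by (rule integral_point_sum[OF m[OF xs] f]) auto
        also have "\<dots> = sum_list (map f xs)"
          by (simp add: sum_list_sum_nth atLeast0LessThan)
        also have "\<dots> = (\<Sum>i\<in>J. f (q i))"
          using fin unfolding xs_def by (simp add: sum.distinct_set_conv_list[symmetric] comp_def)
        finally show "(\<integral>y. f y \<partial>m xs) = (\<Sum>i\<in>J. f (q i))" .
      qed (use q mpm xs in \<open>auto simp: J_def\<close>)
      then show "V \<inter> m ` lists Q \<noteq> {}" using tW xs by blast
    qed
  qed
qed

lemma second_countable_vague:
  assumes "vague_metric (E_topology :: ((real ^ 'd) \<times> ereal) topology) \<rho>"
  shows "second_countable (vague_topology (E_topology :: ((real ^ 'd) \<times> ereal) topology))"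
proof -
  interpret M: Metric_space "point_measures (E_topology :: ((real ^ 'd) \<times> ereal) topology)" \<rho>
    using assms by (simp add: vague_metric_def)
  have top: "M.mtopology = vague_topology E_topology" using assms by (simp add: vague_metric_def)
  obtain D :: "((real ^ 'd) \<times> ereal) measure set" where D: "countable D" "D \<subseteq> point_measures E_topology"
    "\<forall>V. openin (vague_topology E_topology) V \<longrightarrow> V \<noteq> {} \<longrightarrow> V \<inter> D \<noteq> {}"
    by (rule countable_dense_vague)
  let ?B = "(\<lambda>(d, n). M.mball d (inverse (real (Suc n)))) ` (D \<times> UNIV)"
  show ?thesis unfolding second_countable_def
  proof (intro exI[of _ ?B] conjI ballI allI impI)
    show "countable ?B" using D(1) by auto
    show "openin (vague_topology E_topology) V" if "V \<in> ?B" for V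
      using that unfolding top[symmetric] by auto
    fix U and \<mu> :: "((real ^ 'd) \<times> ereal) measure" assume U: "openin (vague_topology E_topology) U \<and> \<mu> \<in> U"
    then have \<mu>: "\<mu> \<in> point_measures E_topology" using openin_subset by (fastforce simp: topspace_vague)
    from U obtain r where r: "0 < r" "M.mball \<mu> r \<subseteq> U"
      unfolding top[symmetric] M.openin_mtopology by blast
    obtain n where n: "inverse (real (Suc n)) < r / 2" using reals_Archimedean[of "r / 2"] r by auto
    have "M.mball \<mu> (inverse (real (Suc n))) \<inter> D \<noteq> {}"
    proof (rule D(3)[rule_format])
      have "\<mu> \<in> M.mball \<mu> (inverse (real (Suc n)))" using \<mu> by simp
      then show "M.mball \<mu> (inverse (real (Suc n))) \<noteq> {}" by blast
    qed (simp add: top[symmetric])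
    then obtain d where d: "d \<in> D" "\<rho> \<mu> d < inverse (real (Suc n))" by auto
    have dpm: "d \<in> point_measures E_topology" using d D by blast
    have "M.mball d (inverse (real (Suc n))) \<subseteq> M.mball \<mu> r"
    proof
      fix \<nu> assume "\<nu> \<in> M.mball d (inverse (real (Suc n)))"
      then show "\<nu> \<in> M.mball \<mu> r"
        using d \<mu> dpm n M.triangle[of \<mu> d \<nu>] by auto
    qed
    moreover have "\<mu> \<in> M.mball d (inverse (real (Suc n)))" using d \<mu> dpm by (simp add: M.commute)
    ultimately show "\<exists>V\<in>?B. \<mu> \<in> V \<and> V \<subseteq> U" using d(1) r(2) by force
  qed
qed

text \<open>Arbitrary unions of open sets reduce to countable ones since every subspace of a second countable
space is Lindelof. Hence it suffices to check the preimages of the generating open sets.\<close>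

lemma measurable_vagueI:
  fixes L :: "'w \<Rightarrow> ((real ^ 'd) \<times> ereal) measure"
  assumes "vague_metric (E_topology :: ((real ^ 'd) \<times> ereal) topology) \<rho>"
    and Lpm: "\<And>\<omega>. \<omega> \<in> space M \<Longrightarrow> L \<omega> \<in> point_measures E_topology"
    and Lf: "\<And>f. f \<in> Cc_nonneg E_topology \<Longrightarrow> (\<lambda>\<omega>. \<integral>y. f y \<partial>L \<omega>) \<in> borel_measurable M"
  shows "L \<in> measurable M (borel_of (vague_topology E_topology))"
  unfolding borel_of_def
proof (rule measurable_measure_of)
  show "L \<in> space M \<rightarrow> topspace (vague_topology E_topology)" using Lpm by (auto simp: topspace_vague)
  let ?S = "{{\<mu> \<in> point_measures E_topology. (\<integral>x. f x \<partial>\<mu>) \<in> U} | f U.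
      f \<in> Cc_nonneg (E_topology :: ((real ^ 'd) \<times> ereal) topology) \<and> open U}"
  fix V :: "((real ^ 'd) \<times> ereal) measure set" assume "V \<in> {U. openin (vague_topology E_topology) U}"
  then have "generate_topology_on ?S V"
    unfolding vague_topology_def by (auto intro: openin_topology_generated_by)
  then show "L -` V \<inter> space M \<in> sets M"
  proof induction
    case (Int a b)
    have "L -` (a \<inter> b) \<inter> space M = (L -` a \<inter> space M) \<inter> (L -` b \<inter> space M)" by auto
    then show ?case using Int by auto
  next
    case (UN K)
    let ?T = "subtopology (vague_topology E_topology) (\<Union>K)"
    have op: "openin (vague_topology E_topology) k" if "k \<in> K" for k
      using UN(1)[OF that] unfolding vague_topology_def openin_topology_generated_by_iff .
    have "Lindelof_space ?T"
      by (intro second_countable_imp_Lindelof_space second_countable_subtopology second_countable_vague[OF assms(1)])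
    moreover have "openin ?T k" if "k \<in> K" for k
      using op[OF that] that by (auto simp: openin_subtopology intro!: exI[of _ k])
    moreover have "\<Union>K = topspace ?T" using op openin_subset by (fastforce simp: topspace_subtopology)
    ultimately obtain K' where K': "countable K'" "K' \<subseteq> K" "\<Union>K' = \<Union>K"
      unfolding Lindelof_space_def by metis
    have "L -` (\<Union>K) \<inter> space M = (\<Union>k\<in>K'. L -` k \<inter> space M)" unfolding K'(3)[symmetric] by blast
    also have "\<dots> \<in> sets M" using K' UN(2) by (intro sets.countable_UN') auto
    finally show ?case .
  next
    case (Basis V)
    then obtain f U where V: "V = {\<mu> \<in> point_measures E_topology. (\<integral>x. f x \<partial>\<mu>) \<in> U}"
      and f: "f \<in> Cc_nonneg E_topology" and U: "open U" by blast
    have "L -` V \<inter> space M = (\<lambda>\<omega>. \<integral>y. f y \<partial>L \<omega>) -` U \<inter> space M"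
      using Lpm unfolding V by auto
    then show ?case using measurable_sets[OF Lf[OF f], of U] U by auto
  qed simp
qed (auto dest: openin_subset)

section \<open>Borel sets of the torus\<close>

text \<open>For \<open>c \<ge> 0\<close> this half-space does not reach the seam of the torus: a ball of radius at most both
\<open>x $ i - c\<close> and \<open>1 - x $ i\<close> around \<open>x\<close> meets neither of the faces that are glued together.\<close>

lemma openin_coordinate_gt:
  assumes "0 \<le> c" shows "openin torus_topology {x \<in> torus. c < x $ i}"
  unfolding torus.openin_mtopology
proof (intro conjI ballI allI impI)
  show "{x \<in> torus. c < x $ i} \<subseteq> torus" by auto
  fix x :: "real ^ 'a" assume "x \<in> {x \<in> torus. c < x $ i}"
  then have x: "x \<in> torus" "c < x $ i" "x $ i < 1" by (auto simp: torus_def)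
  show "\<exists>r>0. torus.mball x r \<subseteq> {x \<in> torus. c < x $ i}"
  proof (intro exI[of _ "min (x $ i - c) (1 - x $ i)"] conjI subsetI)
    fix y assume y: "y \<in> torus.mball x (min (x $ i - c) (1 - x $ i))"
    then obtain z where z: "z \<in> lattice" "norm (x - y + z) < min (x $ i - c) (1 - x $ i)"
      using torus_dist_less_iff[THEN iffD1, of x y "min (x $ i - c) (1 - x $ i)"] by auto
    have "y \<in> torus" using y by simp
    then have yi: "0 \<le> y $ i" "y $ i < 1" by (auto simp: torus_def)
    have "\<bar>x $ i - y $ i + z $ i\<bar> < min (x $ i - c) (1 - x $ i)"
      using z(2) component_le_norm_cart[of "x - y + z" i] by simp
    then have b: "c < y $ i - z $ i" "y $ i - z $ i < 1" by linarith+
    obtain m where m: "z $ i = of_int m" using z(1) by (auto simp: lattice_def elim: Ints_cases)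
    have "of_int m < (1 :: real)" "of_int m > (- 1 :: real)" using b yi m assms by linarith+
    then have "m = 0" by linarith
    then show "y \<in> {x \<in> torus. c < x $ i}" using b m y by simp
  qed (use x in auto)
qed

text \<open>The torus topology is coarser than the Euclidean one on the half-open cube, but has the same Borel
sets. In this form the fact makes maps into \<open>E\<close> accessible to measurability of their components.\<close>

lemma measurable_torus_ident: "(\<lambda>x. x) \<in> measurable (borel_of torus_topology) (borel :: (real ^ 'd) measure)"
proof (rule borel_measurable_euclidean_space[THEN iffD2], rule ballI)
  fix b :: "real ^ 'd" assume "b \<in> Basis"
  then obtain i where b: "b = axis i 1" by (auto simp: Basis_vec_def)
  have "(\<lambda>x :: real ^ 'd. x $ i) \<in> borel_measurable (borel_of torus_topology)"
    unfolding borel_measurable_iff_greater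
  proof
    fix c :: real
    show "{x \<in> space (borel_of torus_topology). c < x $ i} \<in> sets (borel_of torus_topology)"
    proof (cases "0 \<le> c")
      case True then show ?thesis using openin_sets_borel_of[OF openin_coordinate_gt[OF True, of i]] by simp
    next
      case False
      then have "{x \<in> space (borel_of torus_topology). c < x $ i} = space (borel_of torus_topology)"
        unfolding space_borel_of torus.topspace_mtopology by (auto simp: torus_def intro: less_le_trans[of c 0])
      then show ?thesis by (metis sets.top)
    qed
  qed
  then show "(\<lambda>x. x \<bullet> b) \<in> borel_measurable (borel_of torus_topology)"
    unfolding b by (simp add: inner_axis)
qed

lemma openin_E_imp_euclidean:
  assumes "openin E_topology W" shows "\<exists>T. open T \<and> W = (torus \<times> {-\<infinity><..}) \<inter> T"
proof -
  let ?f = "\<lambda>(v :: real ^ 'a, u :: ereal). (frac_vec v, u)"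
  have "continuous_map (prod_topology euclidean (top_of_set {-\<infinity><..})) E_topology ?f"
    unfolding E_topology_def case_prod_unfold
    by (intro continuous_map_pairedI continuous_map_snd
        continuous_map_compose[OF continuous_map_fst continuous_map_frac_vec, unfolded comp_def])
  then have "openin (prod_topology euclidean (top_of_set {-\<infinity><..})) {y \<in> UNIV \<times> {-\<infinity><..}. ?f y \<in> W}"
    using openin_continuous_map_preimage[OF _ assms] by fastforce
  moreover have "prod_topology euclidean (top_of_set {-\<infinity><..}) =
      (top_of_set (UNIV \<times> {-\<infinity><..}) :: ((real ^ 'a) \<times> ereal) topology)"
    by (simp add: prod_topology_subtopology euclidean_product_topology)
  ultimately have "openin (top_of_set (UNIV \<times> {-\<infinity><..})) {y \<in> UNIV \<times> {-\<infinity><..}. ?f y \<in> W}" by simp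
  then obtain T where T: "open T" "{y \<in> UNIV \<times> {-\<infinity><..}. ?f y \<in> W} = (UNIV \<times> {-\<infinity><..}) \<inter> T"
    unfolding openin_open by blast
  have "W = (torus \<times> {-\<infinity><..}) \<inter> T"
  proof (intro equalityI subsetI)
    fix y assume y: "y \<in> W"
    then have "y \<in> torus \<times> {-\<infinity><..}" using openin_subset[OF assms] by auto
    moreover from this have "y \<in> {y \<in> UNIV \<times> {-\<infinity><..}. ?f y \<in> W}" using y by auto
    ultimately show "y \<in> (torus \<times> {-\<infinity><..}) \<inter> T" unfolding T(2) by blast
  next
    fix y assume y: "y \<in> (torus \<times> {-\<infinity><..}) \<inter> T"
    then have "y \<in> {y \<in> UNIV \<times> {-\<infinity><..}. ?f y \<in> W}" unfolding T(2) by auto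
    then show "y \<in> W" using y by auto
  qed
  then show ?thesis using T(1) by blast
qed

text \<open>Open subsets of \<open>E\<close> are traces of open subsets of a second countable product, whose Borel sets are
generated by rectangles.\<close>

lemma measurable_into_E:
  fixes f :: "'w \<Rightarrow> real ^ 'd"
  assumes f: "f \<in> borel_measurable M" and g: "g \<in> borel_measurable M"
    and "\<And>x. x \<in> space M \<Longrightarrow> f x \<in> torus" "\<And>x. x \<in> space M \<Longrightarrow> -\<infinity> < g x"
  shows "(\<lambda>x. (f x, g x)) \<in> measurable M (borel_of E_topology)"
  unfolding borel_of_def
proof (rule measurable_measure_of)
  show "(\<lambda>x. (f x, g x)) \<in> space M \<rightarrow> topspace E_topology" using assms by auto
  fix W assume "W \<in> {U. openin (E_topology :: ((real ^ 'd) \<times> ereal) topology) U}"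
  then obtain T where T: "open T" "W = (torus \<times> {-\<infinity><..}) \<inter> T" using openin_E_imp_euclidean by blast
  have "(\<lambda>x. (f x, g x)) \<in> measurable M (borel \<Otimes>\<^sub>M borel)" using f g by measurable
  then have "(\<lambda>x. (f x, g x)) \<in> borel_measurable M" by (simp add: borel_prod)
  from measurable_sets[OF this, of T] T(1) have "(\<lambda>x. (f x, g x)) -` T \<inter> space M \<in> sets M" by simp
  moreover have "(\<lambda>x. (f x, g x)) -` W \<inter> space M = (\<lambda>x. (f x, g x)) -` T \<inter> space M"
    unfolding T(2) using assms(3,4) by auto
  ultimately show "(\<lambda>x. (f x, g x)) -` W \<inter> space M \<in> sets M" by simp
next
  show "{U. openin (E_topology :: ((real ^ 'd) \<times> ereal) topology) U} \<subseteq> Pow (topspace E_topology)"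
    by (auto dest: subsetD[OF openin_subset] simp del: topspace_E)
qed

lemma rectangle_borel_E:
  assumes "A \<in> sets (borel_of torus_topology)"
  shows "A \<times> {ereal u..} \<in> sets (borel_of E_topology)"
proof -
  have "fst \<in> measurable (borel_of E_topology) (borel_of torus_topology)"
    unfolding E_topology_def by (intro measurable_continuous_map continuous_map_fst)
  from measurable_sets[OF this assms] have "(fst -` A \<inter> space (borel_of E_topology)) \<inter> strip u \<in> sets (borel_of E_topology)"
    by auto
  also have "(fst -` A \<inter> space (borel_of E_topology)) \<inter> strip u = A \<times> {ereal u..}"
    using borel_torus_subset[OF assms] by (auto simp: strip_def)
  finally show ?thesis .
qed

section \<open>Finite configurations\<close>

lemma configurationE:
  fixes \<omega> :: "(real ^ 'd) measure"
  assumes "\<omega> \<in> point_measures torus_topology"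
  obtains p and I :: "nat set" where "finite I" "p \<in> I \<rightarrow> torus" "\<omega> = distr (count_space I) (borel_of torus_topology) p"
    "\<forall>A\<in>sets (borel_of torus_topology). emeasure \<omega> A = of_nat (card {i \<in> I. p i \<in> A})"
proof -
  obtain p and I :: "nat set" where p: "p \<in> I \<rightarrow> topspace torus_topology"
    "\<omega> = distr (count_space I) (borel_of torus_topology) p" by (rule point_measuresE[OF assms])
  have "finite {i \<in> I. p i \<in> torus}"
    using point_measures_compact_finite[OF assms compact_torus] sets.top[of "borel_of torus_topology"] assms
    unfolding p(2) by (intro finite_points_in[OF _ p(1)]) simp_all
  moreover have "{i \<in> I. p i \<in> torus} = I" using p(1) by auto
  ultimately have fin: "finite I" by simp
  show thesis
  proof (rule that[OF fin _ p(2)])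
    show "p \<in> I \<rightarrow> torus" using p(1) by simp
    show "\<forall>A\<in>sets (borel_of torus_topology). emeasure \<omega> A = of_nat (card {i \<in> I. p i \<in> A})"
    proof
      fix A :: "(real ^ 'd) set" assume "A \<in> sets (borel_of torus_topology)"
      then show "emeasure \<omega> A = of_nat (card {i \<in> I. p i \<in> A})"
        unfolding p(2) using fin by (subst emeasure_point_sum[OF p(1)]) auto
    qed
  qed
qed

text \<open>By \<open>knn_radius_ge_iff\<close> below, these are the points whose \<open>k\<close>-th nearest neighbour is at distance
at least \<open>r\<close>. Unlike the radius itself, the condition involves a single count.\<close>

definition isolated :: "nat \<Rightarrow> real \<Rightarrow> (real ^ 'd) measure \<Rightarrow> (real ^ 'd) set" where
  "isolated k r \<omega> = {x \<in> torus. emeasure \<omega> (torus.mball x r - {x}) < of_nat k}"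

lemma singleton_borel_torus [simp]: "x \<in> torus \<Longrightarrow> {x} \<in> sets (borel_of torus_topology)"
  by (intro closedin_sets_borel_of) (simp add: closedin_Hausdorff_singleton torus.Hausdorff_space_mtopology)

lemma mcball_borel [simp]: "torus.mcball x r \<in> sets (borel_of torus_topology)"
  by (intro closedin_sets_borel_of) simp

lemma punctured_mball_borel [simp]: "torus.mball x r - {x} \<in> sets (borel_of torus_topology)"
proof (cases "x \<in> torus")
  case False then show ?thesis by (simp add: torus.mball_def)
qed (intro sets.Diff; simp)

lemma punctured_mcball_borel [simp]: "torus.mcball x r - {x} \<in> sets (borel_of torus_topology)"
proof (cases "x \<in> torus")
  case False then show ?thesis by (simp add: torus.mcball_def)
qed (intro sets.Diff; simp)

lemma isolated_borel:
  assumes "\<omega> \<in> point_measures torus_topology"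
  shows "isolated k r \<omega> \<in> sets (borel_of torus_topology)"
proof -
  obtain p and I :: "nat set" where I: "finite I" "p \<in> I \<rightarrow> torus"
    "\<omega> = distr (count_space I) (borel_of torus_topology) p"
    "\<forall>A\<in>sets (borel_of torus_topology). emeasure \<omega> A = of_nat (card {i \<in> I. p i \<in> A})"
    by (rule configurationE[OF assms])
  let ?f = "\<lambda>x. \<Sum>i\<in>I. indicator (torus.mball (p i) r - {p i}) x :: ennreal"
  have "emeasure \<omega> (torus.mball x r - {x}) = ?f x" if "x \<in> torus" for x
  proof -
    have "?f x = (\<Sum>i\<in>I. if p i \<in> torus.mball x r - {x} then 1 else 0)"
      using I(2) that by (intro sum.cong) (auto simp: torus.commute indicator_def)
    also have "\<dots> = of_nat (card {i \<in> I. p i \<in> torus.mball x r - {x}})"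
      using I(1) by (simp add: sum.If_cases Int_def)
    finally show ?thesis by (simp add: I(4))
  qed
  then have "isolated k r \<omega> = {x \<in> space (borel_of torus_topology). ?f x < of_nat k}"
    unfolding isolated_def by auto
  also have "\<dots> \<in> sets (borel_of torus_topology)"
    by (intro borel_measurable_less borel_measurable_sum borel_measurable_indicator) auto
  finally show ?thesis .
qed

text \<open>If the open ball contains \<open>k\<close> other points, then so does a closed ball of a smaller radius, because
there are finitely many points and one of them is farthest from \<open>x\<close>.\<close>

lemma knn_radius_ge_iff:
  assumes \<omega>: "\<omega> \<in> point_measures torus_topology" and x: "x \<in> torus" and "0 < r" "1 \<le> k"
  shows "ereal r \<le> knn_radius k x \<omega> \<longleftrightarrow> x \<in> isolated k r \<omega>"
proof
  assume iso: "x \<in> isolated k r \<omega>"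
  show "ereal r \<le> knn_radius k x \<omega>"
    unfolding knn_radius_def
  proof (rule INF_greatest)
    fix s assume s: "s \<in> {s. 0 < s \<and> of_nat k \<le> emeasure \<omega> (torus.mcball x s - {x})}"
    have "\<not> s < r"
    proof
      assume "s < r"
      then have "emeasure \<omega> (torus.mcball x s - {x}) \<le> emeasure \<omega> (torus.mball x r - {x})"
        using \<omega> by (intro emeasure_mono) (auto simp: point_measures_sets)
      then show False using s iso by (auto simp: isolated_def)
    qed
    then show "ereal r \<le> ereal s" by simp
  qed
next
  assume le: "ereal r \<le> knn_radius k x \<omega>"
  obtain p and I :: "nat set" where I: "finite I" "p \<in> I \<rightarrow> torus"
    "\<omega> = distr (count_space I) (borel_of torus_topology) p"
    "\<forall>A\<in>sets (borel_of torus_topology). emeasure \<omega> A = of_nat (card {i \<in> I. p i \<in> A})"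
    by (rule configurationE[OF \<omega>])
  show "x \<in> isolated k r \<omega>"
  proof (rule ccontr)
    assume "x \<notin> isolated k r \<omega>"
    then have ge: "of_nat k \<le> emeasure \<omega> (torus.mball x r - {x})" using x by (simp add: isolated_def)
    let ?J = "{i \<in> I. p i \<in> torus.mball x r - {x}}"
    have J: "finite ?J" "?J \<noteq> {}"
    proof -
      show "?J \<noteq> {}"
      proof
        assume "?J = {}"
        then have "emeasure \<omega> (torus.mball x r - {x}) = 0"
          using I(4)[rule_format, OF punctured_mball_borel[of x r]] by (metis card.empty of_nat_0)
        then show False using ge \<open>1 \<le> k\<close> by simp
      qed
    qed (use I in auto)
    define s where "s = Max ((\<lambda>i. torus_dist x (p i)) ` ?J)"
    have "s \<in> (\<lambda>i. torus_dist x (p i)) ` ?J" unfolding s_def using J by (intro Max_in) auto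
    then obtain j where j: "j \<in> ?J" "s = torus_dist x (p j)" by blast
    then have s: "0 < s" "s < r" using x I(2) by (auto simp: torus.mdist_pos_less)
    have "?J \<subseteq> {i \<in> I. p i \<in> torus.mcball x s - {x}}"
      using J x I(2) unfolding s_def by auto
    then have "emeasure \<omega> (torus.mball x r - {x}) \<le> emeasure \<omega> (torus.mcball x s - {x})"
      using I(1) by (simp add: I(4) card_mono)
    then have "knn_radius k x \<omega> \<le> ereal s"
      unfolding knn_radius_def using s ge by (intro INF_lower) (auto intro: order_trans)
    then show False using le s(2) by (meson ereal_less_eq(3) leD order_trans)
  qed
qed

lemma knn_radius_nonneg: "0 \<le> knn_radius k x \<omega>"
  unfolding knn_radius_def by (rule INF_greatest) auto

lemma knn_radius_measurable:
  assumes \<omega>: "\<omega> \<in> point_measures torus_topology" and "1 \<le> k"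
  shows "(\<lambda>x. knn_radius k x \<omega>) \<in> borel_measurable (borel_of torus_topology)"
  unfolding borel_measurable_iff_Ici_ereal
proof
  fix a :: ereal
  have pos: "{x \<in> torus. ereal r \<le> knn_radius k x \<omega>} \<in> sets (borel_of torus_topology)" if "0 < r" for r
  proof -
    have "{x \<in> torus. ereal r \<le> knn_radius k x \<omega>} = isolated k r \<omega>"
      using knn_radius_ge_iff[OF \<omega> _ that \<open>1 \<le> k\<close>] by (auto simp: isolated_def)
    then show ?thesis using isolated_borel[OF \<omega>] by simp
  qed
  have "(\<lambda>x. knn_radius k x \<omega>) -` {a..} \<inter> space (borel_of torus_topology) = {x \<in> torus. a \<le> knn_radius k x \<omega>}"
    by auto
  also have "\<dots> \<in> sets (borel_of torus_topology)"
  proof (cases a)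
    case (real r)
    show ?thesis
    proof (cases "0 < r")
      case True then show ?thesis using pos real by simp
    next
      case False
      then have "a \<le> 0" using real by simp
      then have "{x \<in> torus. a \<le> knn_radius k x \<omega>} = space (borel_of torus_topology)"
        using order_trans[OF \<open>a \<le> 0\<close> knn_radius_nonneg] by auto
      then show ?thesis by (metis sets.top)
    qed
  next
    case PInf
    have "{x \<in> torus. a \<le> knn_radius k x \<omega>} = (\<Inter>n::nat. {x \<in> torus. ereal (real (Suc n)) \<le> knn_radius k x \<omega>})"
    proof (intro equalityI subsetI)
      fix x assume "x \<in> (\<Inter>n::nat. {x \<in> torus. ereal (real (Suc n)) \<le> knn_radius k x \<omega>})"
      then have x: "x \<in> torus" "\<And>n. ereal (real (Suc n)) \<le> knn_radius k x \<omega>" by auto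
      have "knn_radius k x \<omega> = \<infinity>"
      proof (cases "knn_radius k x \<omega>")
        case (real y)
        obtain n where "y < real n" using reals_Archimedean2 by blast
        then show ?thesis using x(2)[of n] real by simp
      qed (use x(2)[of 0] in auto)
      then show "x \<in> {x \<in> torus. a \<le> knn_radius k x \<omega>}" using x(1) by simp
    qed (use PInf in auto)
    also have "\<dots> \<in> sets (borel_of torus_topology)"
    proof -
      have "{x \<in> torus. ereal (real (Suc n)) \<le> knn_radius k x \<omega>} \<in> sets (borel_of torus_topology)" for n
        by (rule pos) simp
      then show ?thesis by (intro sets.countable_INT) auto
    qed
    finally show ?thesis .
  next
    case MInf
    then have "{x \<in> torus. a \<le> knn_radius k x \<omega>} = space (borel_of torus_topology)" by auto
    then show ?thesis by (metis sets.top)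
  qed
  finally show "(\<lambda>x. knn_radius k x \<omega>) -` {a..} \<inter> space (borel_of torus_topology) \<in> sets (borel_of torus_topology)" .
qed

section \<open>The marked process\<close>

text \<open>The map that attaches the mark to a point; the marked process is the image of the configuration
under it.\<close>

definition excess :: "nat \<Rightarrow> (nat \<Rightarrow> real) \<Rightarrow> nat \<Rightarrow> (real ^ 'd) measure \<Rightarrow> real ^ 'd \<Rightarrow> (real ^ 'd) \<times> ereal" where
  "excess k a n \<omega> x = (x, ereal (real n * unit_ball_volume TYPE('d)) * knn_radius k x \<omega> ^ CARD('d) - ereal (a n))"

lemma excess_measurable:
  fixes \<omega> :: "(real ^ 'd) measure"
  assumes \<omega>: "\<omega> \<in> point_measures torus_topology" and "1 \<le> k"
  shows "excess k a n \<omega> \<in> measurable (borel_of torus_topology) (borel_of E_topology)"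
  unfolding excess_def
proof (rule measurable_into_E[OF measurable_torus_ident])
  have [measurable]: "(\<lambda>x. knn_radius k x \<omega> ^ j) \<in> borel_measurable (borel_of torus_topology)" for j
  proof (induction j)
    case (Suc j)
    then show ?case using borel_measurable_ereal_times[OF knn_radius_measurable[OF assms] Suc] by simp
  qed simp
  show "(\<lambda>x. ereal (real n * unit_ball_volume TYPE('d)) * knn_radius k x \<omega> ^ CARD('d) - ereal (a n))
    \<in> borel_measurable (borel_of torus_topology)"
    by (intro borel_measurable_ereal_diff borel_measurable_ereal_times borel_measurable_const) measurable
  show "- \<infinity> < ereal (real n * unit_ball_volume TYPE('d)) * knn_radius k x \<omega> ^ CARD('d) - ereal (a n)" for x
  proof -
    have "0 \<le> ereal (real n * unit_ball_volume TYPE('d)) * knn_radius k x \<omega> ^ CARD('d)"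
      using unit_ball_volume_pos[where 'd = 'd] knn_radius_nonneg[of k x \<omega>]
      by (cases "knn_radius k x \<omega>") auto
    moreover have "- \<infinity> < y - ereal (a n)" if "0 \<le> y" for y using that by (cases y) auto
    ultimately show ?thesis by blast
  qed
qed simp

lemma L_process_alt:
  "L_process k a n \<omega> = (if emeasure \<omega> torus > of_nat k then distr \<omega> (borel_of E_topology) (excess k a n \<omega>)
     else null_measure (borel_of E_topology))"
  by (simp add: L_process_def excess_def[abs_def])

lemma L_process_in_point_measures:
  assumes \<omega>: "\<omega> \<in> point_measures torus_topology" and "1 \<le> k"
  shows "L_process k a n \<omega> \<in> point_measures E_topology"
proof -
  obtain p and I :: "nat set" where I: "finite I" "p \<in> I \<rightarrow> torus"
    "\<omega> = distr (count_space I) (borel_of torus_topology) p"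
    "\<forall>A\<in>sets (borel_of torus_topology). emeasure \<omega> A = of_nat (card {i \<in> I. p i \<in> A})"
    by (rule configurationE[OF \<omega>])
  have pm: "p \<in> measurable (count_space I) (borel_of torus_topology)" using I(2) by simp
  have "distr \<omega> (borel_of E_topology) (excess k a n \<omega>) =
      distr (count_space I) (borel_of E_topology) (excess k a n \<omega> \<circ> p)"
    using distr_distr[OF excess_measurable[OF assms, of a n] pm] I(3) by simp
  moreover have "excess k a n \<omega> \<circ> p \<in> I \<rightarrow> topspace E_topology"
    using measurable_space[OF measurable_comp[OF pm excess_measurable[OF assms, of a n]]] by auto
  ultimately have "distr \<omega> (borel_of E_topology) (excess k a n \<omega>) \<in> point_measures E_topology"
    using finite_point_sum_in_point_measures[OF I(1)] by metis
  then show ?thesis by (simp add: L_process_alt null_in_point_measures)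
qed

text \<open>The level \<open>u\<close> corresponds to the radius \<open>r\<close> at which a ball has expected number of points
\<open>a n + u\<close>: a mark is at least \<open>u\<close> if and only if its point is isolated at radius \<open>r\<close>.\<close>

lemma emeasure_L_process:
  fixes \<omega> :: "(real ^ 'd) measure"
  assumes \<omega>: "\<omega> \<in> point_measures torus_topology" and k: "1 \<le> k"
    and A: "A \<in> sets (borel_of torus_topology)" and n: "0 < n" and r: "0 < r"
    and u: "real n * unit_ball_volume TYPE('d) * r ^ CARD('d) = a n + u"
  shows "emeasure (L_process k a n \<omega>) (A \<times> {ereal u..}) =
    (if emeasure \<omega> torus > of_nat k then emeasure \<omega> (A \<inter> isolated k r \<omega>) else 0)"
proof -
  let ?c = "real n * unit_ball_volume TYPE('d)"
  have c: "0 < ?c" using n unit_ball_volume_pos[where 'd = 'd] by simp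
  have iff: "ereal u \<le> ereal ?c * knn_radius k x \<omega> ^ CARD('d) - ereal (a n) \<longleftrightarrow> ereal r \<le> knn_radius k x \<omega>" for x
  proof (cases "knn_radius k x \<omega>")
    case (real s)
    then have s: "0 \<le> s" using knn_radius_nonneg[of k x \<omega>] by simp
    have "ereal u \<le> ereal ?c * knn_radius k x \<omega> ^ CARD('d) - ereal (a n) \<longleftrightarrow> u \<le> ?c * s ^ CARD('d) - a n"
      using real by simp
    also have "\<dots> \<longleftrightarrow> ?c * r ^ CARD('d) \<le> ?c * s ^ CARD('d)" using u by auto
    also have "\<dots> \<longleftrightarrow> r ^ CARD('d) \<le> s ^ CARD('d)" using c by (rule mult_le_cancel_left_pos)
    also have "\<dots> \<longleftrightarrow> r \<le> s" using r s by (intro power_mono_iff) auto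
    finally show ?thesis using real by simp
  next
    case PInf then show ?thesis using n unit_ball_volume_pos[where 'd = 'd] by simp
  qed (use knn_radius_nonneg[of k x \<omega>] in auto)
  have sp: "space \<omega> = torus" using point_measures_space[OF \<omega>] by simp
  have "excess k a n \<omega> -` (A \<times> {ereal u..}) \<inter> space \<omega> = A \<inter> isolated k r \<omega>"
  proof (intro equalityI subsetI)
    fix x assume "x \<in> excess k a n \<omega> -` (A \<times> {ereal u..}) \<inter> space \<omega>"
    then have "x \<in> A" "x \<in> torus" "ereal r \<le> knn_radius k x \<omega>"
      unfolding sp excess_def using iff[of x] by auto
    then show "x \<in> A \<inter> isolated k r \<omega>" using knn_radius_ge_iff[OF \<omega> _ r k] by auto
  next
    fix x assume x: "x \<in> A \<inter> isolated k r \<omega>"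
    then have "x \<in> torus" by (auto simp: isolated_def)
    then have "ereal r \<le> knn_radius k x \<omega>" using x knn_radius_ge_iff[OF \<omega> _ r k] by auto
    then show "x \<in> excess k a n \<omega> -` (A \<times> {ereal u..}) \<inter> space \<omega>"
      using x \<open>x \<in> torus\<close> iff[of x] by (simp add: sp excess_def)
  qed
  moreover have "excess k a n \<omega> \<in> measurable \<omega> (borel_of E_topology)"
    using excess_measurable[OF \<omega> k] measurable_cong_sets[OF point_measures_sets[OF \<omega>] refl] by blast
  ultimately show ?thesis
    using rectangle_borel_E[OF A, of u] by (simp add: L_process_alt emeasure_distr)
qed

section \<open>Poisson counts\<close>

text \<open>The probability that a Poisson variable with mean \<open>l\<close> is less than \<open>k\<close>.\<close>

definition pois_lt :: "nat \<Rightarrow> real \<Rightarrow> real" where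
  "pois_lt k l = (\<Sum>j<k. exp (- l) * l ^ j / fact j)"

lemma pois_lt_0 [simp]: "pois_lt 0 l = 0" by (simp add: pois_lt_def)

lemma pois_lt_nonneg: "0 \<le> l \<Longrightarrow> 0 \<le> pois_lt k l"
  by (simp add: pois_lt_def sum_nonneg)

text \<open>The derivatives of the summands telescope.\<close>

lemma pois_lt_has_derivative:
  "(pois_lt (Suc m) has_real_derivative - (exp (- x) * x ^ m / fact m)) (at x)"
proof (induction m)
  case 0
  have "pois_lt (Suc 0) = (\<lambda>x. exp (- x))" by (simp add: pois_lt_def fun_eq_iff)
  then show ?case by (auto intro!: derivative_eq_intros)
next
  case (Suc m)
  have eq: "pois_lt (Suc (Suc m)) = (\<lambda>x. pois_lt (Suc m) x + exp (- x) * x ^ Suc m / fact (Suc m))"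
    by (simp add: pois_lt_def fun_eq_iff)
  have "((\<lambda>x. exp (- x) * x ^ Suc m / fact (Suc m)) has_real_derivative
      (- exp (- x) * x ^ Suc m + exp (- x) * (real (Suc m) * x ^ m)) / fact (Suc m)) (at x)"
    by (rule derivative_eq_intros refl | simp)+
  moreover have "exp (- x) * (real (Suc m) * x ^ m) / fact (Suc m) = exp (- x) * x ^ m / fact m"
    by (simp add: fact_Suc divide_simps del: of_nat_Suc)
  ultimately have "((\<lambda>x. exp (- x) * x ^ Suc m / fact (Suc m)) has_real_derivative
      (- exp (- x) * x ^ Suc m / fact (Suc m) + exp (- x) * x ^ m / fact m)) (at x)"
    by (simp only: add_divide_distrib)
  from DERIV_add[OF Suc.IH this] show ?case unfolding eq by simp
qed

lemma pois_lt_antimono: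
  assumes "0 \<le> x" "x \<le> y" shows "pois_lt k y \<le> pois_lt k x"
proof (cases k)
  case (Suc m)
  show ?thesis unfolding Suc
  proof (rule DERIV_nonpos_imp_nonincreasing[OF assms(2)])
    fix z assume "x \<le> z"
    then show "\<exists>y. (pois_lt (Suc m) has_real_derivative y) (at z) \<and> y \<le> 0"
      using pois_lt_has_derivative[of m z] assms(1) by (intro exI conjI) auto
  qed
qed simp

lemma pois_lt_tendsto [tendsto_intros]:
  "(f \<longlongrightarrow> l) F \<Longrightarrow> ((\<lambda>x. pois_lt k (f x)) \<longlongrightarrow> pois_lt k l) F"
  unfolding pois_lt_def by (intro tendsto_intros) auto

lemma poisson_mean_sums: "(\<lambda>j. real j * (exp (- l) * l ^ j / fact j)) sums l"
proof -
  have "(\<lambda>j. exp (- l) * l * (l ^ j /\<^sub>R fact j)) sums (exp (- l) * l * exp l)"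
    by (intro sums_mult exp_converges)
  also have "exp (- l) * l * exp l = l" by (simp add: exp_minus)
  also have "(\<lambda>j. exp (- l) * l * (l ^ j /\<^sub>R fact j)) = (\<lambda>j. real (Suc j) * (exp (- l) * l ^ Suc j / fact (Suc j)))"
    by (auto simp: fun_eq_iff fact_Suc divide_simps simp del: of_nat_Suc)
  finally show ?thesis by (subst (asm) sums_Suc_iff) simp
qed

lemma poisson_factorial_moment_sums: "(\<lambda>j. real j * (real j - 1) * (exp (- l) * l ^ j / fact j)) sums l\<^sup>2"
proof -
  have "(\<lambda>j. l * (real j * (exp (- l) * l ^ j / fact j))) sums (l * l)"
    by (intro sums_mult poisson_mean_sums)
  also have "(\<lambda>j. l * (real j * (exp (- l) * l ^ j / fact j))) =
      (\<lambda>j. real (Suc j) * (real (Suc j) - 1) * (exp (- l) * l ^ Suc j / fact (Suc j)))"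
    by (auto simp: fun_eq_iff fact_Suc divide_simps simp del: of_nat_Suc)
  finally show ?thesis by (subst (asm) sums_Suc_iff) (simp add: power2_eq_square)
qed

definition ind_lt :: "nat \<Rightarrow> ennreal \<Rightarrow> ennreal" where
  "ind_lt k x = (if x < of_nat k then 1 else 0)"

text \<open>The expectation of \<open>ge2 N\<close> controls the event that there are two points or more; it plays the
part of the second factorial moment, but needs no subtraction in \<open>ennreal\<close>.\<close>

definition ge2 :: "ennreal \<Rightarrow> ennreal" where
  "ge2 x = (if 2 \<le> x then x else 0)"

lemma ind_lt_measurable [measurable]: "ind_lt k \<in> borel_measurable borel"
  unfolding ind_lt_def by measurable

lemma ge2_measurable [measurable]: "ge2 \<in> borel_measurable borel"
  unfolding ge2_def by measurable

abbreviation vol :: "(real ^ 'd) set \<Rightarrow> real" where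
  "vol A \<equiv> measure lborel A"

lemma emeasure_eq_vol:
  assumes "A \<in> sets (borel_of torus_topology)"
  shows "emeasure lborel A = ennreal (vol A)" "vol A \<le> 1"
proof -
  have "emeasure lborel A \<le> 1"
    using emeasure_mono[OF borel_torus_subset[OF assms], of lborel] by (simp add: emeasure_torus)
  then show *: "emeasure lborel A = ennreal (vol A)"
    by (intro emeasure_eq_ennreal_measure) (auto simp: top_unique)
  show "vol A \<le> 1" using \<open>emeasure lborel A \<le> 1\<close> unfolding * by simp
qed

locale torus_poisson = prob_space \<Omega> for \<Omega> :: "'w measure" +
  fixes P :: "'w \<Rightarrow> (real ^ 'd) measure" and t :: real
  assumes hom: "homogeneous_poisson \<Omega> t P" and t_nonneg: "0 \<le> t"
begin

lemma configuration: "\<omega> \<in> space \<Omega> \<Longrightarrow> P \<omega> \<in> point_measures torus_topology"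
  using hom by (simp add: homogeneous_poisson_def poisson_process_def)

lemma count_measurable: "A \<in> sets (borel_of torus_topology) \<Longrightarrow> (\<lambda>\<omega>. emeasure (P \<omega>) A) \<in> borel_measurable \<Omega>"
  using hom by (simp add: homogeneous_poisson_def poisson_process_def)

lemma intensity:
  assumes "A \<in> sets (borel_of torus_topology)"
  shows "emeasure (scale_measure (ennreal t) lebesgue_torus) A < \<infinity>"
    "measure (scale_measure (ennreal t) lebesgue_torus) A = t * vol A"
proof -
  have "emeasure (scale_measure (ennreal t) lebesgue_torus) A = ennreal (t * vol A)"
    using assms t_nonneg by (simp add: emeasure_lebesgue_torus emeasure_eq_vol ennreal_mult)
  then show "emeasure (scale_measure (ennreal t) lebesgue_torus) A < \<infinity>"
    "measure (scale_measure (ennreal t) lebesgue_torus) A = t * vol A"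
    using t_nonneg by (simp_all add: measure_def)
qed

lemma prob_count:
  assumes "A \<in> sets (borel_of torus_topology)"
  shows "prob {\<omega> \<in> space \<Omega>. emeasure (P \<omega>) A = of_nat j} = exp (- (t * vol A)) * (t * vol A) ^ j / fact j"
  using hom intensity[OF assms] assms unfolding homogeneous_poisson_def poisson_process_def by auto

lemma count_nat:
  assumes "\<omega> \<in> space \<Omega>" "A \<in> sets (borel_of torus_topology)"
  obtains j where "emeasure (P \<omega>) A = of_nat j"
proof -
  obtain p and I :: "nat set" where "finite I" "p \<in> I \<rightarrow> torus"
    "P \<omega> = distr (count_space I) (borel_of torus_topology) p"
    "\<forall>A\<in>sets (borel_of torus_topology). emeasure (P \<omega>) A = of_nat (card {i \<in> I. p i \<in> A})"
    by (rule configurationE[OF configuration[OF assms(1)]])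
  then show thesis using that assms(2) by blast
qed

lemma nn_integral_count:
  assumes A: "A \<in> sets (borel_of torus_topology)"
  shows "(\<integral>\<^sup>+\<omega>. \<phi> (emeasure (P \<omega>) A) \<partial>\<Omega>) =
    (\<Sum>j. \<phi> (of_nat j) * ennreal (exp (- (t * vol A)) * (t * vol A) ^ j / fact j))"
proof -
  define N where "N j = {\<omega> \<in> space \<Omega>. emeasure (P \<omega>) A = of_nat j}" for j :: nat
  note [measurable] = count_measurable[OF A]
  have N [measurable]: "N j \<in> sets \<Omega>" for j unfolding N_def by measurable
  have "(\<integral>\<^sup>+\<omega>. \<phi> (emeasure (P \<omega>) A) \<partial>\<Omega>) = (\<integral>\<^sup>+\<omega>. (\<Sum>j. \<phi> (of_nat j) * indicator (N j) \<omega>) \<partial>\<Omega>)"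
  proof (rule nn_integral_cong)
    fix \<omega> assume \<omega>: "\<omega> \<in> space \<Omega>"
    obtain i where i: "emeasure (P \<omega>) A = of_nat i" by (rule count_nat[OF \<omega> A])
    have "(\<Sum>j. \<phi> (of_nat j) * indicator (N j) \<omega>) = (\<Sum>j\<in>{i}. \<phi> (of_nat j) * indicator (N j) \<omega>)"
      by (rule suminf_finite) (auto simp: N_def i)
    then show "\<phi> (emeasure (P \<omega>) A) = (\<Sum>j. \<phi> (of_nat j) * indicator (N j) \<omega>)"
      using \<omega> by (simp add: N_def i)
  qed
  also have "\<dots> = (\<Sum>j. \<integral>\<^sup>+\<omega>. \<phi> (of_nat j) * indicator (N j) \<omega> \<partial>\<Omega>)"
    by (intro nn_integral_suminf) measurable
  also have "\<dots> = (\<Sum>j. \<phi> (of_nat j) * emeasure \<Omega> (N j))"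
    by (simp add: nn_integral_cmult_indicator)
  also have "\<dots> = (\<Sum>j. \<phi> (of_nat j) * ennreal (exp (- (t * vol A)) * (t * vol A) ^ j / fact j))"
    using prob_count[OF A] by (simp add: N_def emeasure_eq_measure)
  finally show ?thesis .
qed

lemma mean_count:
  assumes A: "A \<in> sets (borel_of torus_topology)"
  shows "(\<integral>\<^sup>+\<omega>. emeasure (P \<omega>) A \<partial>\<Omega>) = ennreal (t * vol A)"
proof -
  let ?l = "t * vol A"
  have l: "0 \<le> ?l" using t_nonneg by simp
  have "(\<integral>\<^sup>+\<omega>. emeasure (P \<omega>) A \<partial>\<Omega>) = (\<Sum>j. of_nat j * ennreal (exp (- ?l) * ?l ^ j / fact j))"
    using nn_integral_count[OF A, of "\<lambda>x. x"] .
  also have "\<dots> = (\<Sum>j. ennreal (real j * (exp (- ?l) * ?l ^ j / fact j)))"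
    using l by (intro suminf_cong) (simp only: ennreal_of_nat_eq_real_of_nat, simp add: ennreal_mult''[symmetric])
  also have "\<dots> = ennreal ?l"
    using l by (intro suminf_ennreal_eq poisson_mean_sums) auto
  finally show ?thesis .
qed

text \<open>By \<open>ge2 j \<le> j * (j - 1)\<close>, the second factorial moment is an upper bound.\<close>

lemma mean_ge2_count:
  assumes A: "A \<in> sets (borel_of torus_topology)"
  shows "(\<integral>\<^sup>+\<omega>. ge2 (emeasure (P \<omega>) A) \<partial>\<Omega>) \<le> ennreal ((t * vol A)\<^sup>2)"
proof -
  let ?l = "t * vol A"
  have l: "0 \<le> ?l" using t_nonneg by simp
  have "(\<integral>\<^sup>+\<omega>. ge2 (emeasure (P \<omega>) A) \<partial>\<Omega>) = (\<Sum>j. ge2 (of_nat j) * ennreal (exp (- ?l) * ?l ^ j / fact j))"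
    using nn_integral_count[OF A, of ge2] .
  also have "\<dots> \<le> (\<Sum>j. ennreal (real j * (real j - 1) * (exp (- ?l) * ?l ^ j / fact j)))"
  proof (intro suminf_le)
    fix j :: nat
    have "ge2 (of_nat j) \<le> ennreal (real j * (real j - 1))"
    proof (cases "2 \<le> j")
      case True
      then have "real j * 1 \<le> real j * (real j - 1)" by (intro mult_left_mono) auto
      then show ?thesis by (simp add: ge2_def ennreal_of_nat_eq_real_of_nat ennreal_leI)
    next
      case False
      then have "j = 0 \<or> j = 1" by auto
      then show ?thesis by (auto simp: ge2_def)
    qed
    then have "ge2 (of_nat j) * ennreal (exp (- ?l) * ?l ^ j / fact j) \<le>
        ennreal (real j * (real j - 1)) * ennreal (exp (- ?l) * ?l ^ j / fact j)"
      by (rule mult_right_mono) simp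
    also have "\<dots> = ennreal (real j * (real j - 1) * (exp (- ?l) * ?l ^ j / fact j))"
      using l by (intro ennreal_mult''[symmetric]) auto
    finally show "ge2 (of_nat j) * ennreal (exp (- ?l) * ?l ^ j / fact j) \<le>
      ennreal (real j * (real j - 1) * (exp (- ?l) * ?l ^ j / fact j))" .
  qed auto
  also have "\<dots> = ennreal (?l\<^sup>2)"
  proof (intro suminf_ennreal_eq poisson_factorial_moment_sums)
    fix j :: nat
    have "0 \<le> real j * (real j - 1)" by (cases j) auto
    then show "0 \<le> real j * (real j - 1) * (exp (- ?l) * ?l ^ j / fact j)"
      by (rule mult_nonneg_nonneg) (use l in simp)
  qed
  finally show ?thesis .
qed

lemma prob_count_lt:
  assumes A: "A \<in> sets (borel_of torus_topology)"
  shows "(\<integral>\<^sup>+\<omega>. ind_lt k (emeasure (P \<omega>) A) \<partial>\<Omega>) = ennreal (pois_lt k (t * vol A))"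
proof -
  let ?l = "t * vol A"
  have l: "0 \<le> ?l" using t_nonneg by simp
  have "(\<integral>\<^sup>+\<omega>. ind_lt k (emeasure (P \<omega>) A) \<partial>\<Omega>) = (\<Sum>j. ind_lt k (of_nat j) * ennreal (exp (- ?l) * ?l ^ j / fact j))"
    using nn_integral_count[OF A, of "ind_lt k"] .
  also have "\<dots> = (\<Sum>j<k. ind_lt k (of_nat j) * ennreal (exp (- ?l) * ?l ^ j / fact j))"
    by (rule suminf_finite) (auto simp: ind_lt_def)
  also have "\<dots> = (\<Sum>j<k. ennreal (exp (- ?l) * ?l ^ j / fact j))"
    by (intro sum.cong) (auto simp: ind_lt_def)
  also have "\<dots> = ennreal (pois_lt k ?l)"
    unfolding pois_lt_def using l by (intro sum_ennreal) auto
  finally show ?thesis .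
qed

lemma nn_integral_prod_counts:
  fixes A :: "nat \<Rightarrow> (real ^ 'd) set" and m :: nat
  assumes A: "\<And>i. i < m \<Longrightarrow> A i \<in> sets (borel_of torus_topology)" "disjoint_family_on A {..<m}"
    and \<phi>: "\<And>i. i < m \<Longrightarrow> \<phi> i \<in> borel_measurable borel"
  shows "(\<integral>\<^sup>+\<omega>. (\<Prod>i<m. \<phi> i (emeasure (P \<omega>) (A i))) \<partial>\<Omega>) = (\<Prod>i<m. \<integral>\<^sup>+\<omega>. \<phi> i (emeasure (P \<omega>) (A i)) \<partial>\<Omega>)"
proof -
  have "\<forall>(A :: nat \<Rightarrow> (real ^ 'd) set) m. (\<forall>i<m. A i \<in> sets (borel_of torus_topology)) \<and>
      disjoint_family_on A {..<m} \<longrightarrow> indep_vars (\<lambda>_. borel) (\<lambda>i \<omega>. emeasure (P \<omega>) (A i)) {..<m}"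
    using hom unfolding homogeneous_poisson_def poisson_process_def by (elim conjE)
  from this[THEN spec[of _ A], THEN spec[of _ m]] have "indep_vars (\<lambda>_. borel) (\<lambda>i \<omega>. emeasure (P \<omega>) (A i)) {..<m}"
    using A by simp
  then have "indep_vars (\<lambda>_. borel) (\<lambda>i \<omega>. \<phi> i (emeasure (P \<omega>) (A i))) {..<m}"
    by (rule indep_vars_compose2) (use \<phi> in auto)
  then show ?thesis by (intro indep_vars_nn_integral) auto
qed

lemma nn_integral_count_mult_lt:
  assumes "A \<in> sets (borel_of torus_topology)" "B \<in> sets (borel_of torus_topology)" "A \<inter> B = {}"
  shows "(\<integral>\<^sup>+\<omega>. emeasure (P \<omega>) A * ind_lt k (emeasure (P \<omega>) B) \<partial>\<Omega>) =
    ennreal (t * vol A * pois_lt k (t * vol B))"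
proof -
  have "(\<integral>\<^sup>+\<omega>. (\<Prod>i<2. ([\<lambda>x. x, ind_lt k] ! i) (emeasure (P \<omega>) ([A, B] ! i))) \<partial>\<Omega>) =
    (\<Prod>i<2. \<integral>\<^sup>+\<omega>. ([\<lambda>x. x, ind_lt k] ! i) (emeasure (P \<omega>) ([A, B] ! i)) \<partial>\<Omega>)"
    using assms by (intro nn_integral_prod_counts)
      (auto simp: disjoint_family_on_def less_2_cases_iff disjoint_iff)
  then show ?thesis
    using assms t_nonneg
    by (simp add: numeral_2_eq_2 mean_count prob_count_lt ennreal_mult pois_lt_nonneg)
qed

lemma nn_integral_two_counts_mult_lt:
  assumes "A \<in> sets (borel_of torus_topology)" "B \<in> sets (borel_of torus_topology)"
    "C \<in> sets (borel_of torus_topology)" "D \<in> sets (borel_of torus_topology)"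
    and "A \<inter> B = {}" "A \<inter> C = {}" "A \<inter> D = {}" "B \<inter> C = {}" "B \<inter> D = {}" "C \<inter> D = {}"
  shows "(\<integral>\<^sup>+\<omega>. emeasure (P \<omega>) A * emeasure (P \<omega>) B * ind_lt j (emeasure (P \<omega>) C) * ind_lt k (emeasure (P \<omega>) D) \<partial>\<Omega>)
    = ennreal (t * vol A * (t * vol B) * pois_lt j (t * vol C) * pois_lt k (t * vol D))"
proof -
  have lt4: "i < 4 \<longleftrightarrow> i = 0 \<or> i = 1 \<or> i = 2 \<or> i = (3 :: nat)" for i by auto
  have set4: "{..<4} = {0, 1, 2, 3 :: nat}" by auto
  have "(\<integral>\<^sup>+\<omega>. (\<Prod>i<4. ([\<lambda>x. x, \<lambda>x. x, ind_lt j, ind_lt k] ! i) (emeasure (P \<omega>) ([A, B, C, D] ! i))) \<partial>\<Omega>) =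
    (\<Prod>i<4. \<integral>\<^sup>+\<omega>. ([\<lambda>x. x, \<lambda>x. x, ind_lt j, ind_lt k] ! i) (emeasure (P \<omega>) ([A, B, C, D] ! i)) \<partial>\<Omega>)"
  proof (rule nn_integral_prod_counts)
    show "[A, B, C, D] ! i \<in> sets (borel_of torus_topology)" if "i < 4" for i
      using that assms(1-4) unfolding lt4 by (elim disjE) simp_all
    show "disjoint_family_on ((!) [A, B, C, D]) {..<4}"
      using assms(5-10) unfolding disjoint_family_on_def set4 by (simp add: Int_commute)
    show "[\<lambda>x. x, \<lambda>x. x, ind_lt j, ind_lt k] ! i \<in> borel_measurable borel" if "i < 4" for i
      using that unfolding lt4 by (elim disjE) simp_all
  qed
  moreover have "(\<Prod>i<4. f i) = f 0 * f 1 * f 2 * f 3" for f :: "nat \<Rightarrow> ennreal"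
    by (simp add: eval_nat_numeral)
  ultimately show ?thesis
    using assms t_nonneg
    by (simp add: mean_count prob_count_lt ennreal_mult pois_lt_nonneg)
qed

end

section \<open>Fine partitions of the torus\<close>

definition cell :: "(real ^ 'd \<Rightarrow> real ^ 'd) \<Rightarrow> real ^ 'd \<Rightarrow> (real ^ 'd) set" where
  "cell \<kappa> c = {x \<in> torus. \<kappa> x = c}"

text \<open>A point is sent by \<open>\<kappa>\<close> to the representative of its cell; the cells are the fibres of \<open>\<kappa>\<close>, and the
representatives index them.\<close>

definition fine_partition :: "real \<Rightarrow> (real ^ 'd \<Rightarrow> real ^ 'd) \<Rightarrow> bool" where
  "fine_partition \<delta> \<kappa> \<longleftrightarrow> finite (\<kappa> ` torus) \<and> (\<forall>x\<in>torus. \<kappa> x \<in> torus \<and> torus_dist (\<kappa> x) x < \<delta>) \<and>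
     (\<forall>c. cell \<kappa> c \<in> sets (borel_of torus_topology))"

lemma fine_partition_exists:
  assumes "0 < \<delta>" shows "\<exists>\<kappa> :: real ^ 'd \<Rightarrow> real ^ 'd. fine_partition \<delta> \<kappa>"
proof (rule torus_partition[OF assms])
  fix \<kappa> :: "real ^ 'd \<Rightarrow> real ^ 'd"
  assume "finite (\<kappa> ` torus)" "\<And>x. x \<in> torus \<Longrightarrow> \<kappa> x \<in> torus"
    "\<And>c. {x \<in> torus. \<kappa> x = c} \<in> sets (borel_of torus_topology)"
    "\<And>x. x \<in> torus \<Longrightarrow> torus_dist (\<kappa> x) x < \<delta>"
  then have "fine_partition \<delta> \<kappa>" by (simp add: fine_partition_def cell_def)
  then show ?thesis by blast
qed

lemma cell_borel [simp]: "fine_partition \<delta> \<kappa> \<Longrightarrow> cell \<kappa> c \<in> sets (borel_of torus_topology)"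
  by (simp add: fine_partition_def)

lemma cell_disjoint: "c \<noteq> c' \<Longrightarrow> cell \<kappa> c \<inter> cell \<kappa> c' = {}"
  by (auto simp: cell_def)

lemma cell_subset_mball: "fine_partition \<delta> \<kappa> \<Longrightarrow> cell \<kappa> c \<subseteq> torus.mball c \<delta>"
  by (auto simp: fine_partition_def cell_def)

lemma sum_cells:
  assumes \<kappa>: "fine_partition \<delta> \<kappa>" and \<mu>: "sets (borel_of torus_topology) \<subseteq> sets \<mu>"
    and A: "A \<in> sets (borel_of torus_topology)"
  shows "(\<Sum>c\<in>\<kappa> ` torus. emeasure \<mu> (A \<inter> cell \<kappa> c)) = emeasure \<mu> A"
proof -
  have "(\<Sum>c\<in>\<kappa> ` torus. emeasure \<mu> (A \<inter> cell \<kappa> c)) = emeasure \<mu> (\<Union>c\<in>\<kappa> ` torus. A \<inter> cell \<kappa> c)"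
  proof (rule sum_emeasure)
    show "(\<lambda>c. A \<inter> cell \<kappa> c) ` \<kappa> ` torus \<subseteq> sets \<mu>"
      using \<mu> sets.Int[OF A cell_borel[OF \<kappa>]] by blast
    show "disjoint_family_on (\<lambda>c. A \<inter> cell \<kappa> c) (\<kappa> ` torus)"
      using cell_disjoint by (fastforce simp: disjoint_family_on_def)
    show "finite (\<kappa> ` torus)" using \<kappa> by (simp add: fine_partition_def)
  qed
  also have "(\<Union>c\<in>\<kappa> ` torus. A \<inter> cell \<kappa> c) = A"
    using borel_torus_subset[OF A] by (auto simp: cell_def)
  finally show ?thesis .
qed

lemma torus_sets: "torus \<in> sets (borel_of torus_topology)"
  using sets.top[of "borel_of torus_topology"] by simp

lemma sum_vol_cells:
  assumes \<kappa>: "fine_partition \<delta> \<kappa>" and A: "A \<in> sets (borel_of torus_topology)"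
  shows "(\<Sum>c\<in>\<kappa> ` torus. vol (A \<inter> cell \<kappa> c)) = vol A"
proof -
  have "ennreal (\<Sum>c\<in>\<kappa> ` torus. vol (A \<inter> cell \<kappa> c)) = (\<Sum>c\<in>\<kappa> ` torus. emeasure lborel (A \<inter> cell \<kappa> c))"
    using emeasure_eq_vol(1)[OF sets.Int[OF A cell_borel[OF \<kappa>]]] by (simp add: sum_ennreal)
  also have "\<dots> = ennreal (vol A)"
    using sum_cells[OF \<kappa> _ A, of lborel] borel_torus_imp_borel emeasure_eq_vol[OF A] by auto
  finally show ?thesis by (simp add: sum_nonneg)
qed

lemma vol_mono:
  assumes "A \<subseteq> B" "A \<in> sets (borel_of torus_topology)" "B \<in> sets (borel_of torus_topology)"
  shows "vol A \<le> vol B"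
  using emeasure_mono[OF assms(1), of lborel] borel_torus_imp_borel[OF assms(3)]
  by (simp add: emeasure_eq_vol assms)

lemma vol_mball:
  fixes x :: "real ^ 'd"
  assumes "x \<in> torus" "0 \<le> r" "r \<le> 1 / 2"
  shows "vol (torus.mball x r) = unit_ball_volume TYPE('d) * r ^ CARD('d)"
  using emeasure_mball[OF assms] assms unit_ball_volume_pos[where 'd = 'd]
  by (simp add: measure_def)

lemma vol_diff_ge:
  assumes "A \<in> sets (borel_of torus_topology)" "B \<in> sets (borel_of torus_topology)"
  shows "vol A - vol B \<le> vol (A - B)"
proof -
  have "emeasure lborel A \<le> emeasure lborel (A - B) + emeasure lborel B"
    using borel_torus_imp_borel assms
    by (intro order_trans[OF emeasure_mono emeasure_subadditive]) auto
  then have "ennreal (vol A) \<le> ennreal (vol (A - B) + vol B)"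
    using assms by (simp add: emeasure_eq_vol sets.Diff)
  then show ?thesis by (subst (asm) ennreal_le_iff) auto
qed

lemma vol_cell_le:
  fixes \<kappa> :: "real ^ 'd \<Rightarrow> real ^ 'd"
  assumes "fine_partition \<delta> \<kappa>" "c \<in> torus" "0 < \<delta>" "\<delta> \<le> 1 / 2"
  shows "vol (cell \<kappa> c) \<le> unit_ball_volume TYPE('d) * \<delta> ^ CARD('d)"
  using vol_mono[OF cell_subset_mball[OF assms(1), of c]] vol_mball[OF assms(2), of \<delta>] assms by simp

section \<open>The mean number of isolated points\<close>

text \<open>Isolation of a point of a cell is replaced by a condition on the representative \<open>c\<close> of the cell: the
ball around \<open>c\<close>, with the cell removed, has fewer than \<open>k\<close> points. For a Poisson process this
condition is independent of the number of points in the cell. For a given finite configuration the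
replacement is exact as soon as \<open>\<delta>\<close> is small compared to the finitely many positive distances
between points and to the amounts by which distances below \<open>r\<close> fall short of \<open>r\<close>.\<close>

lemma discretized_count:
  fixes \<omega> :: "(real ^ 'd) measure"
  assumes \<omega>: "\<omega> \<in> point_measures torus_topology"
  obtains \<delta>0 where "0 < \<delta>0" "\<And>\<delta> \<kappa> A. 0 < \<delta> \<Longrightarrow> \<delta> \<le> \<delta>0 \<Longrightarrow> fine_partition \<delta> \<kappa> \<Longrightarrow>
     A \<in> sets (borel_of torus_topology) \<Longrightarrow>
     (\<Sum>c\<in>\<kappa> ` torus. emeasure \<omega> (A \<inter> cell \<kappa> c) * ind_lt k (emeasure \<omega> (torus.mball c (r - \<delta>) - cell \<kappa> c)))
       = emeasure \<omega> (A \<inter> isolated k r \<omega>)"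
proof -
  obtain p and I :: "nat set" where I: "finite I" "p \<in> I \<rightarrow> torus"
    "\<omega> = distr (count_space I) (borel_of torus_topology) p"
    "\<forall>A\<in>sets (borel_of torus_topology). emeasure \<omega> A = of_nat (card {i \<in> I. p i \<in> A})"
    by (rule configurationE[OF \<omega>])
  define F where "F = p ` I"
  have F: "finite F" "F \<subseteq> torus" using I(1,2) by (auto simp: F_def)
  have cong: "emeasure \<omega> A = emeasure \<omega> B"
    if "A \<in> sets (borel_of torus_topology)" "B \<in> sets (borel_of torus_topology)" "\<And>x. x \<in> F \<Longrightarrow> x \<in> A \<longleftrightarrow> x \<in> B"
    for A B
  proof -
    have "{i \<in> I. p i \<in> A} = {i \<in> I. p i \<in> B}" using that(3) by (auto simp: F_def)
    then show ?thesis using that I(4) by simp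
  qed
  \<comment> \<open>Cells of mesh at most \<open>Min D\<close> separate the points, and shrinking the ball by the mesh loses none
  of the points at distance less than \<open>r\<close>.\<close>
  define D where "D = insert 1 ((\<lambda>(x, y). torus_dist x y / 2) ` {z \<in> F \<times> F. fst z \<noteq> snd z} \<union>
     (\<lambda>(x, y). (r - torus_dist x y) / 2) ` {z \<in> F \<times> F. torus_dist (fst z) (snd z) < r})"
  have D: "finite D" "D \<noteq> {}" using F(1) by (auto simp: D_def)
  have Dpos: "0 < z" if "z \<in> D" for z
    using that F(2) unfolding D_def by (auto simp: torus.mdist_pos_less subset_iff)
  show thesis
  proof (rule that[of "Min D"])
    show "0 < Min D" using D Dpos by simp
    fix \<delta> :: real and \<kappa> :: "real ^ 'd \<Rightarrow> real ^ 'd" and A :: "(real ^ 'd) set"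
    assume \<delta>: "0 < \<delta>" "\<delta> \<le> Min D" and \<kappa>: "fine_partition \<delta> \<kappa>" and A: "A \<in> sets (borel_of torus_topology)"
    have d1: "2 * \<delta> \<le> torus_dist x y" if "x \<in> F" "y \<in> F" "x \<noteq> y" for x y
    proof -
      have "torus_dist x y / 2 \<in> D" unfolding D_def using that by force
      then show ?thesis using Min_le[OF D(1)] \<delta>(2) by fastforce
    qed
    have d2: "torus_dist x y + 2 * \<delta> \<le> r" if "x \<in> F" "y \<in> F" "torus_dist x y < r" for x y
    proof -
      have "(r - torus_dist x y) / 2 \<in> D" unfolding D_def using that by force
      then show ?thesis using Min_le[OF D(1)] \<delta>(2) by fastforce
    qed
    have iso: "isolated k r \<omega> \<in> sets (borel_of torus_topology)" by (rule isolated_borel[OF \<omega>])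
    have key: "emeasure \<omega> (torus.mball c (r - \<delta>) - cell \<kappa> c) = emeasure \<omega> (torus.mball x r - {x})"
      if x: "x \<in> F" "x \<in> cell \<kappa> c" for x c
    proof (rule cong)
      have c: "c \<in> torus" "x \<in> torus" "torus_dist c x < \<delta>" using x \<kappa> by (auto simp: cell_def fine_partition_def)
      fix y assume y: "y \<in> F"
      then have yt: "y \<in> torus" using F(2) by blast
      show "y \<in> torus.mball c (r - \<delta>) - cell \<kappa> c \<longleftrightarrow> y \<in> torus.mball x r - {x}"
      proof
        assume "y \<in> torus.mball c (r - \<delta>) - cell \<kappa> c"
        then have "torus_dist c y < r - \<delta>" "y \<noteq> x" using x by auto
        moreover have "torus_dist x y \<le> torus_dist x c + torus_dist c y" by (rule torus_dist_triangle)
        ultimately show "y \<in> torus.mball x r - {x}" using c yt by (auto simp: torus.commute)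
      next
        assume "y \<in> torus.mball x r - {x}"
        then have xy: "torus_dist x y < r" "y \<noteq> x" by auto
        have "torus_dist c y \<le> torus_dist c x + torus_dist x y" by (rule torus_dist_triangle)
        then have "torus_dist c y < r - \<delta>" using d2[OF x(1) y xy(1)] c(3) by linarith
        moreover have "y \<notin> cell \<kappa> c"
        proof
          assume "y \<in> cell \<kappa> c"
          then have "torus_dist c y < \<delta>" using \<kappa> by (auto simp: cell_def fine_partition_def)
          moreover have "torus_dist x y \<le> torus_dist x c + torus_dist c y" by (rule torus_dist_triangle)
          ultimately show False using d1[OF x(1) y] xy(2) c(3) by (auto simp: torus.commute)
        qed
        ultimately show "y \<in> torus.mball c (r - \<delta>) - cell \<kappa> c" using c yt by simp
      qed
    qed (use cell_borel[OF \<kappa>] in auto)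
    have "emeasure \<omega> (A \<inter> cell \<kappa> c) * ind_lt k (emeasure \<omega> (torus.mball c (r - \<delta>) - cell \<kappa> c)) =
        emeasure \<omega> (A \<inter> isolated k r \<omega> \<inter> cell \<kappa> c)" for c
    proof (cases "emeasure \<omega> (torus.mball c (r - \<delta>) - cell \<kappa> c) < of_nat k")
      case True
      have "emeasure \<omega> (A \<inter> cell \<kappa> c) = emeasure \<omega> (A \<inter> isolated k r \<omega> \<inter> cell \<kappa> c)"
      proof (rule cong)
        fix x assume "x \<in> F"
        then show "x \<in> A \<inter> cell \<kappa> c \<longleftrightarrow> x \<in> A \<inter> isolated k r \<omega> \<inter> cell \<kappa> c"
          using key[of x c] True F(2) by (auto simp: isolated_def)
      qed (use A iso cell_borel[OF \<kappa>] in auto)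
      then show ?thesis using True by (simp add: ind_lt_def)
    next
      case False
      have "emeasure \<omega> (A \<inter> isolated k r \<omega> \<inter> cell \<kappa> c) = emeasure \<omega> {}"
      proof (rule cong)
        fix x assume "x \<in> F"
        then show "x \<in> A \<inter> isolated k r \<omega> \<inter> cell \<kappa> c \<longleftrightarrow> x \<in> {}"
          using key[of x c] False by (auto simp: isolated_def)
      qed (use A iso cell_borel[OF \<kappa>] in auto)
      then show ?thesis using False by (simp add: ind_lt_def)
    qed
    then show "(\<Sum>c\<in>\<kappa> ` torus. emeasure \<omega> (A \<inter> cell \<kappa> c) *
        ind_lt k (emeasure \<omega> (torus.mball c (r - \<delta>) - cell \<kappa> c))) = emeasure \<omega> (A \<inter> isolated k r \<omega>)"
      using sum_cells[OF \<kappa>, of \<omega> "A \<inter> isolated k r \<omega>"] A iso \<omega> by (simp add: point_measures_sets)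
  qed
qed

lemma partition_sequence:
  obtains \<kappa> :: "nat \<Rightarrow> real ^ 'd \<Rightarrow> real ^ 'd" where "\<forall>m. fine_partition (1 / real (Suc m)) (\<kappa> m)"
proof -
  have "\<forall>m. \<exists>\<kappa> :: real ^ 'd \<Rightarrow> real ^ 'd. fine_partition (1 / real (Suc m)) \<kappa>"
    by (intro allI fine_partition_exists) simp
  then obtain \<kappa> :: "nat \<Rightarrow> real ^ 'd \<Rightarrow> real ^ 'd" where "\<forall>m. fine_partition (1 / real (Suc m)) (\<kappa> m)"
    by (rule choice[THEN exE])
  then show thesis using that by blast
qed

lemma mesh_tendsto: "(\<lambda>m. 1 / real (Suc m)) \<longlonglongrightarrow> 0"
  using LIMSEQ_inverse_real_of_nat by (simp add: inverse_eq_divide)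

lemma eventually_mesh_le: "0 < e \<Longrightarrow> eventually (\<lambda>m. 1 / real (Suc m) \<le> e) sequentially"
  using order_tendstoD(2)[OF mesh_tendsto, of e] by (auto elim: eventually_mono)

lemma discretized_count_tendsto:
  fixes \<omega> :: "(real ^ 'd) measure"
  assumes \<omega>: "\<omega> \<in> point_measures torus_topology" and \<kappa>: "\<And>m. fine_partition (1 / real (Suc m)) (\<kappa> m)"
    and A: "A \<in> sets (borel_of torus_topology)"
  shows "(\<lambda>m. \<Sum>c\<in>\<kappa> m ` torus. emeasure \<omega> (A \<inter> cell (\<kappa> m) c) *
      ind_lt k (emeasure \<omega> (torus.mball c (r - 1 / real (Suc m)) - cell (\<kappa> m) c)))
    \<longlonglongrightarrow> emeasure \<omega> (A \<inter> isolated k r \<omega>)"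
proof (rule discretized_count[OF \<omega>, of k r])
  fix \<delta>0 :: real
  assume "0 < \<delta>0" and eq: "\<And>\<delta> \<kappa> A. 0 < \<delta> \<Longrightarrow> \<delta> \<le> \<delta>0 \<Longrightarrow> fine_partition \<delta> \<kappa> \<Longrightarrow>
     A \<in> sets (borel_of torus_topology) \<Longrightarrow>
     (\<Sum>c\<in>\<kappa> ` torus. emeasure \<omega> (A \<inter> cell \<kappa> c) * ind_lt k (emeasure \<omega> (torus.mball c (r - \<delta>) - cell \<kappa> c)))
       = emeasure \<omega> (A \<inter> isolated k r \<omega>)"
  show ?thesis
    by (intro tendsto_eventually eventually_mono[OF eventually_mesh_le[OF \<open>0 < \<delta>0\<close>]] eq \<kappa> A) simp_all
qed

context torus_poisson
begin

text \<open>The discretized counts are built from counts of fixed Borel sets, and converge pointwise.\<close>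

lemma isolated_count_measurable:
  assumes A: "A \<in> sets (borel_of torus_topology)"
  shows "(\<lambda>\<omega>. emeasure (P \<omega>) (A \<inter> isolated k r (P \<omega>))) \<in> borel_measurable \<Omega>"
proof -
  obtain \<kappa> :: "nat \<Rightarrow> real ^ 'd \<Rightarrow> real ^ 'd" where "\<forall>m. fine_partition (1 / real (Suc m)) (\<kappa> m)"
    by (rule partition_sequence)
  then have \<kappa>: "fine_partition (1 / real (Suc m)) (\<kappa> m)" for m by blast
  note cellm = cell_borel[OF \<kappa>]
  note [measurable] = count_measurable[OF sets.Int[OF A cellm]] count_measurable[OF sets.Diff[OF mball_borel cellm]]
  show ?thesis
    by (rule borel_measurable_LIMSEQ_order[OF discretized_count_tendsto[OF configuration \<kappa> A]]) measurable
qed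

text \<open>This is Campbell's formula for the isolated points. It follows from the discretized counts by
dominated convergence, the number of all points being the dominating function: the expectation of
a summand factorizes, and its second factor involves a ball of volume close to \<open>\<theta> * r ^ d\<close>.\<close>

lemma mean_isolated_count:
  assumes A: "A \<in> sets (borel_of torus_topology)" and r: "0 < r" "r \<le> 1 / 2"
  shows "(\<integral>\<^sup>+\<omega>. emeasure (P \<omega>) (A \<inter> isolated k r (P \<omega>)) \<partial>\<Omega>) =
      ennreal (t * vol A * pois_lt k (t * unit_ball_volume TYPE('d) * r ^ CARD('d)))"
proof -
  let ?\<theta> = "unit_ball_volume TYPE('d)" and ?d = "CARD('d)"
  have \<theta>: "0 < ?\<theta>" by (rule unit_ball_volume_pos)
  obtain \<kappa> :: "nat \<Rightarrow> real ^ 'd \<Rightarrow> real ^ 'd" where "\<forall>m. fine_partition (1 / real (Suc m)) (\<kappa> m)"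
    by (rule partition_sequence)
  then have \<kappa>: "fine_partition (1 / real (Suc m)) (\<kappa> m)" for m by blast
  define \<delta> where "\<delta> m = 1 / real (Suc m)" for m
  have \<delta>pos: "0 < \<delta> m" for m by (simp add: \<delta>_def)
  note cellm = cell_borel[OF \<kappa>]
  define B where "B m c = torus.mball c (r - \<delta> m) - cell (\<kappa> m) c" for m and c :: "real ^ 'd"
  have Bm: "B m c \<in> sets (borel_of torus_topology)" for m c
    unfolding B_def by (intro sets.Diff cellm mball_borel)
  have Am: "A \<inter> cell (\<kappa> m) c \<in> sets (borel_of torus_topology)" for m c
    by (intro sets.Int A cellm)
  define S where "S m \<omega> = (\<Sum>c\<in>\<kappa> m ` torus. emeasure (P \<omega>) (A \<inter> cell (\<kappa> m) c) * ind_lt k (emeasure (P \<omega>) (B m c)))" for m \<omega>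
  define N where "N \<omega> = emeasure (P \<omega>) (A \<inter> isolated k r (P \<omega>))" for \<omega>
  note [measurable] = count_measurable[OF Am] count_measurable[OF Bm]
  have Sterm: "(\<lambda>\<omega>. emeasure (P \<omega>) (A \<inter> cell (\<kappa> m) c) * ind_lt k (emeasure (P \<omega>) (B m c))) \<in> borel_measurable \<Omega>" for m c
    by measurable
  have Smeas: "S m \<in> borel_measurable \<Omega>" for m
    unfolding S_def by (intro borel_measurable_sum Sterm)
  have lim: "(\<lambda>m. S m \<omega>) \<longlonglongrightarrow> N \<omega>" if \<omega>: "\<omega> \<in> space \<Omega>" for \<omega>
    unfolding S_def N_def B_def \<delta>_def by (rule discretized_count_tendsto[OF configuration[OF \<omega>] \<kappa> A])
  note Nmeas = isolated_count_measurable[OF A, of k r]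
  have Sle: "S m \<omega> \<le> emeasure (P \<omega>) A" if \<omega>: "\<omega> \<in> space \<Omega>" for m \<omega>
  proof -
    have "S m \<omega> \<le> (\<Sum>c\<in>\<kappa> m ` torus. emeasure (P \<omega>) (A \<inter> cell (\<kappa> m) c) * 1)"
      unfolding S_def by (intro sum_mono mult_left_mono) (auto simp: ind_lt_def)
    also have "\<dots> = emeasure (P \<omega>) A"
      using sum_cells[OF \<kappa>, of "P \<omega>" A m] A point_measures_sets[OF configuration[OF \<omega>]] by simp
    finally show ?thesis .
  qed
  have conv: "(\<lambda>m. \<integral>\<^sup>+\<omega>. S m \<omega> \<partial>\<Omega>) \<longlonglongrightarrow> (\<integral>\<^sup>+\<omega>. N \<omega> \<partial>\<Omega>)"
  proof (rule nn_integral_dominated_convergence[where w = "\<lambda>\<omega>. emeasure (P \<omega>) A"])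
    show "(\<integral>\<^sup>+\<omega>. emeasure (P \<omega>) A \<partial>\<Omega>) < \<infinity>" by (simp add: mean_count[OF A])
  qed (use Smeas Nmeas count_measurable[OF A] Sle lim in \<open>auto simp: N_def\<close>)
  define e where "e m = (\<Sum>c\<in>\<kappa> m ` torus. t * vol (A \<inter> cell (\<kappa> m) c) * pois_lt k (t * vol (B m c)))" for m
  have Se: "(\<integral>\<^sup>+\<omega>. S m \<omega> \<partial>\<Omega>) = ennreal (e m)" for m
  proof -
    have "(\<integral>\<^sup>+\<omega>. S m \<omega> \<partial>\<Omega>) = (\<Sum>c\<in>\<kappa> m ` torus. \<integral>\<^sup>+\<omega>. emeasure (P \<omega>) (A \<inter> cell (\<kappa> m) c) * ind_lt k (emeasure (P \<omega>) (B m c)) \<partial>\<Omega>)"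
      unfolding S_def by (rule nn_integral_sum[OF Sterm])
    also have "\<dots> = (\<Sum>c\<in>\<kappa> m ` torus. ennreal (t * vol (A \<inter> cell (\<kappa> m) c) * pois_lt k (t * vol (B m c))))"
      by (intro sum.cong refl nn_integral_count_mult_lt Am Bm) (auto simp: B_def)
    also have "\<dots> = ennreal (e m)"
      unfolding e_def using t_nonneg by (intro sum_ennreal) (auto intro!: mult_nonneg_nonneg pois_lt_nonneg)
    finally show ?thesis .
  qed
  define lo where "lo m = t * vol A * pois_lt k (t * (?\<theta> * (r - \<delta> m) ^ ?d))" for m
  define hi where "hi m = t * vol A * pois_lt k (t * (?\<theta> * (r - \<delta> m) ^ ?d - ?\<theta> * \<delta> m ^ ?d))" for m
  have bounds: "eventually (\<lambda>m. lo m \<le> e m \<and> e m \<le> hi m) sequentially"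
    using eventually_mesh_le[OF half_gt_zero[OF r(1)]]
  proof eventually_elim
    case (elim m)
    have \<delta>: "0 < \<delta> m" "\<delta> m \<le> r / 2" "\<delta> m \<le> r - \<delta> m" "r - \<delta> m \<le> 1 / 2" "\<delta> m \<le> 1 / 2"
      using elim[folded \<delta>_def] r \<delta>pos[of m] by linarith+
    have vs: "(\<Sum>c\<in>\<kappa> m ` torus. vol (A \<inter> cell (\<kappa> m) c)) = vol A" by (rule sum_vol_cells[OF \<kappa> A])
    have V: "vol (B m c) \<le> ?\<theta> * (r - \<delta> m) ^ ?d" "?\<theta> * (r - \<delta> m) ^ ?d - ?\<theta> * \<delta> m ^ ?d \<le> vol (B m c)"
      if "c \<in> \<kappa> m ` torus" for c
    proof -
      have c: "c \<in> torus" using that \<kappa>[of m] by (auto simp: fine_partition_def)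
      have vb: "vol (torus.mball c (r - \<delta> m)) = ?\<theta> * (r - \<delta> m) ^ ?d"
        using \<delta> by (intro vol_mball c) auto
      show "vol (B m c) \<le> ?\<theta> * (r - \<delta> m) ^ ?d"
        unfolding vb[symmetric] by (intro vol_mono Bm mball_borel) (auto simp: B_def)
      have "vol (cell (\<kappa> m) c) \<le> ?\<theta> * \<delta> m ^ ?d"
        using \<delta> \<kappa>[of m] by (intro vol_cell_le c) (auto simp: \<delta>_def)
      then show "?\<theta> * (r - \<delta> m) ^ ?d - ?\<theta> * \<delta> m ^ ?d \<le> vol (B m c)"
        using vol_diff_ge[OF mball_borel cellm, of c "r - \<delta> m" m c] vb by (simp add: B_def)
    qed
    have pos: "0 \<le> ?\<theta> * (r - \<delta> m) ^ ?d - ?\<theta> * \<delta> m ^ ?d"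
      using \<delta> \<theta> by (simp add: power_mono)
    have "lo m = (\<Sum>c\<in>\<kappa> m ` torus. t * vol (A \<inter> cell (\<kappa> m) c) * pois_lt k (t * (?\<theta> * (r - \<delta> m) ^ ?d)))"
      unfolding lo_def vs[symmetric] by (simp add: sum_distrib_left sum_distrib_right)
    also have "\<dots> \<le> e m" unfolding e_def
      using V t_nonneg by (intro sum_mono mult_left_mono pois_lt_antimono) auto
    finally have "lo m \<le> e m" .
    have "e m \<le> (\<Sum>c\<in>\<kappa> m ` torus. t * vol (A \<inter> cell (\<kappa> m) c) * pois_lt k (t * (?\<theta> * (r - \<delta> m) ^ ?d - ?\<theta> * \<delta> m ^ ?d)))"
      unfolding e_def
      using V t_nonneg pos by (intro sum_mono mult_left_mono pois_lt_antimono) auto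
    also have "\<dots> = hi m"
      unfolding hi_def vs[symmetric] by (simp add: sum_distrib_left sum_distrib_right)
    finally show ?case using \<open>lo m \<le> e m\<close> by simp
  qed
  have \<delta>0: "\<delta> \<longlonglongrightarrow> 0" unfolding \<delta>_def by (rule mesh_tendsto)
  have lo: "lo \<longlonglongrightarrow> t * vol A * pois_lt k (t * (?\<theta> * (r - 0) ^ ?d))"
    unfolding lo_def by (intro tendsto_intros \<delta>0)
  have hi: "hi \<longlonglongrightarrow> t * vol A * pois_lt k (t * (?\<theta> * (r - 0) ^ ?d - ?\<theta> * 0 ^ ?d))"
    unfolding hi_def by (intro tendsto_intros \<delta>0)
  have "e \<longlonglongrightarrow> t * vol A * pois_lt k (t * ?\<theta> * r ^ ?d)"
  proof (rule tendsto_sandwich)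
    show "eventually (\<lambda>m. lo m \<le> e m) sequentially" using bounds by (rule eventually_mono) simp
    show "eventually (\<lambda>m. e m \<le> hi m) sequentially" using bounds by (rule eventually_mono) simp
  qed (use lo hi in \<open>simp_all add: mult.assoc power_0_left\<close>)
  then have "(\<lambda>m. \<integral>\<^sup>+\<omega>. S m \<omega> \<partial>\<Omega>) \<longlonglongrightarrow> ennreal (t * vol A * pois_lt k (t * ?\<theta> * r ^ ?d))"
    unfolding Se by (rule tendsto_ennrealI)
  then show "(\<integral>\<^sup>+\<omega>. emeasure (P \<omega>) (A \<inter> isolated k r (P \<omega>)) \<partial>\<Omega>) = ennreal (t * vol A * pois_lt k (t * ?\<theta> * r ^ ?d))"
    using LIMSEQ_unique[OF conv] unfolding N_def by blast
qed

end

section \<open>Pairs of isolated points\<close>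

text \<open>If there are two isolated points or more, then they all lie in one cell, which is counted by the
first sum, or each of them can be paired with one in another cell. Isolation of two points in the
cells of \<open>c\<close> and \<open>c'\<close> makes the ball around \<open>c\<close>, and the part of the ball around \<open>c'\<close> outside it,
contain few points besides those of the two cells. The four sets involved are disjoint. When the
cells are close, each point counts as a neighbour of the other, so only \<open>k - 1\<close> instead of \<open>k\<close> is
available in the first ball; the estimates below depend on this gain.\<close>

lemma isolated_pairs_bound:
  fixes \<omega> :: "(real ^ 'd) measure"
  assumes \<omega>: "\<omega> \<in> point_measures torus_topology" and \<kappa>: "fine_partition \<delta> \<kappa>"
    and \<delta>: "0 < \<delta>" "\<delta> \<le> r / 4" and e: "e \<le> 1 / 2"
  shows "ge2 (emeasure \<omega> (isolated k r \<omega>)) \<le> (\<Sum>c\<in>\<kappa> ` torus. ge2 (emeasure \<omega> (cell \<kappa> c))) +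
    (\<Sum>c\<in>\<kappa> ` torus. \<Sum>c'\<in>\<kappa> ` torus - {c}. emeasure \<omega> (cell \<kappa> c) * emeasure \<omega> (cell \<kappa> c') *
       ind_lt (if torus_dist c c' < e * r then k - 1 else k)
         (emeasure \<omega> (torus.mball c (r - \<delta>) - (cell \<kappa> c \<union> cell \<kappa> c'))) *
       ind_lt k (emeasure \<omega> (torus.mball c' (r - \<delta>) - (torus.mball c (r - \<delta>) \<union> cell \<kappa> c \<union> cell \<kappa> c'))))"
    (is "_ \<le> ?S1 + (\<Sum>c\<in>?C. \<Sum>c'\<in>?C - {c}. ?T c c')")
proof -
  obtain p and I :: "nat set" where I: "finite I" "p \<in> I \<rightarrow> torus"
    "\<omega> = distr (count_space I) (borel_of torus_topology) p"
    "\<forall>A\<in>sets (borel_of torus_topology). emeasure \<omega> A = of_nat (card {i \<in> I. p i \<in> A})"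
    by (rule configurationE[OF \<omega>])
  let ?J = "isolated k r \<omega>"
  have fin: "finite ?C" using \<kappa> by (simp add: fine_partition_def)
  have iso: "?J \<in> sets (borel_of torus_topology)" by (rule isolated_borel[OF \<omega>])
  note cb = cell_borel[OF \<kappa>]
  have \<omega>s: "sets \<omega> = sets (borel_of torus_topology)" by (rule point_measures_sets[OF \<omega>])
  define N where "N c = card {i \<in> I. p i \<in> ?J \<inter> cell \<kappa> c}" for c
  have N: "emeasure \<omega> (?J \<inter> cell \<kappa> c) = of_nat (N c)" for c
    unfolding N_def using I(4) sets.Int[OF iso cb] by blast
  have NJ: "emeasure \<omega> ?J = of_nat (\<Sum>c\<in>?C. N c)"
    using sum_cells[OF \<kappa>, of \<omega> ?J] iso \<omega>s by (simp add: N)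
  have Nle: "of_nat (N c) \<le> emeasure \<omega> (cell \<kappa> c)" for c
    unfolding N[symmetric] using cb \<omega>s by (intro emeasure_mono) auto
  have pair: "of_nat (N c * N c') \<le> ?T c c'" if c: "c \<in> ?C" and c': "c' \<in> ?C - {c}" for c c'
  proof (cases "N c = 0 \<or> N c' = 0")
    case False
    then have "{i \<in> I. p i \<in> ?J \<inter> cell \<kappa> c} \<noteq> {}" "{i \<in> I. p i \<in> ?J \<inter> cell \<kappa> c'} \<noteq> {}"
      unfolding N_def by (metis card.empty)+
    then obtain i j where i: "i \<in> I" "p i \<in> ?J" "p i \<in> cell \<kappa> c" and j: "j \<in> I" "p j \<in> ?J" "p j \<in> cell \<kappa> c'"
      by blast
    define x y where "x = p i" and "y = p j"
    have x: "x \<in> ?J" "x \<in> cell \<kappa> c" "x \<in> torus" and y: "y \<in> ?J" "y \<in> cell \<kappa> c'" "y \<in> torus"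
      using i j I(2) by (auto simp: x_def y_def)
    have ct: "c \<in> torus" "c' \<in> torus" using c c' \<kappa> by (auto simp: fine_partition_def)
    have dx: "torus_dist c x < \<delta>" and dy: "torus_dist c' y < \<delta>"
      using x y \<kappa> by (auto simp: fine_partition_def cell_def)
    have xy: "x \<noteq> y" using x(2) y(2) c' by (auto simp: cell_def)
    have sub: "torus.mball c'' (r - \<delta>) - cell \<kappa> c'' \<subseteq> torus.mball z r - {z}"
      if "z \<in> cell \<kappa> c''" "torus_dist c'' z < \<delta>" "z \<in> torus" for c'' z
    proof
      fix w assume w: "w \<in> torus.mball c'' (r - \<delta>) - cell \<kappa> c''"
      then have "torus_dist z w < r"
        using torus_dist_triangle[of z w c''] that by (auto simp: torus.commute)
      then show "w \<in> torus.mball z r - {z}" using w that by auto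
    qed
    let ?D1 = "torus.mball c (r - \<delta>) - (cell \<kappa> c \<union> cell \<kappa> c')"
    let ?D2 = "torus.mball c' (r - \<delta>) - (torus.mball c (r - \<delta>) \<union> cell \<kappa> c \<union> cell \<kappa> c')"
    have D: "?D1 \<in> sets (borel_of torus_topology)" "?D2 \<in> sets (borel_of torus_topology)"
      using cb by (auto intro!: sets.Diff sets.Un)
    have "emeasure \<omega> ?D2 \<le> emeasure \<omega> (torus.mball y r - {y})"
      using sub[OF y(2) dy y(3)] \<omega>s by (intro emeasure_mono) auto
    also have "\<dots> < of_nat k" using y(1) by (simp add: isolated_def)
    finally have 2: "ind_lt k (emeasure \<omega> ?D2) = 1" by (simp add: ind_lt_def)
    have xk: "emeasure \<omega> (torus.mball x r - {x}) < of_nat k" using x(1) by (simp add: isolated_def)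
    \<comment> \<open>The point \<open>y\<close> is in the ball around \<open>x\<close> but not in \<open>?D1\<close>, which gains one.\<close>
    have 1: "ind_lt (if torus_dist c c' < e * r then k - 1 else k) (emeasure \<omega> ?D1) = 1"
    proof (cases "torus_dist c c' < e * r")
      case True
      have "torus_dist x y \<le> torus_dist x c + torus_dist c c' + torus_dist c' y"
        using torus_dist_triangle[of x y c] torus_dist_triangle[of c y c'] by simp
      also have "\<dots> < \<delta> + e * r + \<delta>" using dx dy True by (simp add: torus.commute)
      also have "\<dots> \<le> r"
      proof -
        have "e * r \<le> 1 / 2 * r" by (rule mult_right_mono[OF e]) (use \<delta> in simp)
        then show ?thesis using \<delta> by linarith
      qed
      finally have y_in: "y \<in> torus.mball x r - {x}" using x y xy by simp
      have "y \<notin> ?D1" using y(2) by blast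
      then have "card {i \<in> I. p i \<in> ?D1} < card {i \<in> I. p i \<in> torus.mball x r - {x}}"
        using I(1) sub[OF x(2) dx x(3)] y_in j(1)
        by (intro psubset_card_mono) (auto simp: y_def)
      moreover have "card {i \<in> I. p i \<in> torus.mball x r - {x}} < k"
        using xk I(4) by (simp del: torus.in_mball)
      ultimately have "card {i \<in> I. p i \<in> ?D1} < k - 1" by linarith
      then have "ind_lt (k - 1) (emeasure \<omega> ?D1) = 1"
        using I(4)[rule_format, OF D(1)] by (simp add: ind_lt_def)
      then show ?thesis using True by simp
    next
      case False
      have "emeasure \<omega> ?D1 \<le> emeasure \<omega> (torus.mball x r - {x})"
        using sub[OF x(2) dx x(3)] \<omega>s by (intro emeasure_mono) auto
      then show ?thesis using False xk by (simp add: ind_lt_def)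
    qed
    show ?thesis unfolding 1 2 using mult_mono[OF Nle[of c] Nle[of c']] by simp
  qed auto
  show ?thesis
  proof (cases "2 \<le> (\<Sum>c\<in>?C. N c)")
    case False
    then have "\<not> (of_nat 2 \<le> (of_nat (\<Sum>c\<in>?C. N c) :: ennreal))" by (simp del: of_nat_sum of_nat_numeral)
    then show ?thesis by (simp add: ge2_def NJ del: of_nat_sum)
  next
    case True
    show ?thesis
    proof (cases "\<exists>c\<in>?C. N c = (\<Sum>c\<in>?C. N c)")
      case True
      then obtain c where c: "c \<in> ?C" "N c = (\<Sum>c\<in>?C. N c)" by blast
      have "of_nat 2 \<le> (of_nat (N c) :: ennreal)" using \<open>2 \<le> _\<close> c(2) by (simp del: of_nat_sum of_nat_numeral)
      from order_trans[OF this Nle[of c]] have "2 \<le> emeasure \<omega> (cell \<kappa> c)" by simp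
      then have "ge2 (emeasure \<omega> ?J) \<le> ge2 (emeasure \<omega> (cell \<kappa> c))"
        using Nle[of c] c(2) by (simp add: ge2_def NJ del: of_nat_sum)
      also have "\<dots> \<le> ?S1" by (rule member_le_sum[OF c(1)]) (use fin in auto)
      finally show ?thesis by (rule order_trans) simp
    next
      case False
      have "(\<Sum>c\<in>?C. N c) \<le> (\<Sum>c\<in>?C. \<Sum>c'\<in>?C - {c}. N c * N c')"
      proof (rule sum_mono)
        fix c assume c: "c \<in> ?C"
        have "(\<Sum>c\<in>?C. N c) = N c + (\<Sum>c'\<in>?C - {c}. N c')" by (rule sum.remove[OF fin c])
        moreover have "N c \<noteq> (\<Sum>c\<in>?C. N c)" using False c by blast
        ultimately have "1 \<le> (\<Sum>c'\<in>?C - {c}. N c')" by linarith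
        then have "N c * 1 \<le> N c * (\<Sum>c'\<in>?C - {c}. N c')" by (rule mult_left_mono) simp
        then show "N c \<le> (\<Sum>c'\<in>?C - {c}. N c * N c')" by (simp add: sum_distrib_left)
      qed
      then have "(of_nat (\<Sum>c\<in>?C. N c) :: ennreal) \<le> of_nat (\<Sum>c\<in>?C. \<Sum>c'\<in>?C - {c}. N c * N c')"
        by (rule of_nat_mono)
      also have "\<dots> = (\<Sum>c\<in>?C. \<Sum>c'\<in>?C - {c}. of_nat (N c * N c'))"
        by (simp only: of_nat_sum)
      also have "\<dots> \<le> (\<Sum>c\<in>?C. \<Sum>c'\<in>?C - {c}. ?T c c')"
        by (intro sum_mono pair)
      finally have "emeasure \<omega> ?J \<le> (\<Sum>c\<in>?C. \<Sum>c'\<in>?C - {c}. ?T c c')" unfolding NJ .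
      moreover have "ge2 (emeasure \<omega> ?J) \<le> emeasure \<omega> ?J" by (simp add: ge2_def)
      ultimately show ?thesis by (meson order_trans add_increasing zero_le)
    qed
  qed
qed

lemma sum_vol_cells_near:
  fixes \<kappa> :: "real ^ 'd \<Rightarrow> real ^ 'd"
  assumes \<kappa>: "fine_partition \<delta> \<kappa>" and c: "c \<in> torus" and s: "0 \<le> s" "0 < \<delta>" "s + \<delta> \<le> 1 / 2"
  shows "(\<Sum>c'\<in>\<kappa> ` torus. (if torus_dist c c' < s then vol (cell \<kappa> c') else 0))
           \<le> unit_ball_volume TYPE('d) * (s + \<delta>) ^ CARD('d)"
proof -
  have fin: "finite (\<kappa> ` torus)" using \<kappa> by (simp add: fine_partition_def)
  have "(\<Sum>c'\<in>\<kappa> ` torus. (if torus_dist c c' < s then vol (cell \<kappa> c') else 0)) \<le>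
      (\<Sum>c'\<in>\<kappa> ` torus. vol (torus.mball c (s + \<delta>) \<inter> cell \<kappa> c'))"
  proof (rule sum_mono)
    fix c' assume "c' \<in> \<kappa> ` torus"
    show "(if torus_dist c c' < s then vol (cell \<kappa> c') else 0) \<le> vol (torus.mball c (s + \<delta>) \<inter> cell \<kappa> c')"
    proof (cases "torus_dist c c' < s")
      case True
      have "cell \<kappa> c' \<subseteq> torus.mball c (s + \<delta>)"
      proof
        fix x assume "x \<in> cell \<kappa> c'"
        then have "x \<in> torus" "torus_dist c' x < \<delta>" using \<kappa> by (auto simp: fine_partition_def cell_def)
        then show "x \<in> torus.mball c (s + \<delta>)"
          using c True torus_dist_triangle[of c x c'] by simp
      qed
      then have "torus.mball c (s + \<delta>) \<inter> cell \<kappa> c' = cell \<kappa> c'" by blast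
      then show ?thesis by simp
    qed simp
  qed
  also have "\<dots> = vol (torus.mball c (s + \<delta>))" by (rule sum_vol_cells[OF \<kappa> mball_borel])
  also have "\<dots> = unit_ball_volume TYPE('d) * (s + \<delta>) ^ CARD('d)" using s by (intro vol_mball c) auto
  finally show ?thesis .
qed

lemma pois_lt_le_1: "0 \<le> l \<Longrightarrow> pois_lt k l \<le> 1"
proof -
  assume "0 \<le> l"
  then have "pois_lt k l \<le> pois_lt k 0" by (intro pois_lt_antimono) auto
  also have "\<dots> \<le> 1" by (cases k) (simp_all add: pois_lt_def lessThan_Suc_eq_insert_0 sum.reindex)
  finally show ?thesis .
qed

context torus_poisson
begin

text \<open>Pairs of cells are sorted by the distance of their representatives. Below \<open>e * r\<close> there are few
partners, and the bound \<open>k - 1\<close> applies; between \<open>e * r\<close> and \<open>2 * r\<close> the volume of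
the lune is at least proportional to \<open>e\<close>; from \<open>2 * r\<close> on the two balls are disjoint. The terms \<open>2 * v\<close> compensate for
the removal of the two cells.\<close>

lemma mean_isolated_pairs_mesh:
  fixes \<delta> r e :: real and \<kappa> :: "real ^ 'd \<Rightarrow> real ^ 'd"
  defines "\<theta> \<equiv> unit_ball_volume TYPE('d)" and "d \<equiv> CARD('d)"
  defines "v \<equiv> \<theta> * \<delta> ^ d"
  defines "L1 \<equiv> t * (\<theta> * (r - \<delta>) ^ d - 2 * v)" and "L2 \<equiv> t * (\<theta> * (r - \<delta>) ^ d * e / 4 - 2 * v)"
  assumes \<kappa>: "fine_partition \<delta> \<kappa>" and \<delta>: "0 < \<delta>" "\<delta> \<le> r / 4" and r: "0 < r" "r \<le> 1 / 8"
    and e: "0 < e" "e \<le> 1 / 2" and L2: "0 \<le> L2"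
  shows "(\<integral>\<^sup>+\<omega>. ge2 (emeasure (P \<omega>) (isolated k r (P \<omega>))) \<partial>\<Omega>) \<le>
    ennreal (t\<^sup>2 * v + t\<^sup>2 * (pois_lt (k - 1) L1 * (\<theta> * (e * r + \<delta>) ^ d) +
       pois_lt k L1 * pois_lt k L2 * (\<theta> * (2 * r + \<delta>) ^ d) + pois_lt k L1 * pois_lt k L1))"
proof -
  let ?C = "\<kappa> ` torus"
  have \<theta>: "0 < \<theta>" unfolding \<theta>_def by (rule unit_ball_volume_pos)
  have fin: "finite ?C" using \<kappa> by (simp add: fine_partition_def)
  note cb = cell_borel[OF \<kappa>]
  define D1 where "D1 c c' = torus.mball c (r - \<delta>) - (cell \<kappa> c \<union> cell \<kappa> c')" for c c'
  define D2 where "D2 c c' = torus.mball c' (r - \<delta>) - (torus.mball c (r - \<delta>) \<union> cell \<kappa> c \<union> cell \<kappa> c')" for c c'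
  have D: "D1 c c' \<in> sets (borel_of torus_topology)" "D2 c c' \<in> sets (borel_of torus_topology)" for c c'
    unfolding D1_def D2_def using cb by (auto intro!: sets.Diff sets.Un)
  define K where "K c c' = (if torus_dist c c' < e * r then k - 1 else k)" for c c' :: "real ^ 'd"
  define T where "T c c' \<omega> = emeasure (P \<omega>) (cell \<kappa> c) * emeasure (P \<omega>) (cell \<kappa> c') *
       ind_lt (K c c') (emeasure (P \<omega>) (D1 c c')) * ind_lt k (emeasure (P \<omega>) (D2 c c'))" for c c' \<omega>
  note [measurable] = count_measurable[OF cb] count_measurable[OF D(1)] count_measurable[OF D(2)]
  have Tm [measurable]: "T c c' \<in> borel_measurable \<Omega>" for c c' unfolding T_def by measurable
  have gm [measurable]: "(\<lambda>\<omega>. ge2 (emeasure (P \<omega>) (cell \<kappa> c))) \<in> borel_measurable \<Omega>" for c by measurable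
  define G where "G c c' = pois_lt (K c c') (t * vol (D1 c c')) * pois_lt k (t * vol (D2 c c'))" for c c'
  define v' where "v' c = vol (cell \<kappa> c)" for c
  have v'0: "0 \<le> v' c" for c by (simp add: v'_def)
  have ET: "(\<integral>\<^sup>+\<omega>. T c c' \<omega> \<partial>\<Omega>) = ennreal (t\<^sup>2 * (v' c * (v' c' * G c c')))" if "c \<noteq> c'" for c c'
  proof -
    have "(\<integral>\<^sup>+\<omega>. T c c' \<omega> \<partial>\<Omega>) = ennreal (t * v' c * (t * v' c') * pois_lt (K c c') (t * vol (D1 c c')) * pois_lt k (t * vol (D2 c c')))"
      unfolding T_def v'_def
      by (intro nn_integral_two_counts_mult_lt cb D cell_disjoint that) (auto simp: D1_def D2_def)
    then show ?thesis by (simp add: G_def power2_eq_square mult_ac)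
  qed
  have ct: "c \<in> torus" if "c \<in> ?C" for c using that \<kappa> by (auto simp: fine_partition_def)
  have v'le: "v' c \<le> v" if "c \<in> ?C" for c
    unfolding v'_def v_def \<theta>_def d_def using \<delta> r by (intro vol_cell_le[OF \<kappa> ct[OF that]]) auto
  have sumv': "(\<Sum>c\<in>?C. v' c) = 1"
    using sum_vol_cells[OF \<kappa> torus_sets] emeasure_torus[where 'd = 'd] cell_def[of \<kappa>]
    by (simp add: v'_def measure_def Int_absorb1 cell_def subset_iff)
  have v: "0 \<le> v" using \<theta> \<delta> by (simp add: v_def)
  have L1: "0 \<le> L1"
  proof -
    have "\<theta> * (r - \<delta>) ^ d * (e / 4) \<le> \<theta> * (r - \<delta>) ^ d * 1"
      using e \<theta> \<delta> r by (intro mult_left_mono mult_nonneg_nonneg) auto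
    then have "L2 \<le> L1" unfolding L1_def L2_def using t_nonneg by (intro mult_left_mono) auto
    then show ?thesis using L2 by simp
  qed
  have volball: "vol (torus.mball c (r - \<delta>)) = \<theta> * (r - \<delta>) ^ d" if "c \<in> ?C" for c
    unfolding \<theta>_def d_def using \<delta> r by (intro vol_mball ct[OF that]) auto
  have cells: "vol (cell \<kappa> c \<union> cell \<kappa> c') \<le> 2 * v" if "c \<in> ?C" "c' \<in> ?C" for c c'
  proof -
    have "vol (cell \<kappa> c \<union> cell \<kappa> c') \<le> vol (cell \<kappa> c) + vol (cell \<kappa> c')"
      using cb by (intro measure_Un_le) (auto intro: borel_torus_imp_borel)
    then show ?thesis using v'le[OF that(1)] v'le[OF that(2)] by (simp add: v'_def)
  qed
  have cellsm: "cell \<kappa> c \<union> cell \<kappa> c' \<in> sets (borel_of torus_topology)" for c c' using cb by (rule sets.Un[OF _ cb])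
  have vD1: "L1 \<le> t * vol (D1 c c')" if "c \<in> ?C" "c' \<in> ?C" for c c'
    unfolding L1_def D1_def
    using vol_diff_ge[OF mball_borel cellsm, of c "r - \<delta>" c c'] cells[OF that] volball[OF that(1)] t_nonneg
    by (intro mult_left_mono) auto
  have D2_eq: "D2 c c' = (torus.mball c' (r - \<delta>) - torus.mball c (r - \<delta>)) - (cell \<kappa> c \<union> cell \<kappa> c')" for c c'
    by (auto simp: D2_def)
  have mm: "torus.mball c' (r - \<delta>) - torus.mball c (r - \<delta>) \<in> sets (borel_of torus_topology)" for c c'
    by (intro sets.Diff mball_borel)
  have vD2: "L2 \<le> t * vol (D2 c c')" if c: "c \<in> ?C" "c' \<in> ?C" and far: "\<not> torus_dist c c' < e * r" for c c'
  proof -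
    have "ennreal (\<theta> * (r - \<delta>) ^ d * e / 4) \<le> emeasure lborel (torus.mball c' (r - \<delta>) - torus.mball c (r - \<delta>))"
      unfolding \<theta>_def d_def
    proof (rule emeasure_mball_diff_mball[OF ct[OF c(2)] ct[OF c(1)]])
      have "e * (r - \<delta>) \<le> e * r" using e \<delta> by (intro mult_left_mono) auto
      then show "e * (r - \<delta>) \<le> torus_dist c' c" using far by (simp add: torus.commute)
    qed (use \<delta> r e in auto)
    then have "\<theta> * (r - \<delta>) ^ d * e / 4 \<le> vol (torus.mball c' (r - \<delta>) - torus.mball c (r - \<delta>))"
      unfolding emeasure_eq_vol(1)[OF mm] by (subst (asm) ennreal_le_iff) auto
    then show ?thesis
      unfolding L2_def D2_eq
      using vol_diff_ge[OF mm cellsm, of c' c c c'] cells[OF c] t_nonneg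
      by (intro mult_left_mono) auto
  qed
  have vD2': "L1 \<le> t * vol (D2 c c')" if c: "c \<in> ?C" "c' \<in> ?C" and far: "\<not> torus_dist c c' < 2 * r" for c c'
  proof -
    have "torus.mball c' (r - \<delta>) \<inter> torus.mball c (r - \<delta>) = {}"
    proof (rule equals0I)
      fix z assume "z \<in> torus.mball c' (r - \<delta>) \<inter> torus.mball c (r - \<delta>)"
      then show False using far torus_dist_triangle[of c c' z] \<delta> by (auto simp: torus.commute)
    qed
    then have "torus.mball c' (r - \<delta>) - torus.mball c (r - \<delta>) = torus.mball c' (r - \<delta>)" by blast
    then show ?thesis
      unfolding L1_def D2_eq
      using vol_diff_ge[OF mball_borel cellsm, of c' "r - \<delta>" c c'] cells[OF c] volball[OF c(2)] t_nonneg
      by (intro mult_left_mono) auto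
  qed
  define p1 p q where "p1 = pois_lt (k - 1) L1" and "p = pois_lt k L1" and "q = pois_lt k L2"
  have pq: "0 \<le> p1" "0 \<le> p" "0 \<le> q" using L1 L2 by (auto simp: p1_def p_def q_def pois_lt_nonneg)
  have vD0: "0 \<le> t * vol (D1 c c')" "0 \<le> t * vol (D2 c c')" for c c' using t_nonneg by auto
  have G: "G c c' \<le> (if torus_dist c c' < e * r then p1 else 0) + (if torus_dist c c' < 2 * r then p * q else 0) + p * p"
    if c: "c \<in> ?C" "c' \<in> ?C" for c c'
  proof (cases "torus_dist c c' < e * r")
    case True
    have K: "K c c' = k - 1" using True by (simp add: K_def)
    have "G c c' \<le> p1 * 1" unfolding G_def p1_def K
      by (intro mult_mono pois_lt_antimono pois_lt_le_1 vD1 c L1 pois_lt_nonneg vD0)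
    then show ?thesis using True mult_nonneg_nonneg[OF pq(2,3)] mult_nonneg_nonneg[OF pq(2,2)]
      by (smt (verit))
  next
    case far: False
    show ?thesis
    proof (cases "torus_dist c c' < 2 * r")
      case True
      have "G c c' \<le> p * q" unfolding G_def p_def q_def K_def using far
        by (auto intro!: mult_mono pois_lt_antimono vD1 vD2 c L1 L2 pois_lt_nonneg vD0)
      then show ?thesis using far True mult_nonneg_nonneg[OF pq(2,2)] by (smt (verit))
    next
      case False
      have "G c c' \<le> p * p" unfolding G_def p_def K_def using far False
        by (auto intro!: mult_mono pois_lt_antimono vD1 vD2' c L1 pois_lt_nonneg vD0)
      then show ?thesis using far False by simp
    qed
  qed
  define R where "R = p1 * (\<theta> * (e * r + \<delta>) ^ d) + p * q * (\<theta> * (2 * r + \<delta>) ^ d) + p * p"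
  have inner: "(\<Sum>c'\<in>?C. v' c' * G c c') \<le> R" if c: "c \<in> ?C" for c
  proof -
    have er: "e * r \<le> 1 / 2 * r" using e r by (intro mult_right_mono) auto
    have "(\<Sum>c'\<in>?C. v' c' * G c c') \<le> (\<Sum>c'\<in>?C. v' c' * ((if torus_dist c c' < e * r then p1 else 0) +
        (if torus_dist c c' < 2 * r then p * q else 0) + p * p))"
      by (intro sum_mono mult_left_mono G c v'0)
    also have "\<dots> = p1 * (\<Sum>c'\<in>?C. (if torus_dist c c' < e * r then v' c' else 0)) +
        p * q * (\<Sum>c'\<in>?C. (if torus_dist c c' < 2 * r then v' c' else 0)) + p * p * (\<Sum>c'\<in>?C. v' c')"
      unfolding sum_distrib_left sum.distrib[symmetric] by (intro sum.cong) (auto simp: algebra_simps)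
    also have "\<dots> \<le> p1 * (\<theta> * (e * r + \<delta>) ^ d) + p * q * (\<theta> * (2 * r + \<delta>) ^ d) + p * p * 1"
      unfolding v'_def \<theta>_def d_def
    proof (intro add_mono mult_left_mono mult_nonneg_nonneg pq)
      show "(\<Sum>c'\<in>?C. if torus_dist c c' < e * r then vol (cell \<kappa> c') else 0) \<le> unit_ball_volume TYPE('d) * (e * r + \<delta>) ^ CARD('d)"
      proof (rule sum_vol_cells_near[OF \<kappa> ct[OF c] _ \<delta>(1)])
        show "e * r + \<delta> \<le> 1 / 2" using er \<delta> r by linarith
      qed (use e r in simp)
      show "(\<Sum>c'\<in>?C. if torus_dist c c' < 2 * r then vol (cell \<kappa> c') else 0) \<le> unit_ball_volume TYPE('d) * (2 * r + \<delta>) ^ CARD('d)"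
        using \<delta> r by (intro sum_vol_cells_near[OF \<kappa> ct[OF c]]) auto
      show "(\<Sum>c'\<in>?C. vol (cell \<kappa> c')) \<le> 1" using sumv' by (simp add: v'_def)
    qed
    finally show ?thesis by (simp add: R_def)
  qed
  have G0: "0 \<le> G c c'" for c c' unfolding G_def by (intro mult_nonneg_nonneg pois_lt_nonneg vD0)
  have "(\<integral>\<^sup>+\<omega>. ge2 (emeasure (P \<omega>) (isolated k r (P \<omega>))) \<partial>\<Omega>) \<le>
     (\<integral>\<^sup>+\<omega>. (\<Sum>c\<in>?C. ge2 (emeasure (P \<omega>) (cell \<kappa> c))) + (\<Sum>c\<in>?C. \<Sum>c'\<in>?C - {c}. T c c' \<omega>) \<partial>\<Omega>)"
    unfolding T_def K_def D1_def D2_def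
    by (intro nn_integral_mono isolated_pairs_bound configuration \<kappa> \<delta> e)
  also have "\<dots> = (\<Sum>c\<in>?C. \<integral>\<^sup>+\<omega>. ge2 (emeasure (P \<omega>) (cell \<kappa> c)) \<partial>\<Omega>) + (\<Sum>c\<in>?C. \<Sum>c'\<in>?C - {c}. \<integral>\<^sup>+\<omega>. T c c' \<omega> \<partial>\<Omega>)"
    by (simp add: nn_integral_add nn_integral_sum borel_measurable_sum)
  also have "\<dots> \<le> (\<Sum>c\<in>?C. ennreal (t\<^sup>2 * v * v' c)) + (\<Sum>c\<in>?C. ennreal (t\<^sup>2 * R * v' c))"
  proof (intro add_mono sum_mono)
    fix c assume c: "c \<in> ?C"
    have "(\<integral>\<^sup>+\<omega>. ge2 (emeasure (P \<omega>) (cell \<kappa> c)) \<partial>\<Omega>) \<le> ennreal ((t * v' c)\<^sup>2)"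
      unfolding v'_def by (rule mean_ge2_count[OF cb])
    also have "(t * v' c)\<^sup>2 \<le> t\<^sup>2 * v * v' c"
      using mult_left_mono[OF mult_right_mono[OF v'le[OF c] v'0[of c]], of "t\<^sup>2"]
      by (simp add: power2_eq_square mult_ac)
    then have "ennreal ((t * v' c)\<^sup>2) \<le> ennreal (t\<^sup>2 * v * v' c)" by (rule ennreal_leI)
    finally show "(\<integral>\<^sup>+\<omega>. ge2 (emeasure (P \<omega>) (cell \<kappa> c)) \<partial>\<Omega>) \<le> ennreal (t\<^sup>2 * v * v' c)" .
    have "(\<Sum>c'\<in>?C - {c}. \<integral>\<^sup>+\<omega>. T c c' \<omega> \<partial>\<Omega>) = (\<Sum>c'\<in>?C - {c}. ennreal (t\<^sup>2 * (v' c * (v' c' * G c c'))))"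
      by (intro sum.cong refl ET) auto
    also have "\<dots> = ennreal (\<Sum>c'\<in>?C - {c}. t\<^sup>2 * (v' c * (v' c' * G c c')))"
      using v'0 G0 by (intro sum_ennreal) auto
    also have "\<dots> \<le> ennreal (t\<^sup>2 * R * v' c)"
    proof (rule ennreal_leI)
      have "(\<Sum>c'\<in>?C - {c}. t\<^sup>2 * (v' c * (v' c' * G c c'))) \<le> (\<Sum>c'\<in>?C. t\<^sup>2 * (v' c * (v' c' * G c c')))"
        using v'0 G0 fin by (intro sum_mono2) auto
      also have "\<dots> = t\<^sup>2 * v' c * (\<Sum>c'\<in>?C. v' c' * G c c')" by (simp add: sum_distrib_left mult.assoc)
      also have "\<dots> \<le> t\<^sup>2 * v' c * R" using inner[OF c] v'0[of c] by (intro mult_left_mono) auto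
      finally show "(\<Sum>c'\<in>?C - {c}. t\<^sup>2 * (v' c * (v' c' * G c c'))) \<le> t\<^sup>2 * R * v' c" by (simp add: mult_ac)
    qed
    finally show "(\<Sum>c'\<in>?C - {c}. \<integral>\<^sup>+\<omega>. T c c' \<omega> \<partial>\<Omega>) \<le> ennreal (t\<^sup>2 * R * v' c)" .
  qed
  also have "\<dots> = ennreal (t\<^sup>2 * v + t\<^sup>2 * R)"
  proof -
    have R0: "0 \<le> R" unfolding R_def using pq \<theta> e r \<delta> by auto
    have "(\<Sum>c\<in>?C. ennreal (w * v' c)) = ennreal w" if "0 \<le> w" for w
    proof -
      have "(\<Sum>c\<in>?C. ennreal (w * v' c)) = ennreal (\<Sum>c\<in>?C. w * v' c)"
        using that v'0 by (intro sum_ennreal) auto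
      also have "(\<Sum>c\<in>?C. w * v' c) = w" using sumv' by (simp add: sum_distrib_left[symmetric])
      finally show ?thesis .
    qed
    from this[of "t\<^sup>2 * v"] this[of "t\<^sup>2 * R"] show ?thesis using v R0 by (simp add: ennreal_plus)
  qed
  finally show ?thesis by (simp only: R_def p1_def p_def q_def)
qed

text \<open>The limit of the previous bound as the mesh tends to \<open>0\<close>.\<close>

lemma mean_isolated_pairs:
  fixes r e :: real
  defines "\<theta> \<equiv> unit_ball_volume TYPE('d)" and "d \<equiv> CARD('d)"
  defines "\<alpha> \<equiv> t * \<theta> * r ^ d"
  assumes r: "0 < r" "r \<le> 1 / 8" and e: "0 < e" "e \<le> 1 / 2"
  shows "(\<integral>\<^sup>+\<omega>. ge2 (emeasure (P \<omega>) (isolated k r (P \<omega>))) \<partial>\<Omega>) \<le>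
    ennreal (t * (e ^ d * \<alpha> * pois_lt (k - 1) \<alpha> + 2 ^ d * \<alpha> * pois_lt k \<alpha> * pois_lt k (\<alpha> * e / 4))
      + (t * pois_lt k \<alpha>)\<^sup>2)"
proof -
  have \<theta>: "0 < \<theta>" unfolding \<theta>_def by (rule unit_ball_volume_pos)
  have d: "0 < d" unfolding d_def by simp
  obtain \<kappa> :: "nat \<Rightarrow> real ^ 'd \<Rightarrow> real ^ 'd" where \<kappa>: "\<forall>m. fine_partition (1 / real (Suc m)) (\<kappa> m)"
    by (rule partition_sequence)
  define \<delta> where "\<delta> m = 1 / real (Suc m)" for m
  have \<delta>0: "\<delta> \<longlonglongrightarrow> 0" unfolding \<delta>_def by (rule mesh_tendsto)
  define L1 where "L1 s = t * (\<theta> * (r - s) ^ d - 2 * (\<theta> * s ^ d))" for s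
  define L2 where "L2 s = t * (\<theta> * (r - s) ^ d * e / 4 - 2 * (\<theta> * s ^ d))" for s
  define b where "b s = t\<^sup>2 * (\<theta> * s ^ d) + t\<^sup>2 * (pois_lt (k - 1) (L1 s) * (\<theta> * (e * r + s) ^ d) +
       pois_lt k (L1 s) * pois_lt k (L2 s) * (\<theta> * (2 * r + s) ^ d) + pois_lt k (L1 s) * pois_lt k (L1 s))" for s
  let ?I = "\<integral>\<^sup>+\<omega>. ge2 (emeasure (P \<omega>) (isolated k r (P \<omega>))) \<partial>\<Omega>"
  have lim_b: "(\<lambda>m. b (\<delta> m)) \<longlonglongrightarrow> b 0"
    unfolding b_def L1_def L2_def by (intro tendsto_intros \<delta>0) simp_all
  have "(\<lambda>m. \<theta> * (r - \<delta> m) ^ d * e / 4 - 2 * (\<theta> * \<delta> m ^ d)) \<longlonglongrightarrow> \<theta> * (r - 0) ^ d * e / 4 - 2 * (\<theta> * 0 ^ d)"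
    by (intro tendsto_intros \<delta>0) auto
  moreover have "0 < \<theta> * (r - 0) ^ d * e / 4 - 2 * (\<theta> * 0 ^ d)" using \<theta> r e d by (simp add: power_0_left)
  ultimately have "eventually (\<lambda>m. 0 < \<theta> * (r - \<delta> m) ^ d * e / 4 - 2 * (\<theta> * \<delta> m ^ d)) sequentially"
    by (rule order_tendstoD(1))
  moreover have "eventually (\<lambda>m. \<delta> m \<le> r / 4) sequentially"
    unfolding \<delta>_def using r by (intro eventually_mesh_le) simp
  ultimately have "eventually (\<lambda>m. ?I \<le> ennreal (b (\<delta> m))) sequentially"
  proof eventually_elim
    case (elim m)
    have "0 \<le> L2 (\<delta> m)" unfolding L2_def using elim(1) t_nonneg by (intro mult_nonneg_nonneg) auto
    moreover have "0 < \<delta> m" by (simp add: \<delta>_def)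
    moreover have "fine_partition (\<delta> m) (\<kappa> m)" using \<kappa> by (simp add: \<delta>_def)
    ultimately show ?case
      unfolding b_def L1_def L2_def \<theta>_def d_def
      by (intro mean_isolated_pairs_mesh[of "\<delta> m" "\<kappa> m"] elim(2) r e)
  qed
  then have "?I \<le> ennreal (b 0)"
    by (intro tendsto_lowerbound[OF tendsto_ennrealI[OF lim_b]]) auto
  also have "b 0 = t * (e ^ d * \<alpha> * pois_lt (k - 1) \<alpha> + 2 ^ d * \<alpha> * pois_lt k \<alpha> * pois_lt k (\<alpha> * e / 4))
      + (t * pois_lt k \<alpha>)\<^sup>2"
  proof -
    have L: "L1 0 = \<alpha>" "L2 0 = \<alpha> * e / 4" using d by (simp_all add: L1_def L2_def \<alpha>_def power_0_left)
    have alg: "t\<^sup>2 * (X * (\<theta> * (e * r) ^ d) + Y * Z * (\<theta> * (2 * r) ^ d) + Y * Y) =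
      t * (e ^ d * \<alpha> * X + 2 ^ d * \<alpha> * Y * Z) + (t * Y)\<^sup>2" for X Y Z
      unfolding \<alpha>_def by (simp add: power_mult_distrib power2_eq_square algebra_simps)
    show ?thesis unfolding alg[symmetric] b_def L using d by (simp add: power_0_left)
  qed
  finally show ?thesis .
qed

end

section \<open>Asymptotics of Poisson probabilities\<close>

lemma power_exp_tendsto_0:
  fixes c :: real assumes "0 < c"
  shows "((\<lambda>x. x ^ j * exp (- (c * x))) \<longlongrightarrow> 0) at_top"
proof -
  have "filterlim (\<lambda>x. c * x) at_top at_top"
    using assms by (intro filterlim_tendsto_pos_mult_at_top[OF tendsto_const _ filterlim_ident])
  from filterlim_compose[OF tendsto_power_div_exp_0 this, of j]
  have "((\<lambda>x. inverse c ^ j * ((c * x) ^ j / exp (c * x))) \<longlongrightarrow> inverse c ^ j * 0) at_top"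
    by (intro tendsto_intros)
  moreover have "inverse c ^ j * ((c * x) ^ j / exp (c * x)) = x ^ j * exp (- (c * x))" for x
    using assms by (simp add: power_mult_distrib exp_minus field_simps)
  ultimately show ?thesis by simp
qed

lemma pois_lt_exp_tendsto_0:
  assumes "0 < c" "e < c"
  shows "((\<lambda>x. x * exp (e * x) * pois_lt k (c * x)) \<longlongrightarrow> 0) at_top"
proof -
  have "((\<lambda>x. \<Sum>j<k. c ^ j / fact j * (x ^ Suc j * exp (- ((c - e) * x)))) \<longlongrightarrow> (\<Sum>j<k. c ^ j / fact j * 0)) at_top"
    using assms by (intro tendsto_intros power_exp_tendsto_0) auto
  moreover have "(\<Sum>j<k. c ^ j / fact j * (x ^ Suc j * exp (- ((c - e) * x)))) = x * exp (e * x) * pois_lt k (c * x)" for x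
    unfolding pois_lt_def sum_distrib_left
  proof (intro sum.cong refl)
    fix j
    have "exp (- ((c - e) * x)) = exp (e * x) * exp (- (c * x))" by (simp add: exp_add[symmetric] algebra_simps)
    then show "c ^ j / fact j * (x ^ Suc j * exp (- ((c - e) * x))) = x * exp (e * x) * (exp (- (c * x)) * (c * x) ^ j / fact j)"
      by (simp add: power_mult_distrib)
  qed
  ultimately show ?thesis by simp
qed

text \<open>Of a Poisson probability of less than \<open>Suc m\<close> points only the summand of order \<open>m\<close> survives
division by \<open>x ^ m\<close>.\<close>

lemma shift_power_ratio:
  fixes u :: real
  assumes "j \<le> m"
  shows "((\<lambda>x. (x + u) ^ j / x ^ m) \<longlongrightarrow> (if j = m then 1 else 0)) at_top"
proof -
  have inv: "((\<lambda>x :: real. inverse x) \<longlongrightarrow> 0) at_top" by (rule tendsto_inverse_0_at_top[OF filterlim_ident])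
  have "((\<lambda>x. (1 + u * inverse x) ^ j * inverse x ^ (m - j)) \<longlongrightarrow> (1 + u * 0) ^ j * 0 ^ (m - j)) at_top"
    by (intro tendsto_intros inv)
  moreover have "eventually (\<lambda>x. (1 + u * inverse x) ^ j * inverse x ^ (m - j) = (x + u) ^ j / x ^ m) at_top"
    using eventually_gt_at_top[of 0]
  proof eventually_elim
    case (elim x)
    have "x ^ m = x ^ j * x ^ (m - j)" using assms by (simp add: power_add[symmetric])
    moreover have "(1 + u * inverse x) * x = x + u" using elim by (simp add: field_simps)
    then have "(x + u) ^ j = (1 + u * inverse x) ^ j * x ^ j" by (metis power_mult_distrib)
    ultimately have "(x + u) ^ j / x ^ m = (1 + u * inverse x) ^ j * x ^ j / (x ^ j * x ^ (m - j))" by metis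
    also have "\<dots> = (1 + u * inverse x) ^ j / x ^ (m - j)" using elim by simp
    also have "\<dots> = (1 + u * inverse x) ^ j * inverse x ^ (m - j)"
      by (metis divide_inverse power_inverse)
    finally show ?case by (rule sym)
  qed
  ultimately have "((\<lambda>x. (x + u) ^ j / x ^ m) \<longlongrightarrow> (1 + u * 0) ^ j * 0 ^ (m - j)) at_top"
    by (rule Lim_transform_eventually)
  moreover have "(1 + u * 0) ^ j * 0 ^ (m - j) = (if j = m then 1 else 0 :: real)" using assms by (simp add: power_0_left)
  ultimately show ?thesis by simp
qed

lemma pois_lt_ratio:
  "((\<lambda>x. exp x * pois_lt (Suc m) (x + u) / x ^ m) \<longlongrightarrow> exp (- u) / fact m) at_top"
proof -
  have "((\<lambda>x. \<Sum>j<Suc m. exp (- u) / fact j * ((x + u) ^ j / x ^ m)) \<longlongrightarrow>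
      (\<Sum>j<Suc m. exp (- u) / fact j * (if j = m then 1 else 0))) at_top"
    by (intro tendsto_sum tendsto_mult tendsto_const shift_power_ratio) auto
  moreover have "(\<Sum>j<Suc m. exp (- u) / fact j * (if j = m then 1 else 0)) = exp (- u) / (fact m :: real)"
    by (subst sum.lessThan_Suc) (auto intro: sum.neutral)
  moreover have "(\<Sum>j<Suc m. exp (- u) / fact j * ((x + u) ^ j / x ^ m)) = exp x * pois_lt (Suc m) (x + u) / x ^ m" for x
    unfolding pois_lt_def sum_distrib_left sum_divide_distrib
  proof (intro sum.cong refl)
    fix j
    have "exp (- u) = exp x * exp (- (x + u))" by (simp add: exp_add[symmetric])
    then show "exp (- u) / fact j * ((x + u) ^ j / x ^ m) = exp x * (exp (- (x + u)) * (x + u) ^ j / fact j) / x ^ m" by simp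
  qed
  ultimately show ?thesis by simp
qed

text \<open>One point less costs a factor \<open>x\<close>; multiplication by the mean compensates exactly for it. This
governs the pairs of close points.\<close>

lemma pois_lt_ratio_lower:
  "\<exists>C. ((\<lambda>x. exp x * ((x + u) * pois_lt m (x + u)) / x ^ m) \<longlongrightarrow> C) at_top"
proof (cases m)
  case 0 then show ?thesis by (auto intro!: exI[of _ 0])
next
  case (Suc l)
  have "((\<lambda>x. (x + u) ^ 1 / x ^ 1) \<longlongrightarrow> (if 1 = (1 :: nat) then 1 else 0)) at_top" by (rule shift_power_ratio) simp
  from tendsto_mult[OF this pois_lt_ratio[of l u]]
  have "((\<lambda>x. exp x * ((x + u) * pois_lt m (x + u)) / x ^ m) \<longlongrightarrow> 1 * (exp (- u) / fact l)) at_top"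
    unfolding Suc by (simp add: mult_ac)
  then show ?thesis by blast
qed

lemma real_tendsto_sandwich_0:
  fixes f g :: "nat \<Rightarrow> real"
  assumes "eventually (\<lambda>n. f n \<le> g n) sequentially" "eventually (\<lambda>n. 0 \<le> f n) sequentially" "g \<longlonglongrightarrow> 0"
  shows "f \<longlonglongrightarrow> 0"
  by (rule tendsto_sandwich[OF assms(2) assms(1) tendsto_const assms(3)])

locale threshold_sequence =
  fixes k :: nat and a b :: "nat \<Rightarrow> real"
  assumes k: "1 \<le> k"
    and a_lower: "filterlim (\<lambda>n. a n - ln (real n) - (real k - 1) * ln (ln (real n))) at_top sequentially"
    and a_small: "a \<in> o(\<lambda>n. real n)"
    and b_eq: "\<And>n. n \<ge> 1 \<Longrightarrow> b n = real n * a n ^ (k - 1) * exp (- a n)"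
begin

lemma ln_at_top: "filterlim (\<lambda>n. ln (real n)) at_top sequentially"
  by (rule filterlim_compose[OF ln_at_top filterlim_real_sequentially])

lemma a_at_top: "filterlim a at_top sequentially"
proof (rule filterlim_at_top_mono)
  show "filterlim (\<lambda>n. (a n - ln (real n) - (real k - 1) * ln (ln (real n))) + ln (real n)) at_top sequentially"
    by (rule filterlim_at_top_add_at_top[OF a_lower ln_at_top])
  have "eventually (\<lambda>n. 1 \<le> ln (real n)) sequentially" using ln_at_top by (simp add: filterlim_at_top)
  then show "eventually (\<lambda>n. (a n - ln (real n) - (real k - 1) * ln (ln (real n))) + ln (real n) \<le> a n) sequentially"
  proof eventually_elim
    case (elim n)
    then have "0 \<le> (real k - 1) * ln (ln (real n))" using k by (intro mult_nonneg_nonneg ln_ge_zero) auto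
    then show ?case by simp
  qed
qed

lemma eventually_b_pos: "eventually (\<lambda>n. 0 < b n) sequentially"
  using filterlim_at_top_dense[THEN iffD1, OF a_at_top, rule_format, of 0] eventually_ge_at_top[of 1]
  by eventually_elim (simp add: b_eq)

text \<open>Writing \<open>x n\<close> for the sequence that is assumed to tend to infinity, \<open>b n\<close> is
\<open>(a n / ln n) ^ (k - 1) * exp (- x n)\<close>. This settles the matter as long as \<open>a n\<close> is at most a
multiple of \<open>ln n\<close>; otherwise \<open>n\<close> is dominated by \<open>exp (a n / 2)\<close>.\<close>

lemma b_tendsto_0: "b \<longlonglongrightarrow> 0"
proof -
  define x where "x n = a n - ln (real n) - (real k - 1) * ln (ln (real n))" for n
  have x: "filterlim x at_top sequentially" unfolding x_def by (rule a_lower)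
  have 1: "(\<lambda>n. (real k + 2) ^ (k - 1) * exp (- x n)) \<longlonglongrightarrow> (real k + 2) ^ (k - 1) * 0"
    by (intro tendsto_intros filterlim_compose[OF exp_at_bot] filterlim_compose[OF filterlim_uminus_at_bot_at_top x])
  have 2: "(\<lambda>n. a n ^ (k - 1) * exp (- (1 / 2 * a n))) \<longlonglongrightarrow> 0"
    by (rule filterlim_compose[OF power_exp_tendsto_0 a_at_top]) simp
  have "eventually (\<lambda>n. 1 \<le> ln (real n)) sequentially" using ln_at_top by (simp add: filterlim_at_top)
  then have "eventually (\<lambda>n. b n \<le> (real k + 2) ^ (k - 1) * exp (- x n) + a n ^ (k - 1) * exp (- (1 / 2 * a n))) sequentially"
    using filterlim_at_top_dense[THEN iffD1, OF a_at_top, rule_format, of 0] eventually_ge_at_top[of 1]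
  proof eventually_elim
    case (elim n)
    have b: "b n = real n * a n ^ (k - 1) * exp (- a n)" using elim by (simp add: b_eq)
    have n: "0 < real n" using elim by simp
    show ?case
    proof (cases "a n \<le> (real k + 2) * ln (real n)")
      case True
      have "real n * (ln (real n)) ^ (k - 1) * exp (- a n) = exp (ln (real n)) * exp ((real k - 1) * ln (ln (real n))) * exp (- a n)"
      proof -
        have "exp ((real k - 1) * ln (ln (real n))) = ln (real n) ^ (k - 1)"
        proof -
          have "real k - 1 = real (k - 1)" using k by simp
          then show ?thesis using elim(1) by (simp only: exp_of_nat_mult) simp
        qed
        then show ?thesis using n by simp
      qed
      also have "\<dots> = exp (- x n)" by (simp add: x_def exp_add[symmetric])
      finally have eq: "real n * (ln (real n)) ^ (k - 1) * exp (- a n) = exp (- x n)" .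
      have "a n ^ (k - 1) \<le> ((real k + 2) * ln (real n)) ^ (k - 1)" using True elim by (intro power_mono) auto
      then have "b n \<le> real n * ((real k + 2) * ln (real n)) ^ (k - 1) * exp (- a n)"
        unfolding b using n by (intro mult_right_mono mult_left_mono) auto
      also have "\<dots> = (real k + 2) ^ (k - 1) * exp (- x n)" unfolding eq[symmetric] by (simp add: power_mult_distrib mult_ac)
      finally show ?thesis using elim by (simp add: add_increasing2)
    next
      case False
      have "2 * ln (real n) \<le> (real k + 2) * ln (real n)" using elim by (intro mult_right_mono) auto
      then have "ln (real n) \<le> 1 / 2 * a n" using False by simp
      then have "real n \<le> exp (1 / 2 * a n)" using n by (metis exp_le_cancel_iff exp_ln)
      then have "b n \<le> exp (1 / 2 * a n) * a n ^ (k - 1) * exp (- a n)"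
        unfolding b using elim by (intro mult_right_mono) auto
      also have "\<dots> = a n ^ (k - 1) * exp (- (1 / 2 * a n))" by (simp add: exp_add[symmetric] mult_ac)
      finally show ?thesis by (simp add: add_increasing)
    qed
  qed
  moreover have "eventually (\<lambda>n. 0 \<le> b n) sequentially" using eventually_b_pos by (rule eventually_mono) simp
  moreover have "(\<lambda>n. (real k + 2) ^ (k - 1) * exp (- x n) + a n ^ (k - 1) * exp (- (1 / 2 * a n))) \<longlonglongrightarrow> 0"
    using tendsto_add[OF 1 2] by simp
  ultimately show ?thesis by (rule real_tendsto_sandwich_0)
qed

lemma tendsto_compose_a: "(f \<longlongrightarrow> l) at_top \<Longrightarrow> (\<lambda>n. f (a n)) \<longlonglongrightarrow> l"
  by (rule filterlim_compose[OF _ a_at_top])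

lemma ratio_b:
  assumes "1 \<le> n" shows "exp (a n) * X / a n ^ (k - 1) = real n * X / b n"
  using assms by (simp add: b_eq exp_minus field_simps)

lemma intensity_ratio: "(\<lambda>n. real n * pois_lt k (a n + u) / b n) \<longlonglongrightarrow> exp (- u) / fact (k - 1)"
proof -
  have k': "k = Suc (k - 1)" using k by simp
  have "(\<lambda>n. exp (a n) * pois_lt k (a n + u) / a n ^ (k - 1)) \<longlonglongrightarrow> exp (- u) / fact (k - 1)"
    using tendsto_compose_a[OF pois_lt_ratio[of "k - 1" u]] k' by simp
  moreover have "eventually (\<lambda>n. exp (a n) * pois_lt k (a n + u) / a n ^ (k - 1) = real n * pois_lt k (a n + u) / b n) sequentially"
    using eventually_ge_at_top[of 1] by eventually_elim (rule ratio_b)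
  ultimately show ?thesis by (rule Lim_transform_eventually)
qed

lemma close_pairs_ratio:
  "\<exists>C. (\<lambda>n. real n * ((a n + u) * pois_lt (k - 1) (a n + u)) / b n) \<longlonglongrightarrow> C"
proof -
  obtain C where "((\<lambda>x. exp x * ((x + u) * pois_lt (k - 1) (x + u)) / x ^ (k - 1)) \<longlongrightarrow> C) at_top"
    using pois_lt_ratio_lower[of u "k - 1"] by blast
  then have "(\<lambda>n. exp (a n) * ((a n + u) * pois_lt (k - 1) (a n + u)) / a n ^ (k - 1)) \<longlonglongrightarrow> C"
    by (rule tendsto_compose_a)
  moreover have "eventually (\<lambda>n. exp (a n) * ((a n + u) * pois_lt (k - 1) (a n + u)) / a n ^ (k - 1) =
      real n * ((a n + u) * pois_lt (k - 1) (a n + u)) / b n) sequentially"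
    using eventually_ge_at_top[of 1] by eventually_elim (rule ratio_b)
  ultimately have "(\<lambda>n. real n * ((a n + u) * pois_lt (k - 1) (a n + u)) / b n) \<longlonglongrightarrow> C"
    by (rule Lim_transform_eventually)
  then show ?thesis by blast
qed

text \<open>Configurations of at most \<open>k\<close> points are sent to the null measure, which cancels their isolated
points. As \<open>a\<close> is of smaller order than \<open>n\<close>, their probability is negligible against \<open>b n\<close>.\<close>

lemma few_points_ratio: "(\<lambda>n. pois_lt (Suc k) (real n) / b n) \<longlonglongrightarrow> 0"
proof (rule real_tendsto_sandwich_0)
  have "eventually (\<lambda>n. norm (a n) \<le> 1 / 2 * norm (real n)) sequentially"
    by (rule landau_o.smallD[OF a_small]) simp
  moreover have "eventually (\<lambda>n. 1 \<le> a n) sequentially" using a_at_top by (simp add: filterlim_at_top)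
  ultimately show "eventually (\<lambda>n. pois_lt (Suc k) (real n) / b n \<le> real n * exp (1 / 2 * real n) * pois_lt (Suc k) (1 * real n)) sequentially"
    using eventually_ge_at_top[of 1]
  proof eventually_elim
    case (elim n)
    have b: "b n = real n * a n ^ (k - 1) * exp (- a n)" using elim by (simp add: b_eq)
    have n: "1 \<le> real n" using elim by simp
    have "exp (- (1 / 2 * real n)) \<le> exp (- a n)" using elim by simp
    moreover have "1 \<le> real n * a n ^ (k - 1)" using n elim mult_mono[of 1 "real n" 1 "a n ^ (k - 1)"] by simp
    ultimately have "1 * exp (- (1 / 2 * real n)) \<le> b n" unfolding b by (intro mult_mono) auto
    then have "pois_lt (Suc k) (real n) / b n \<le> pois_lt (Suc k) (real n) / exp (- (1 / 2 * real n))"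
      using pois_lt_nonneg[of "real n" "Suc k"]
      by (intro divide_left_mono mult_pos_pos) (auto intro: less_le_trans[OF exp_gt_zero])
    also have "\<dots> = 1 * exp (1 / 2 * real n) * pois_lt (Suc k) (real n)" by (simp add: exp_minus field_simps)
    also have "\<dots> \<le> real n * exp (1 / 2 * real n) * pois_lt (Suc k) (real n)"
      using n pois_lt_nonneg[of "real n" "Suc k"] by (intro mult_right_mono) auto
    finally show ?case by simp
  qed
  show "(\<lambda>n. real n * exp (1 / 2 * real n) * pois_lt (Suc k) (1 * real n)) \<longlonglongrightarrow> 0"
    by (rule filterlim_compose[OF pois_lt_exp_tendsto_0 filterlim_real_sequentially]) auto
  show "eventually (\<lambda>n. 0 \<le> pois_lt (Suc k) (real n) / b n) sequentially"
    using eventually_b_pos by eventually_elim (simp add: pois_lt_nonneg)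
qed

lemma pairs_ratio:
  fixes e u :: real and d :: nat
  assumes e: "0 < e"
  obtains C where "(\<lambda>n. (real n * (e ^ d * (a n + u) * pois_lt (k - 1) (a n + u) +
      2 ^ d * (a n + u) * pois_lt k (a n + u) * pois_lt k ((a n + u) * e / 4)) + (real n * pois_lt k (a n + u))\<^sup>2) / b n)
    \<longlonglongrightarrow> e ^ d * C" "(\<lambda>n. real n * ((a n + u) * pois_lt (k - 1) (a n + u)) / b n) \<longlonglongrightarrow> C"
proof -
  obtain C where C: "(\<lambda>n. real n * ((a n + u) * pois_lt (k - 1) (a n + u)) / b n) \<longlonglongrightarrow> C"
    using close_pairs_ratio by blast
  have au: "filterlim (\<lambda>n. a n + u) at_top sequentially"
    using filterlim_tendsto_add_at_top[OF tendsto_const a_at_top, of u] by (simp add: add.commute)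
  have "((\<lambda>x. x * exp (0 * x) * pois_lt k (e / 4 * x)) \<longlongrightarrow> 0) at_top"
    using e by (intro pois_lt_exp_tendsto_0) auto
  then have q: "(\<lambda>n. (a n + u) * exp (0 * (a n + u)) * pois_lt k (e / 4 * (a n + u))) \<longlonglongrightarrow> 0"
    by (rule filterlim_compose[OF _ au])
  define c where "c = exp (- u) / fact (k - 1)"
  have i: "(\<lambda>n. real n * pois_lt k (a n + u) / b n) \<longlonglongrightarrow> c" unfolding c_def by (rule intensity_ratio)
  have "(\<lambda>n. e ^ d * (real n * ((a n + u) * pois_lt (k - 1) (a n + u)) / b n) +
      2 ^ d * ((real n * pois_lt k (a n + u) / b n) * ((a n + u) * exp (0 * (a n + u)) * pois_lt k (e / 4 * (a n + u)))) +
      b n * (real n * pois_lt k (a n + u) / b n)\<^sup>2) \<longlonglongrightarrow> e ^ d * C + 2 ^ d * (c * 0) + 0 * c\<^sup>2"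
    by (intro tendsto_intros C i q b_tendsto_0)
  moreover have "eventually (\<lambda>n. e ^ d * (real n * ((a n + u) * pois_lt (k - 1) (a n + u)) / b n) +
      2 ^ d * ((real n * pois_lt k (a n + u) / b n) * ((a n + u) * exp (0 * (a n + u)) * pois_lt k (e / 4 * (a n + u)))) +
      b n * (real n * pois_lt k (a n + u) / b n)\<^sup>2 =
      (real n * (e ^ d * (a n + u) * pois_lt (k - 1) (a n + u) +
      2 ^ d * (a n + u) * pois_lt k (a n + u) * pois_lt k ((a n + u) * e / 4)) + (real n * pois_lt k (a n + u))\<^sup>2) / b n) sequentially"
    using eventually_b_pos
  proof eventually_elim
    case (elim n)
    have "b n * (real n * pois_lt k (a n + u) / b n)\<^sup>2 = (real n * pois_lt k (a n + u))\<^sup>2 / b n"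
      using elim by (simp add: power2_eq_square)
    moreover have "e / 4 * (a n + u) = (a n + u) * e / 4" by simp
    moreover have "E * (N * (y * p1) / B) + D * ((N * p / B) * (y * exp (0 * y) * q)) + (N * p)\<^sup>2 / B =
        (N * (E * y * p1 + D * y * p * q) + (N * p)\<^sup>2) / B" for E D N y p1 p q B :: real
      by (simp add: add_divide_distrib distrib_left mult_ac)
    ultimately show ?case by (simp only:)
  qed
  ultimately have "(\<lambda>n. (real n * (e ^ d * (a n + u) * pois_lt (k - 1) (a n + u) +
      2 ^ d * (a n + u) * pois_lt k (a n + u) * pois_lt k ((a n + u) * e / 4)) + (real n * pois_lt k (a n + u))\<^sup>2) / b n)
    \<longlonglongrightarrow> e ^ d * C + 2 ^ d * (c * 0) + 0 * c\<^sup>2" by (rule Lim_transform_eventually)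
  then show thesis using that C by simp
qed

text \<open>The radius of a ball with expected number of points \<open>a n + u\<close>.\<close>

definition radius :: "'d::finite itself \<Rightarrow> real \<Rightarrow> nat \<Rightarrow> real" where
  "radius T u n = root CARD('d) ((a n + u) / (real n * unit_ball_volume TYPE('d)))"

lemma radius_properties:
  fixes T :: "'d::finite itself"
  shows "eventually (\<lambda>n. 1 \<le> n \<and> 0 < radius T u n \<and> radius T u n \<le> 1 / 8 \<and>
     real n * unit_ball_volume TYPE('d) * radius T u n ^ CARD('d) = a n + u) sequentially"
proof -
  let ?\<theta> = "unit_ball_volume TYPE('d)"
  have \<theta>: "0 < ?\<theta>" by (rule unit_ball_volume_pos)
  have "(\<lambda>n. a n / real n) \<longlonglongrightarrow> 0" using a_small by (rule smalloD_tendsto)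
  then have "(\<lambda>n. (a n / real n + u / real n) / ?\<theta>) \<longlonglongrightarrow> (0 + 0) / ?\<theta>"
    using \<theta> by (intro tendsto_intros lim_const_over_n) auto
  then have "(\<lambda>n. (a n + u) / (real n * ?\<theta>)) \<longlonglongrightarrow> 0"
    by (simp add: add_divide_distrib)
  then have "(\<lambda>n. radius T u n) \<longlonglongrightarrow> root CARD('d) 0" unfolding radius_def by (intro tendsto_real_root)
  then have "(\<lambda>n. radius T u n) \<longlonglongrightarrow> 0" by simp
  then have "eventually (\<lambda>n. radius T u n < 1 / 8) sequentially" by (rule order_tendstoD) simp
  then show ?thesis
    using filterlim_at_top_dense[THEN iffD1, OF a_at_top, rule_format, of "- u"] eventually_ge_at_top[of 1]
  proof eventually_elim
    case (elim n)
    have "0 < (a n + u) / (real n * ?\<theta>)" using elim \<theta> by simp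
    then have "0 < radius T u n" "radius T u n ^ CARD('d) = (a n + u) / (real n * ?\<theta>)"
      unfolding radius_def by (simp_all add: real_root_gt_zero real_root_pow_pos)
    then show ?case using elim \<theta> by simp
  qed
qed

end

section \<open>Approximation by step functions\<close>

text \<open>Parametrizes the marks in \<open>[s, \<infinity>]\<close> by the compact interval \<open>[0, 1]\<close>, with \<open>\<infinity>\<close> at \<open>0\<close>.\<close>

definition level :: "real \<Rightarrow> real \<Rightarrow> ereal" where
  "level s w = (if w \<le> 0 then \<infinity> else ereal (s - 1 + inverse w))"

lemma continuous_on_level: "continuous_on {0..1} (level s)"
  unfolding continuous_on_def
proof
  fix w :: real assume w: "w \<in> {0..1}"
  show "(level s \<longlongrightarrow> level s w) (at w within {0..1})"
  proof (cases "0 < w")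
    case True
    have "((\<lambda>v. ereal (s - 1 + inverse v)) \<longlongrightarrow> ereal (s - 1 + inverse w)) (at w within {0..1})"
      using True by (intro tendsto_intros) auto
    moreover have "eventually (\<lambda>v. ereal (s - 1 + inverse v) = level s v) (at w within {0..1})"
      using order_tendstoD(1)[OF tendsto_ident_at True, of "{0..1}"] by eventually_elim (simp add: level_def)
    ultimately have "(level s \<longlongrightarrow> ereal (s - 1 + inverse w)) (at w within {0..1})"
      by (rule Lim_transform_eventually)
    then show ?thesis using True by (simp add: level_def)
  next
    case False
    then have w0: "w = 0" using w by simp
    have "eventually (\<lambda>v. ereal r < level s v) (at w within {0..1})" for r
      unfolding eventually_at w0
    proof (intro exI[of _ "inverse (\<bar>r - s + 1\<bar> + 1)"] conjI ballI impI)
      fix v :: real assume v: "v \<in> {0..1}" "v \<noteq> 0 \<and> dist v 0 < inverse (\<bar>r - s + 1\<bar> + 1)"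
      then have "0 < v" "v < inverse (\<bar>r - s + 1\<bar> + 1)" by auto
      then have "\<bar>r - s + 1\<bar> + 1 < inverse v"
        using less_imp_inverse_less[of v "inverse (\<bar>r - s + 1\<bar> + 1)"] by simp
      then show "ereal r < level s v" using \<open>0 < v\<close> by (simp add: level_def)
    qed simp
    then show ?thesis unfolding level_def[of s w] using w0 by (simp add: tendsto_PInfty)
  qed
qed

lemma telescope_steps:
  fixes g :: "nat \<Rightarrow> real"
  shows "(\<Sum>i\<le>m. g i - (if i = 0 then 0 else g (i - 1))) = g m"
  by (induction m) auto

text \<open>Lifted to a cube around the fundamental domain, and with marks parametrized by \<open>[0, 1]\<close>, the function
\<open>f\<close> is continuous on a compact metric space, hence uniformly continuous there. The lift makes points
that are close on the torus close in Euclidean distance. The step function is written with sets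
\<open>{u..}\<close> instead of intervals, since the masses of such rectangles are what the isolated points
compute.\<close>

lemma step_approximation:
  fixes f :: "(real ^ 'd) \<times> ereal \<Rightarrow> real"
  assumes f: "continuous_map E_topology euclideanreal f"
    and f0: "\<forall>y\<in>topspace E_topology - strip s. f y = 0" and \<eta>: "0 < \<eta>"
  shows "\<exists>J c A u. finite (J :: ((real ^ 'd) \<times> nat) set) \<and>
      (\<forall>j\<in>J. A j \<in> sets (borel_of torus_topology) \<and> s \<le> u j) \<and>
      (\<forall>y\<in>topspace E_topology. \<bar>f y - (\<Sum>j\<in>J. c j * indicator (A j \<times> {ereal (u j)..}) y)\<bar> \<le> \<eta> * indicator (strip s) y)"
proof -
  define F where "F = (\<lambda>(v :: real ^ 'd, w). f (frac_vec v, level s w))"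
  have "continuous_map (top_of_set {0..1}) (top_of_set {-\<infinity><..}) (level s)"
    using continuous_on_level[of s] by (auto simp: continuous_map_in_subtopology level_def)
  then have "continuous_map (prod_topology euclidean (top_of_set {0..1})) E_topology (\<lambda>(v, w). (frac_vec v, level s w))"
    unfolding E_topology_def case_prod_unfold
    by (intro continuous_map_pairedI
        continuous_map_compose[OF continuous_map_fst continuous_map_frac_vec, unfolded comp_def]
        continuous_map_compose[OF continuous_map_snd, unfolded comp_def])
  from continuous_map_compose[OF this f]
  have "continuous_map (prod_topology euclidean (top_of_set {0..1})) euclideanreal F"
    by (simp add: F_def comp_def case_prod_unfold)
  then have "continuous_on (UNIV \<times> {0..1}) F"
    by (simp add: prod_topology_subtopology euclidean_product_topology)
  then have "continuous_on (cbox (- 1) 2 \<times> {0..1}) F" by (rule continuous_on_subset) auto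
  then have "uniformly_continuous_on (cbox (- 1) 2 \<times> {0..1}) F"
    by (intro compact_uniformly_continuous compact_Times) auto
  then obtain \<delta> where \<delta>: "0 < \<delta>" "\<And>p q. p \<in> cbox (- 1) 2 \<times> {0..1} \<Longrightarrow> q \<in> cbox (- 1) 2 \<times> {0..1} \<Longrightarrow>
      dist q p < \<delta> \<Longrightarrow> dist (F q) (F p) < \<eta>"
    using \<eta> unfolding uniformly_continuous_on_def by metis
  obtain \<kappa> :: "real ^ 'd \<Rightarrow> real ^ 'd" where \<kappa>: "fine_partition (min 1 (\<delta> / 2)) \<kappa>"
    using fine_partition_exists[of "min 1 (\<delta> / 2)"] \<delta>(1) by auto
  obtain T0 :: nat where T0: "inverse (real (Suc T0)) < \<delta> / 2" using reals_Archimedean[of "\<delta> / 2"] \<delta>(1) by auto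
  define T where "T = Suc T0"
  have T: "0 < T" "1 / real T < \<delta> / 2" using T0 by (auto simp: T_def inverse_eq_divide)
  define u where "u i = s - 1 + real T / real (T - i)" for i
  \<comment> \<open>The thresholds \<open>u i\<close> increase from \<open>s\<close>; their parameters \<open>w i\<close> decrease from \<open>1\<close> in steps of
  \<open>1 / T\<close>, and the last threshold stands for all marks up to infinity.\<close>
  define w where "w i = real (T - i) / real T" for i
  have lw: "level s (w i) = ereal (u i)" if "i < T" for i
  proof -
    have "0 < w i" using that T by (simp add: w_def)
    then show ?thesis by (simp add: level_def u_def) (simp add: w_def)
  qed
  have u_mono: "u i \<le> u j" if "i \<le> j" "j < T" for i j
    unfolding u_def using that by (intro add_left_mono divide_left_mono) auto
  have u0: "u 0 = s" using T by (simp add: u_def)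
  have us: "s \<le> u i" if "i < T" for i using u_mono[of 0 i] that u0 by simp
  have fin: "finite (\<kappa> ` torus)" using \<kappa> by (simp add: fine_partition_def)
  let ?J = "\<kappa> ` torus \<times> {..<T}"
  let ?c = "\<lambda>(c', i). f (c', ereal (u i)) - (if i = 0 then 0 else f (c', ereal (u (i - 1))))"
  let ?A = "\<lambda>(c' :: real ^ 'd, i :: nat). cell \<kappa> c'"
  let ?u = "\<lambda>(c' :: real ^ 'd, i :: nat). u i"
  have step: "(\<Sum>j\<in>?J. ?c j * indicator (?A j \<times> {ereal (?u j)..}) (x, z)) =
      (\<Sum>i\<in>{i. i < T \<and> ereal (u i) \<le> z}. ?c (\<kappa> x, i))" if x: "x \<in> torus" for x z
  proof -
    have "(\<Sum>j\<in>?J. ?c j * indicator (?A j \<times> {ereal (?u j)..}) (x, z)) =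
      (\<Sum>c'\<in>\<kappa> ` torus. \<Sum>i<T. ?c (c', i) * indicator (cell \<kappa> c' \<times> {ereal (u i)..}) (x, z))"
      unfolding sum.cartesian_product by (intro sum.cong) auto
    also have "\<dots> = (\<Sum>c'\<in>\<kappa> ` torus. if c' = \<kappa> x then (\<Sum>i<T. ?c (\<kappa> x, i) * indicator {ereal (u i)..} z) else 0)"
      using x by (intro sum.cong refl) (auto simp: cell_def indicator_def intro!: sum.cong sum.neutral)
    also have "\<dots> = (\<Sum>i<T. ?c (\<kappa> x, i) * indicator {ereal (u i)..} z)"
      using x fin by (simp add: sum.delta)
    also have "\<dots> = (\<Sum>i<T. if ereal (u i) \<le> z then ?c (\<kappa> x, i) else 0)"
      by (intro sum.cong) (auto simp: indicator_def)
    also have "\<dots> = (\<Sum>i\<in>{i. i < T \<and> ereal (u i) \<le> z}. ?c (\<kappa> x, i))"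
      by (subst sum.inter_filter[symmetric]) (auto intro!: sum.cong)
    finally show ?thesis .
  qed
  show ?thesis
  proof (rule exI[of _ ?J], rule exI[of _ ?c], rule exI[of _ ?A], rule exI[of _ ?u], intro conjI ballI)
    show "finite ?J" using fin by simp
    fix j assume "j \<in> ?J"
    then show "?A j \<in> sets (borel_of torus_topology)" "s \<le> ?u j"
      using cell_borel[OF \<kappa>] us by auto
  next
    fix y assume "y \<in> topspace (E_topology :: ((real ^ 'd) \<times> ereal) topology)"
    then obtain x z where y: "y = (x, z)" "x \<in> torus" "-\<infinity> < z" by auto
    show "\<bar>f y - (\<Sum>j\<in>?J. ?c j * indicator (?A j \<times> {ereal (?u j)..}) y)\<bar> \<le> \<eta> * indicator (strip s) y"
    proof (cases "ereal s \<le> z")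
      case False
      then have e: "{i. i < T \<and> ereal (u i) \<le> z} = {}" using us by (auto intro: order_trans simp: ereal_less_eq(3)[symmetric] simp del: ereal_less_eq)
      have "f y = 0" "indicator (strip s) y = (0 :: real)" using f0 y False by (auto simp: strip_def)
      then show ?thesis unfolding y(1) step[OF y(2)] e sum.empty by simp
    next
      case True
      define I where "I = {i. i < T \<and> ereal (u i) \<le> z}"
      define m where "m = Max I"
      have "0 \<in> I" using True T u0 by (simp add: I_def)
      then have m: "m \<in> I" "\<And>i. i \<in> I \<Longrightarrow> i \<le> m"
      proof -
        have "finite I" by (simp add: I_def)
        then show "m \<in> I" "\<And>i. i \<in> I \<Longrightarrow> i \<le> m"
          unfolding m_def using \<open>0 \<in> I\<close> by (auto intro!: Max_in)
      qed
      have mT: "m < T" "ereal (u m) \<le> z" using m(1) by (auto simp: I_def)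
      have I: "I = {..m}"
      proof (intro equalityI subsetI)
        fix i assume "i \<in> {..m}"
        then show "i \<in> I" using u_mono[of i m] mT by (auto simp: I_def intro: order_trans[of "ereal (u i)" "ereal (u m)"])
      qed (use m in auto)
      have S: "(\<Sum>j\<in>?J. ?c j * indicator (?A j \<times> {ereal (?u j)..}) y) = f (\<kappa> x, ereal (u m))"
        unfolding y(1) step[OF y(2)] I_def[symmetric] I
        using telescope_steps[of "\<lambda>i. f (\<kappa> x, ereal (u i))" m] by simp
      define w' where "w' = (if z = \<infinity> then 0 else inverse (real_of_ereal z - s + 1))"
      have w': "level s w' = z" "0 \<le> w'" "w' \<le> 1" "w m - 1 / real T \<le> w'" "w' \<le> w m"
      proof -
        have wm: "w m - 1 / real T = real (T - Suc m) / real T"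
        proof -
          have "real (T - m) = real (T - Suc m) + 1" using mT(1) by simp
          then show ?thesis using T by (simp add: w_def field_simps)
        qed
        have "level s w' = z \<and> 0 \<le> w' \<and> w' \<le> 1 \<and> w m - 1 / real T \<le> w' \<and> w' \<le> w m"
        proof (cases z)
          case (real zr)
          have zs: "s \<le> zr" "u m \<le> zr" using True mT(2) real by simp_all
          have w'eq: "w' = inverse (zr - s + 1)" using real by (simp add: w'_def)
          have pos: "0 < zr - s + 1" using zs by simp
          have "level s w' = z" using pos real by (simp add: level_def w'eq)
          moreover have "w' \<le> 1" unfolding w'eq using zs by (simp add: inverse_le_1_iff)
          moreover have "w' \<le> w m"
          proof -
            have "real T / real (T - m) \<le> zr - s + 1" using zs(2) by (simp add: u_def)
            moreover have "0 < real T / real (T - m)" using T mT by simp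
            ultimately have "inverse (zr - s + 1) \<le> inverse (real T / real (T - m))" by (rule le_imp_inverse_le)
            then show ?thesis by (simp add: w'eq w_def)
          qed
          moreover have "w m - 1 / real T \<le> w'"
          proof (cases "Suc m < T")
            case True
            have "Suc m \<notin> I" using m(2)[of "Suc m"] by auto
            then have "zr < u (Suc m)" using True real by (simp add: I_def)
            then have "zr - s + 1 \<le> real T / real (T - Suc m)" by (simp add: u_def)
            then have "inverse (real T / real (T - Suc m)) \<le> inverse (zr - s + 1)" using pos by (rule le_imp_inverse_le)
            then show ?thesis unfolding wm w'eq by simp
          next
            case False
            then show ?thesis unfolding wm w'eq using pos by simp
          qed
          ultimately show ?thesis using pos by (simp add: w'eq)
        next
          case PInf
          have "Suc m \<ge> T"
          proof (rule ccontr)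
            assume "\<not> T \<le> Suc m"
            then have "Suc m \<in> I" using PInf by (simp add: I_def)
            then show False using m(2)[of "Suc m"] by simp
          qed
          then have "w m - 1 / real T \<le> 0" unfolding wm by simp
          then show ?thesis using PInf by (simp add: w'_def level_def w_def)
        qed (use True in simp)
        then show "level s w' = z" "0 \<le> w'" "w' \<le> 1" "w m - 1 / real T \<le> w'" "w' \<le> w m" by auto
      qed
      have wm1: "0 \<le> w m" "w m \<le> 1" using T by (auto simp: w_def divide_le_eq)
      have kx: "\<kappa> x \<in> torus" "torus_dist (\<kappa> x) x < min 1 (\<delta> / 2)" using \<kappa> y(2) by (auto simp: fine_partition_def)
      then obtain l where l: "l \<in> lattice" "norm (\<kappa> x - x + l) < min 1 (\<delta> / 2)"
        using torus_dist_less_iff[THEN iffD1] by blast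
      define v where "v = \<kappa> x + l"
      have v: "frac_vec v = \<kappa> x" "norm (v - x) < min 1 (\<delta> / 2)"
        using l kx(1) frac_vec_eq_iff[of v "\<kappa> x"] by (auto simp: v_def algebra_simps)
      have "v \<in> cbox (- 1) 2"
      proof -
        have "- 1 \<le> v $ i \<and> v $ i \<le> 2" for i
        proof -
          have "\<bar>v $ i - x $ i\<bar> < 1" using component_le_norm_cart[of "v - x" i] v(2) by simp
          moreover have "0 \<le> x $ i" "x $ i < 1" using y(2) by (auto simp: torus_def)
          ultimately show ?thesis by linarith
        qed
        then show ?thesis by (simp add: mem_box_cart)
      qed
      moreover have "x \<in> cbox (- 1) 2"
      proof -
        have "- 1 \<le> x $ i \<and> x $ i \<le> 2" for i
        proof -
          have "0 \<le> x $ i" "x $ i < 1" using y(2) by (auto simp: torus_def)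
          then show ?thesis by linarith
        qed
        then show ?thesis by (simp add: mem_box_cart)
      qed
      moreover have "dist (v, w m) (x, w') < \<delta>"
      proof -
        have "dist (v, w m) (x, w') \<le> dist v x + dist (w m) w'"
          unfolding dist_Pair_Pair by (rule sqrt_sum_squares_le_sum) auto
        moreover have "dist (w m) w' \<le> 1 / real T" using w'(4,5) by (simp add: dist_real_def)
        ultimately show ?thesis using v(2) T(2) by (simp add: dist_norm)
      qed
      ultimately have "dist (F (v, w m)) (F (x, w')) < \<eta>"
        using wm1 w' by (intro \<delta>(2)) auto
      moreover have "F (v, w m) = f (\<kappa> x, ereal (u m))" "F (x, w') = f y"
        using v(1) lw[OF mT(1)] w'(1) y by (simp_all add: F_def)
      ultimately have "\<bar>f y - f (\<kappa> x, ereal (u m))\<bar> \<le> \<eta>" by (simp add: dist_real_def)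
      moreover have "indicator (strip s) y = (1 :: real)" using y True by (simp add: strip_def)
      ultimately show ?thesis unfolding S by simp
    qed
  qed
qed

lemma step_integral:
  fixes f :: "(real ^ 'd) \<times> ereal \<Rightarrow> real" and J :: "'j set"
  assumes \<mu>: "sets \<mu> = sets (borel_of E_topology)" and fin: "emeasure \<mu> (strip s) < \<infinity>"
    and f: "f \<in> borel_measurable (borel_of E_topology)"
    and J: "finite J" "\<forall>j\<in>J. A j \<in> sets (borel_of torus_topology) \<and> s \<le> u j"
    and approx: "\<forall>y\<in>topspace E_topology. \<bar>f y - (\<Sum>j\<in>J. c j * indicator (A j \<times> {ereal (u j)..}) y)\<bar> \<le> \<eta> * indicator (strip s) y"
  shows "integrable \<mu> f"
    and "\<bar>(\<integral>y. f y \<partial>\<mu>) - (\<Sum>j\<in>J. c j * measure \<mu> (A j \<times> {ereal (u j)..}))\<bar> \<le> \<eta> * measure \<mu> (strip s)"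
proof -
  let ?R = "\<lambda>j. A j \<times> {ereal (u j)..}"
  have sp: "space \<mu> = topspace E_topology" using sets_eq_imp_space_eq[OF \<mu>] by simp
  have R: "?R j \<in> sets \<mu>" "emeasure \<mu> (?R j) < \<infinity>" if "j \<in> J" for j
  proof -
    show "?R j \<in> sets \<mu>" using J(2) that rectangle_borel_E unfolding \<mu> by blast
    have "?R j \<subseteq> strip s"
      using J(2) that borel_torus_subset[of "A j"]
      by (auto simp: strip_def intro: order_trans[of "ereal s" "ereal (u j)"])
    then have "emeasure \<mu> (?R j) \<le> emeasure \<mu> (strip s)" using \<mu> by (intro emeasure_mono) auto
    then show "emeasure \<mu> (?R j) < \<infinity>" using fin by (rule le_less_trans)
  qed
  have st: "strip s \<in> sets \<mu>" using \<mu> by simp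
  have intS: "integrable \<mu> (\<lambda>y. \<Sum>j\<in>J. c j * indicator (?R j) y)"
    using R by (intro Bochner_Integration.integrable_sum integrable_mult_right integrable_real_indicator) auto
  have intI: "integrable \<mu> (\<lambda>y. \<eta> * indicator (strip s) y)"
    using st fin by (intro integrable_mult_right integrable_real_indicator) auto
  have fm: "f \<in> borel_measurable \<mu>" using f measurable_cong_sets[OF \<mu> refl] by blast
  have intD: "integrable \<mu> (\<lambda>y. f y - (\<Sum>j\<in>J. c j * indicator (?R j) y))"
  proof (rule Bochner_Integration.integrable_bound[OF intI])
    show "AE y in \<mu>. norm (f y - (\<Sum>j\<in>J. c j * indicator (?R j) y)) \<le> norm (\<eta> * indicator (strip s) y)"
    proof (intro AE_I2)
      fix y assume "y \<in> space \<mu>"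
      then show "norm (f y - (\<Sum>j\<in>J. c j * indicator (?R j) y)) \<le> norm (\<eta> * indicator (strip s) y)"
        using order_trans[OF bspec[OF approx] abs_ge_self, of y] unfolding sp real_norm_def by blast
    qed
  qed (use fm intS in \<open>auto intro: borel_measurable_diff borel_measurable_integrable\<close>)
  have "integrable \<mu> (\<lambda>y. (f y - (\<Sum>j\<in>J. c j * indicator (?R j) y)) + (\<Sum>j\<in>J. c j * indicator (?R j) y))"
    by (intro Bochner_Integration.integrable_add intD intS)
  then show intf: "integrable \<mu> f" by simp
  have Rsp: "?R j \<inter> space \<mu> = ?R j" if "j \<in> J" for j using sets.sets_into_space[OF R(1)[OF that]] by blast
  have "(\<integral>y. (\<Sum>j\<in>J. c j * indicator (?R j) y) \<partial>\<mu>) = (\<Sum>j\<in>J. c j * measure \<mu> (?R j))"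
    using R Rsp by (subst Bochner_Integration.integral_sum) (auto intro!: sum.cong integrable_mult_right integrable_real_indicator)
  then have "(\<integral>y. f y \<partial>\<mu>) - (\<Sum>j\<in>J. c j * measure \<mu> (?R j)) = (\<integral>y. f y - (\<Sum>j\<in>J. c j * indicator (?R j) y) \<partial>\<mu>)"
    using Bochner_Integration.integral_diff[OF intf intS] by simp
  also have "\<bar>\<dots>\<bar> \<le> (\<integral>y. \<bar>f y - (\<Sum>j\<in>J. c j * indicator (?R j) y)\<bar> \<partial>\<mu>)" by (rule integral_abs_bound)
  also have "\<dots> \<le> (\<integral>y. \<eta> * indicator (strip s) y \<partial>\<mu>)"
    by (intro integral_mono integrable_abs intD intI bspec[OF approx]) (simp only: sp)
  also have "\<dots> = \<eta> * measure \<mu> (strip s)" using sets.sets_into_space[OF st] by (simp add: Int_absorb2)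
  finally show "\<bar>(\<integral>y. f y \<partial>\<mu>) - (\<Sum>j\<in>J. c j * measure \<mu> (?R j))\<bar> \<le> \<eta> * measure \<mu> (strip s)" .
qed

section \<open>Locality of continuous functions of point measures\<close>

text \<open>A vague neighbourhood of the unit mass at \<open>y0\<close> contains all point measures whose only atom above some
level lies near \<open>y0\<close>. Compactness of the strip makes the level uniform in the position of the atom.\<close>

lemma uniform_locality:
  fixes g :: "((real ^ 'd) \<times> ereal) measure \<Rightarrow> real"
  assumes g: "continuous_map (vague_topology E_topology) euclideanreal g" and \<eta>: "0 < \<eta>"
  shows "\<exists>t\<le>s. \<forall>y\<in>strip s. \<forall>\<mu>\<in>point_measures E_topology.
     emeasure \<mu> {y} = 1 \<and> emeasure \<mu> (strip t - {y}) = 0 \<longrightarrow> \<bar>g \<mu> - g (dirac E_topology y)\<bar> \<le> \<eta>"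
proof -
  have "\<exists>t W. openin E_topology W \<and> y0 \<in> W \<and> (\<forall>y\<in>W. \<forall>\<mu>\<in>point_measures E_topology.
     emeasure \<mu> {y} = 1 \<and> emeasure \<mu> (strip t - {y}) = 0 \<longrightarrow> \<bar>g \<mu> - g (dirac E_topology y)\<bar> \<le> \<eta>)"
    if y0: "y0 \<in> strip s" for y0
  proof -
    have y0E: "y0 \<in> topspace E_topology" using y0 strip_subset by auto
    define V where "V = {\<mu> \<in> point_measures E_topology. g \<mu> \<in> ball (g (dirac E_topology y0)) (\<eta> / 2)}"
    have "openin (vague_topology E_topology) V"
      unfolding V_def topspace_vague[symmetric] using g by (rule openin_continuous_map_preimage) simp
    moreover have "dirac E_topology y0 \<in> V" unfolding V_def using dirac_in_point_measures[OF y0E] \<eta> by simp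
    ultimately obtain t W where W: "openin E_topology W" "y0 \<in> W"
      "\<forall>y\<in>W. \<forall>\<mu>\<in>point_measures E_topology. emeasure \<mu> {y} = 1 \<and> emeasure \<mu> (strip t - {y}) = 0 \<longrightarrow> \<mu> \<in> V"
      using vague_nbhd_dirac[OF _ y0E] by metis
    show ?thesis
    proof (intro exI[of _ t] exI[of _ W] conjI ballI impI W(1,2))
      fix y \<mu> assume y: "y \<in> W" and \<mu>: "\<mu> \<in> point_measures E_topology" "emeasure \<mu> {y} = 1 \<and> emeasure \<mu> (strip t - {y}) = 0"
      have yE: "y \<in> topspace E_topology" using openin_subset[OF W(1)] y by blast
      have "dirac E_topology y \<in> V"
        using y yE by (intro W(3)[rule_format, of y] dirac_in_point_measures) (auto simp: sets.Diff)
      moreover have "\<mu> \<in> V" using W(3) y \<mu> by blast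
      ultimately have "\<bar>g (dirac E_topology y0) - g (dirac E_topology y)\<bar> < \<eta> / 2"
        "\<bar>g (dirac E_topology y0) - g \<mu>\<bar> < \<eta> / 2"
        unfolding V_def by (simp_all add: dist_real_def)
      then show "\<bar>g \<mu> - g (dirac E_topology y)\<bar> \<le> \<eta>" by linarith
    qed
  qed
  then obtain t W where tW: "\<And>y0. y0 \<in> strip s \<Longrightarrow> openin E_topology (W y0) \<and> y0 \<in> W y0 \<and>
      (\<forall>y\<in>W y0. \<forall>\<mu>\<in>point_measures E_topology.
     emeasure \<mu> {y} = 1 \<and> emeasure \<mu> (strip (t y0) - {y}) = 0 \<longrightarrow> \<bar>g \<mu> - g (dirac E_topology y)\<bar> \<le> \<eta>)"
    by metis
  have "\<exists>\<F>. finite \<F> \<and> \<F> \<subseteq> W ` strip s \<and> strip s \<subseteq> \<Union>\<F>"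
    using tW by (intro compactinD[OF compactin_strip]) auto
  then obtain C where C: "finite C" "C \<subseteq> strip s" "strip s \<subseteq> (\<Union>y0\<in>C. W y0)"
    by (metis finite_subset_image)
  define t' where "t' = Min (insert s (t ` C))"
  show ?thesis
  proof (intro exI[of _ t'] conjI ballI impI)
    show "t' \<le> s" unfolding t'_def using C(1) by (intro Min_le) auto
    fix y :: "(real ^ 'd) \<times> ereal" and \<mu> assume y: "y \<in> strip s" and \<mu>: "\<mu> \<in> point_measures E_topology"
      "emeasure \<mu> {y} = 1 \<and> emeasure \<mu> (strip t' - {y}) = 0"
    obtain y0 where y0: "y0 \<in> C" "y \<in> W y0" using C(3) y by blast
    have "t' \<le> t y0" unfolding t'_def using C(1) y0(1) by (intro Min_le) auto
    then have "strip (t y0) - {y} \<subseteq> strip t' - {y}" using strip_mono by blast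
    moreover have "strip t' - {y} \<in> sets \<mu>"
      unfolding point_measures_sets[OF \<mu>(1)]
      by (intro sets.Diff strip_borel singleton_borel_E subsetD[OF strip_subset y])
    ultimately have "emeasure \<mu> (strip (t y0) - {y}) = 0"
      using \<mu>(2) emeasure_mono[of "strip (t y0) - {y}" "strip t' - {y}" \<mu>] by simp
    then show "\<bar>g \<mu> - g (dirac E_topology y)\<bar> \<le> \<eta>" using tW[of y0] y0 C(2) \<mu> by blast
  qed
qed

text \<open>With no atom in the larger strip both terms vanish; with one atom, uniform locality applies if it
lies in the smaller strip, and both terms vanish otherwise; with \<open>N \<ge> 2\<close> atoms, the two terms are
bounded by \<open>B\<close> and \<open>N * B\<close>.\<close>

lemma pathwise_bound:
  fixes g :: "((real ^ 'd) \<times> ereal) measure \<Rightarrow> real"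
  assumes L: "L \<in> point_measures E_topology"
    and B: "\<forall>\<mu>\<in>point_measures E_topology. \<bar>g \<mu>\<bar> \<le> B"
    and g0: "\<forall>\<mu>\<in>point_measures E_topology. emeasure \<mu> (strip s) = 0 \<longrightarrow> g \<mu> = 0"
    and ts: "t \<le> s" and \<eta>: "0 < \<eta>"
    and loc: "\<forall>y\<in>strip s. \<forall>\<mu>\<in>point_measures E_topology.
     emeasure \<mu> {y} = 1 \<and> emeasure \<mu> (strip t - {y}) = 0 \<longrightarrow> \<bar>g \<mu> - g (dirac E_topology y)\<bar> \<le> \<eta>"
    and h: "h = (\<lambda>y. g (dirac E_topology y))" and hm: "h \<in> borel_measurable (borel_of E_topology)"
  shows "\<bar>g L - (\<integral>y. h y \<partial>L)\<bar> \<le> \<eta> * measure L (strip s) + 2 * B * enn2real (ge2 (emeasure L (strip t)))"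
proof -
  have sets: "sets L = sets (borel_of E_topology)" by (rule point_measures_sets[OF L])
  have B0: "0 \<le> B" using B L by force
  obtain p and I :: "nat set" where p: "p \<in> I \<rightarrow> topspace E_topology" "L = distr (count_space I) (borel_of E_topology) p"
    by (rule point_measuresE[OF L])
  have sub: "strip s \<subseteq> (strip t :: ((real ^ 'd) \<times> ereal) set)" using ts by (rule strip_mono)
  have h0: "\<forall>y\<in>topspace E_topology - strip s. h y = 0"
  proof
    fix y :: "(real ^ 'd) \<times> ereal" assume y: "y \<in> topspace E_topology - strip s"
    then have "dirac E_topology y \<in> point_measures E_topology" by (intro dirac_in_point_measures) blast
    moreover have "emeasure (dirac E_topology y) (strip s) = 0" using y by simp
    ultimately show "h y = 0" unfolding h using g0 by blast
  qed
  have h0t: "\<forall>y\<in>topspace E_topology - strip t. h y = 0" using h0 sub by blast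
  let ?I = "{i \<in> I. p i \<in> strip t}"
  have finI: "finite ?I"
    using point_measures_compact_finite[OF L compactin_strip[of t]] L unfolding p(2)
    by (intro finite_points_in[OF _ p(1)]) simp_all
  have Nt: "emeasure L (strip t) = of_nat (card ?I)"
    unfolding p(2) using finI by (subst emeasure_point_sum[OF p(1)]) auto
  have rhs0: "0 \<le> \<eta> * measure L (strip s) + 2 * B * enn2real (ge2 (emeasure L (strip t)))"
    using \<eta> B0 by simp
  consider "card ?I = 0" | "card ?I = 1" | "2 \<le> card ?I" by linarith
  then show ?thesis
  proof cases
    case 1
    then have t0: "emeasure L (strip t) = 0" using Nt by simp
    then have "emeasure L (strip s) = 0" using emeasure_mono[OF sub, of L] sets by simp
    then have gL: "g L = 0" using g0 L by blast
    have "(\<integral>y. h y \<partial>L) = (\<Sum>i\<in>?I. h (p i))"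
      unfolding p(2) by (rule integral_point_sum[OF p(1) hm finI]) (use h0t p(1) in auto)
    moreover have "?I = {}" using 1 finI by (simp only: card_0_eq)
    ultimately have "(\<integral>y. h y \<partial>L) = 0" by (simp only: sum.empty)
    then show ?thesis using rhs0 gL by simp
  next
    case 2
    then obtain i where i: "?I = {i}" by (rule card_1_singletonE)
    define y where "y = p i"
    have "i \<in> ?I" unfolding i by simp
    then have yt: "y \<in> strip t" and iI: "i \<in> I" by (simp_all add: y_def)
    have yE: "y \<in> topspace E_topology" using yt strip_subset by auto
    have yset: "{y} \<in> sets (borel_of E_topology)" using yE by simp
    have only: "j = i" if "j \<in> I" "p j \<in> strip t" for j
    proof -
      have "j \<in> ?I" using that by simp
      then show ?thesis unfolding i by simp
    qed
    have "{j \<in> I. p j \<in> {y}} = {i}"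
    proof (intro equalityI subsetI)
      fix j assume "j \<in> {j \<in> I. p j \<in> {y}}"
      then show "j \<in> {i}" using only[of j] yt by simp
    qed (simp add: iI y_def)
    then have y1: "emeasure L {y} = 1" unfolding p(2) using iI by (subst emeasure_point_sum[OF p(1) yset]) simp
    have "{j \<in> I. p j \<in> strip t - {y}} = {}"
    proof (rule equals0I)
      fix j assume "j \<in> {j \<in> I. p j \<in> strip t - {y}}"
      then show False using only[of j] by (simp add: y_def)
    qed
    then have y0: "emeasure L (strip t - {y}) = 0"
      unfolding p(2) emeasure_point_sum[OF p(1) sets.Diff[OF strip_borel yset]] by (simp only: emeasure_empty)
    have int: "(\<integral>z. h z \<partial>L) = h y" by (rule integral_single_point[OF sets yE y1 y0 h0t hm])
    show ?thesis
    proof (cases "y \<in> strip s")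
      case True
      then have "\<bar>g L - h y\<bar> \<le> \<eta>" using loc L y1 y0 unfolding h by blast
      moreover have "1 \<le> measure L (strip s)"
      proof -
        have "emeasure L {y} \<le> emeasure L (strip s)" using True sets by (intro emeasure_mono) auto
        moreover have "emeasure L (strip s) < \<infinity>" by (rule point_measures_compact_finite[OF L compactin_strip])
        ultimately show ?thesis unfolding y1 measure_def by (metis enn2real_1 enn2real_mono infinity_ennreal_def)
      qed
      then have "\<eta> \<le> \<eta> * measure L (strip s)" using \<eta> by simp
      moreover have "0 \<le> 2 * B * enn2real (ge2 (emeasure L (strip t)))" using B0 by simp
      ultimately show ?thesis unfolding int by linarith
    next
      case False
      then have "strip s \<subseteq> strip t - {y}" using sub by blast
      then have "emeasure L (strip s) \<le> emeasure L (strip t - {y})"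
        using sets.Diff[OF strip_borel yset] sets by (intro emeasure_mono) auto
      then have "g L = 0" using g0 L y0 by simp
      moreover have "h y = 0" using h0 False yE by blast
      ultimately show ?thesis unfolding int using rhs0 by simp
    qed
  next
    case 3
    have "(\<integral>y. h y \<partial>L) = (\<Sum>i\<in>?I. h (p i))"
      unfolding p(2) by (rule integral_point_sum[OF p(1) hm finI]) (use h0t p(1) in auto)
    also have "\<bar>\<dots>\<bar> \<le> (\<Sum>i\<in>?I. \<bar>h (p i)\<bar>)" by (rule sum_abs)
    also have "\<dots> \<le> (\<Sum>i\<in>?I. B)"
    proof (rule sum_mono)
      fix i assume "i \<in> ?I"
      then have "dirac E_topology (p i) \<in> point_measures E_topology"
        using p(1) by (intro dirac_in_point_measures) blast
      then show "\<bar>h (p i)\<bar> \<le> B" unfolding h using B by blast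
    qed
    finally have "\<bar>\<integral>y. h y \<partial>L\<bar> \<le> real (card ?I) * B" by simp
    moreover have "\<bar>g L\<bar> \<le> B" using B L by blast
    moreover have "1 * B \<le> real (card ?I) * B" using 3 B0 by (intro mult_right_mono) auto
    ultimately have "\<bar>g L - (\<integral>y. h y \<partial>L)\<bar> \<le> 2 * B * real (card ?I)" by (simp add: abs_le_iff mult_ac)
    also have "real (card ?I) = enn2real (ge2 (emeasure L (strip t)))"
    proof -
      have "of_nat 2 \<le> (of_nat (card ?I) :: ennreal)" using 3 by (simp del: of_nat_numeral)
      then show ?thesis unfolding Nt by (simp add: ge2_def ennreal_of_nat_eq_real_of_nat)
    qed
    finally show ?thesis using \<eta> by (simp add: add_increasing)
  qed
qed

section \<open>The limit measure\<close>

text \<open>The limit measure is, up to the factor \<open>1 / fact (k - 1)\<close>, the image of this measure on \<open>E\<close> under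
\<open>y \<mapsto> \<delta>\<^sub>y\<close>.\<close>

definition limit_intensity :: "((real ^ 'd) \<times> ereal) measure" where
  "limit_intensity = distr (density (lebesgue_torus \<Otimes>\<^sub>M lborel) (\<lambda>(x, u). ennreal (exp (- u))))
     (borel_of E_topology) (\<lambda>(x, u). (x, ereal u))"

lemma sets_limit_intensity [simp]: "sets limit_intensity = sets (borel_of E_topology)"
  by (simp add: limit_intensity_def)

lemma mark_measurable:
  "(\<lambda>(x, u). (x, ereal u)) \<in> measurable (lebesgue_torus \<Otimes>\<^sub>M lborel) (borel_of (E_topology :: ((real ^ 'd) \<times> ereal) topology))"
  unfolding case_prod_unfold
proof (rule measurable_into_E)
  have "(\<lambda>x. x) \<in> borel_measurable (lebesgue_torus :: (real ^ 'd) measure)"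
    unfolding lebesgue_torus_def by (rule measurable_restrict_space1) simp
  from measurable_compose[OF measurable_fst this]
  show "(\<lambda>x. fst x) \<in> borel_measurable (lebesgue_torus \<Otimes>\<^sub>M lborel :: ((real ^ 'd) \<times> real) measure)" .
  show "(\<lambda>x. ereal (snd x)) \<in> borel_measurable (lebesgue_torus \<Otimes>\<^sub>M lborel :: ((real ^ 'd) \<times> real) measure)"
    by measurable
  show "fst x \<in> torus" if "x \<in> space (lebesgue_torus \<Otimes>\<^sub>M lborel)" for x :: "(real ^ 'd) \<times> real"
    using that by (auto simp: space_pair_measure lebesgue_torus_def space_restrict_space)
qed simp

lemma nn_integral_exp_tail: "(\<integral>\<^sup>+v. ennreal (exp (- v)) * indicator {u..} v \<partial>lborel) = ennreal (exp (- u))"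
proof -
  have "(\<integral>\<^sup>+v. ennreal (exp (- v)) * indicator {u..} v \<partial>lborel) = ennreal (0 - (- exp (- u)))"
  proof (rule nn_integral_FTC_atLeast)
    show "((\<lambda>v. - exp (- v)) has_real_derivative exp (- x)) (at x)" for x :: real
      by (auto intro!: derivative_eq_intros)
    have "((\<lambda>v :: real. - exp (- v)) \<longlongrightarrow> - 0) at_top"
      by (intro tendsto_minus filterlim_compose[OF exp_at_bot filterlim_uminus_at_bot_at_top])
    then show "((\<lambda>v :: real. - exp (- v)) \<longlongrightarrow> 0) at_top" by simp
  qed auto
  then show ?thesis by simp
qed

lemma emeasure_limit_intensity:
  fixes A :: "(real ^ 'd) set"
  assumes A: "A \<in> sets (borel_of torus_topology)"
  shows "emeasure limit_intensity (A \<times> {ereal u..}) = ennreal (vol A * exp (- u))"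
proof -
  let ?M = "lebesgue_torus \<Otimes>\<^sub>M lborel :: ((real ^ 'd) \<times> real) measure"
  have Am: "A \<in> sets lebesgue_torus"
    unfolding lebesgue_torus_def using borel_torus_imp_borel[OF A] borel_torus_subset[OF A]
    by (simp add: sets_restrict_space_iff)
  have R: "A \<times> {u..} \<in> sets ?M" using Am by (intro pair_measureI) auto
  have sp: "space ?M = torus \<times> UNIV"
    by (simp add: space_pair_measure lebesgue_torus_def space_restrict_space)
  have dm: "(\<lambda>(x :: real ^ 'd, u). ennreal (exp (- u))) \<in> borel_measurable ?M" by measurable
  have "(\<lambda>(x :: real ^ 'd, u). (x, ereal u)) -` (A \<times> {ereal u..}) \<inter> space ?M = A \<times> {u..}"
    using borel_torus_subset[OF A] by (auto simp: sp)
  then have "emeasure limit_intensity (A \<times> {ereal u..}) = emeasure (density ?M (\<lambda>(x, u). ennreal (exp (- u)))) (A \<times> {u..})"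
    unfolding limit_intensity_def
    by (subst emeasure_distr) (use mark_measurable rectangle_borel_E[OF A] in auto)
  also have "\<dots> = (\<integral>\<^sup>+z. (case z of (x, u) \<Rightarrow> ennreal (exp (- u))) * indicator (A \<times> {u..}) z \<partial>?M)"
    by (rule emeasure_density[OF dm R])
  also have "\<dots> = (\<integral>\<^sup>+x. \<integral>\<^sup>+v. ennreal (exp (- v)) * indicator (A \<times> {u..}) (x, v) \<partial>lborel \<partial>lebesgue_torus)"
    using dm R by (subst lborel.nn_integral_fst[symmetric]) auto
  also have "\<dots> = (\<integral>\<^sup>+x. ennreal (exp (- u)) * indicator A x \<partial>lebesgue_torus)"
  proof (rule nn_integral_cong)
    fix x :: "real ^ 'd"
    have "(\<integral>\<^sup>+v. ennreal (exp (- v)) * indicator (A \<times> {u..}) (x, v) \<partial>lborel) =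
        (\<integral>\<^sup>+v. (ennreal (exp (- v)) * indicator {u..} v) * indicator A x \<partial>lborel)"
      by (intro nn_integral_cong) (auto simp: indicator_def)
    also have "\<dots> = ennreal (exp (- u)) * indicator A x"
      by (subst nn_integral_multc) (auto simp: nn_integral_exp_tail)
    finally show "(\<integral>\<^sup>+v. ennreal (exp (- v)) * indicator (A \<times> {u..}) (x, v) \<partial>lborel) = ennreal (exp (- u)) * indicator A x" .
  qed
  also have "\<dots> = ennreal (exp (- u)) * emeasure lebesgue_torus A"
    using Am by (rule nn_integral_cmult_indicator)
  also have "\<dots> = ennreal (vol A * exp (- u))"
    by (simp add: emeasure_lebesgue_torus[OF A] emeasure_eq_vol(1)[OF A] ennreal_mult mult.commute)
  finally show ?thesis .
qed

lemma vol_torus: "vol (torus :: (real ^ 'd) set) = 1"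
  using emeasure_torus[where 'd = 'd] by (simp add: measure_def)

lemma emeasure_limit_intensity_strip: "emeasure (limit_intensity :: ((real ^ 'd) \<times> ereal) measure) (strip t) = ennreal (exp (- t))"
  using emeasure_limit_intensity[OF torus_sets[where 'a = 'd], of t] by (simp add: strip_def vol_torus)

lemma xi_limit_alt:
  "xi_limit k = scale_measure (ennreal (1 / fact (k - 1)))
     (distr limit_intensity (borel_of (vague_topology E_topology)) (dirac (E_topology :: ((real ^ 'd) \<times> ereal) topology)))"
proof -
  have "(\<lambda>(x, u). (x, ereal u)) \<in> measurable (density (lebesgue_torus \<Otimes>\<^sub>M lborel) (\<lambda>(x, u). ennreal (exp (- u))))
      (borel_of (E_topology :: ((real ^ 'd) \<times> ereal) topology))"
    using mark_measurable by simp
  from distr_distr[OF measurable_continuous_map[OF continuous_map_dirac] this]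
  show ?thesis unfolding xi_limit_def limit_intensity_def by (simp add: comp_def case_prod_unfold)
qed

lemma integral_scale_measure:
  fixes f :: "'a \<Rightarrow> real"
  assumes "0 \<le> c" "f \<in> borel_measurable M"
  shows "(\<integral>x. f x \<partial>scale_measure (ennreal c) M) = c * (\<integral>x. f x \<partial>M)"
proof -
  have "scale_measure (ennreal c) M = density M (\<lambda>_. ennreal c)"
    by (rule measure_eqI) (auto simp: emeasure_density_const)
  then show ?thesis using assms by (simp add: integral_density)
qed

text \<open>The complement of a ball around the null measure only contains unit masses at points of some strip,
and a strip has finite measure.\<close>

lemma xi_limit_in_M0:
  assumes "vague_metric (E_topology :: ((real ^ 'd) \<times> ereal) topology) \<rho>"
  shows "(xi_limit k :: ((real ^ 'd) \<times> ereal) measure measure) \<in> M0 E_topology \<rho>"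
  unfolding M0_def
proof (intro CollectI conjI allI impI)
  show "sets (xi_limit k :: ((real ^ 'd) \<times> ereal) measure measure) = sets (borel_of (vague_topology E_topology))"
    by (simp add: xi_limit_alt)
  fix r :: real assume r: "0 < r"
  interpret M: Metric_space "point_measures (E_topology :: ((real ^ 'd) \<times> ereal) topology)" \<rho>
    using assms by (simp add: vague_metric_def)
  let ?O = "null_measure (borel_of (E_topology :: ((real ^ 'd) \<times> ereal) topology))"
  have top: "M.mtopology = vague_topology E_topology" using assms by (simp add: vague_metric_def)
  have op: "openin (vague_topology E_topology) (M.mball ?O r)" unfolding top[symmetric] by simp
  have "?O \<in> point_measures E_topology" by (rule null_in_point_measures)
  then have "?O \<in> M.mball ?O r" using r by simp
  then obtain t where t: "\<forall>\<mu>\<in>point_measures E_topology. emeasure \<mu> (strip t) = 0 \<longrightarrow> \<mu> \<in> M.mball ?O r"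
    using vague_nbhd_null[OF op] by blast
  have "closedin (vague_topology E_topology) (point_measures E_topology - M.mball ?O r)"
    using closedin_diff[OF closedin_topspace op] by (simp only: topspace_vague)
  then have S: "point_measures E_topology - M.mball ?O r \<in> sets (borel_of (vague_topology E_topology))"
    by (rule closedin_sets_borel_of)
  have "emeasure (distr limit_intensity (borel_of (vague_topology E_topology)) (dirac E_topology)) (point_measures E_topology - M.mball ?O r)
     = emeasure limit_intensity (dirac E_topology -` (point_measures E_topology - M.mball ?O r) \<inter> space limit_intensity)"
    using measurable_continuous_map[OF continuous_map_dirac[where 'd = 'd]] S
    by (intro emeasure_distr) (auto cong: measurable_cong_sets)
  also have "\<dots> \<le> emeasure limit_intensity (strip t :: ((real ^ 'd) \<times> ereal) set)"
  proof (rule emeasure_mono)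
    show "dirac E_topology -` (point_measures E_topology - M.mball ?O r) \<inter> space limit_intensity \<subseteq> strip t"
    proof
      fix y assume y: "y \<in> dirac E_topology -` (point_measures E_topology - M.mball ?O r) \<inter> space limit_intensity"
      show "y \<in> strip t"
      proof (rule ccontr)
        assume "y \<notin> strip t"
        then have "emeasure (dirac E_topology y) (strip t) = 0" by simp
        then show False using t y by blast
      qed
    qed
  qed simp
  also have "\<dots> < \<infinity>" by (simp add: emeasure_limit_intensity_strip)
  finally show "emeasure (xi_limit k) (point_measures E_topology - M.mball ?O r) < \<infinity>"
    by (simp add: xi_limit_alt ennreal_mult_less_top)
qed

section \<open>Moments of the marked process\<close>

text \<open>Marks are at least \<open>- a n\<close>, so a level not above \<open>- a n\<close> imposes no condition. Such levels occur in the
test functions by which measurability of the marked process is established for a given \<open>n\<close>.\<close>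

lemma emeasure_L_process_low:
  fixes \<omega> :: "(real ^ 'd) measure"
  assumes \<omega>: "\<omega> \<in> point_measures torus_topology" and k: "1 \<le> k"
    and A: "A \<in> sets (borel_of torus_topology)" and u: "a n + u \<le> 0"
  shows "emeasure (L_process k a n \<omega>) (A \<times> {ereal u..}) = (if emeasure \<omega> torus > of_nat k then emeasure \<omega> A else 0)"
proof -
  have sp: "space \<omega> = torus" using point_measures_space[OF \<omega>] by simp
  have "ereal u \<le> ereal (real n * unit_ball_volume TYPE('d)) * knn_radius k x \<omega> ^ CARD('d) - ereal (a n)" for x
  proof -
    have "0 \<le> ereal (real n * unit_ball_volume TYPE('d)) * knn_radius k x \<omega> ^ CARD('d)"
      using unit_ball_volume_pos[where 'd = 'd] knn_radius_nonneg[of k x \<omega>]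
      by (cases "knn_radius k x \<omega>") auto
    moreover have "ereal u \<le> y - ereal (a n)" if "0 \<le> y" for y using that u by (cases y) auto
    ultimately show ?thesis by blast
  qed
  then have "excess k a n \<omega> -` (A \<times> {ereal u..}) \<inter> space \<omega> = A"
    using borel_torus_subset[OF A] by (auto simp: excess_def sp)
  moreover have "excess k a n \<omega> \<in> measurable \<omega> (borel_of E_topology)"
    using excess_measurable[OF \<omega> k] measurable_cong_sets[OF point_measures_sets[OF \<omega>] refl] by blast
  ultimately show ?thesis
    using rectangle_borel_E[OF A, of u] by (simp add: L_process_alt emeasure_distr)
qed

locale knn_setting = threshold_sequence k a b + prob_space \<Omega>
  for k :: nat and a b :: "nat \<Rightarrow> real" and \<Omega> :: "'w measure" +
  fixes P :: "nat \<Rightarrow> 'w \<Rightarrow> (real ^ 'd) measure"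
  assumes poisson: "\<And>n. n \<ge> 1 \<Longrightarrow> homogeneous_poisson \<Omega> (real n) (P n)"
begin

abbreviation L :: "nat \<Rightarrow> 'w \<Rightarrow> ((real ^ 'd) \<times> ereal) measure" where
  "L n \<omega> \<equiv> L_process k a n (P n \<omega>)"

lemma torus_poisson: "1 \<le> n \<Longrightarrow> torus_poisson \<Omega> (P n) (real n)"
  by (simp add: torus_poisson_def torus_poisson_axioms_def poisson prob_space_axioms)

lemma P_configuration: "1 \<le> n \<Longrightarrow> \<omega> \<in> space \<Omega> \<Longrightarrow> P n \<omega> \<in> point_measures torus_topology"
  using torus_poisson.configuration[OF torus_poisson] .

lemma L_point_measure: "1 \<le> n \<Longrightarrow> \<omega> \<in> space \<Omega> \<Longrightarrow> L n \<omega> \<in> point_measures E_topology"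
  by (intro L_process_in_point_measures P_configuration k)

lemma L_emeasure_measurable:
  assumes n: "1 \<le> n" and A: "A \<in> sets (borel_of torus_topology)"
  shows "(\<lambda>\<omega>. emeasure (L n \<omega>) (A \<times> {ereal u..})) \<in> borel_measurable \<Omega>"
proof -
  interpret torus_poisson \<Omega> "P n" "real n" by (rule torus_poisson[OF n])
  note [measurable] = count_measurable[OF torus_sets] count_measurable[OF A] isolated_count_measurable[OF A]
  show ?thesis
  proof (cases "a n + u \<le> 0")
    case True
    have "(\<lambda>\<omega>. if emeasure (P n \<omega>) torus > of_nat k then emeasure (P n \<omega>) A else 0) \<in> borel_measurable \<Omega>" by measurable
    then show ?thesis
      by (subst measurable_cong[OF emeasure_L_process_low[where a = a and n = n and u = u, OF P_configuration[OF n] k A True]])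
  next
    case False
    let ?r = "root CARD('d) ((a n + u) / (real n * unit_ball_volume TYPE('d)))"
    have pos: "0 < (a n + u) / (real n * unit_ball_volume TYPE('d))"
      using False n unit_ball_volume_pos[where 'd = 'd] by simp
    then have r: "0 < ?r" "?r ^ CARD('d) = (a n + u) / (real n * unit_ball_volume TYPE('d))"
      by (simp_all add: real_root_gt_zero real_root_pow_pos)
    have u: "real n * unit_ball_volume TYPE('d) * ?r ^ CARD('d) = a n + u"
      unfolding r(2) using n unit_ball_volume_pos[where 'd = 'd] by simp
    have "(\<lambda>\<omega>. if emeasure (P n \<omega>) torus > of_nat k then emeasure (P n \<omega>) (A \<inter> isolated k ?r (P n \<omega>)) else 0) \<in> borel_measurable \<Omega>"
      by measurable
    then show ?thesis
      using n by (subst measurable_cong[OF emeasure_L_process[where a = a and n = n and u = u, OF P_configuration[OF n] k A _ r(1) u]]) auto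
  qed
qed

lemma L_bounds:
  assumes n: "1 \<le> n" and \<omega>: "\<omega> \<in> space \<Omega>" and A: "A \<in> sets (borel_of torus_topology)"
    and r: "0 < r" and u: "real n * unit_ball_volume TYPE('d) * r ^ CARD('d) = a n + u"
  shows "emeasure (L n \<omega>) (A \<times> {ereal u..}) \<le> emeasure (P n \<omega>) (A \<inter> isolated k r (P n \<omega>))"
    and "emeasure (P n \<omega>) (A \<inter> isolated k r (P n \<omega>)) \<le>
      emeasure (L n \<omega>) (A \<times> {ereal u..}) + of_nat k * ind_lt (Suc k) (emeasure (P n \<omega>) torus)"
proof -
  have conf: "P n \<omega> \<in> point_measures torus_topology" by (rule P_configuration[OF n \<omega>])
  have eq: "emeasure (L n \<omega>) (A \<times> {ereal u..}) =
    (if emeasure (P n \<omega>) torus > of_nat k then emeasure (P n \<omega>) (A \<inter> isolated k r (P n \<omega>)) else 0)"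
    using n by (intro emeasure_L_process[where a = a and n = n and u = u, OF conf k A _ r u]) simp
  then show "emeasure (L n \<omega>) (A \<times> {ereal u..}) \<le> emeasure (P n \<omega>) (A \<inter> isolated k r (P n \<omega>))" by simp
  show "emeasure (P n \<omega>) (A \<inter> isolated k r (P n \<omega>)) \<le>
      emeasure (L n \<omega>) (A \<times> {ereal u..}) + of_nat k * ind_lt (Suc k) (emeasure (P n \<omega>) torus)"
  proof (cases "emeasure (P n \<omega>) torus > of_nat k")
    case True then show ?thesis unfolding eq by simp
  next
    case False
    then have le: "emeasure (P n \<omega>) torus \<le> of_nat k" by simp
    have "emeasure (P n \<omega>) (A \<inter> isolated k r (P n \<omega>)) \<le> emeasure (P n \<omega>) torus"
      using torus_sets point_measures_sets[OF conf] borel_torus_subset[OF A] by (intro emeasure_mono) auto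
    moreover have "of_nat k < (of_nat (Suc k) :: ennreal)" by (simp only: of_nat_less_iff)
    then have "ind_lt (Suc k) (emeasure (P n \<omega>) torus) = 1"
      using le_less_trans[OF le] by (simp only: ind_lt_def if_True)
    ultimately show ?thesis using le False by (simp add: eq order_trans)
  qed
qed

definition mean_count_above :: "(real ^ 'd) set \<Rightarrow> real \<Rightarrow> nat \<Rightarrow> real" where
  "mean_count_above A u n = (\<integral>\<omega>. measure (L n \<omega>) (A \<times> {ereal u..}) \<partial>\<Omega>)"

lemma L_finite:
  assumes n: "1 \<le> n" and \<omega>: "\<omega> \<in> space \<Omega>" and A: "A \<in> sets (borel_of torus_topology)"
  shows "ennreal (measure (L n \<omega>) (A \<times> {ereal u..})) = emeasure (L n \<omega>) (A \<times> {ereal u..})"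
proof -
  have "emeasure (L n \<omega>) (A \<times> {ereal u..}) \<le> emeasure (L n \<omega>) (strip u)"
    using borel_torus_subset[OF A] point_measures_sets[OF L_point_measure[OF n \<omega>]]
    by (intro emeasure_mono) (auto simp: strip_def[of u, symmetric], auto simp: strip_def)
  also have "\<dots> < \<infinity>" by (rule point_measures_compact_finite[OF L_point_measure[OF n \<omega>] compactin_strip])
  finally show ?thesis by (intro emeasure_eq_ennreal_measure[symmetric]) auto
qed

lemma L_measure_measurable:
  assumes n: "1 \<le> n" and A: "A \<in> sets (borel_of torus_topology)"
  shows "(\<lambda>\<omega>. measure (L n \<omega>) (A \<times> {ereal u..})) \<in> borel_measurable \<Omega>"
  unfolding measure_def by (intro measurable_compose[OF L_emeasure_measurable[OF n A]]) measurable

text \<open>The marked process has at most as many points above the level \<open>u\<close> as there are isolated points; the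
difference comes from configurations with at most \<open>k\<close> points.\<close>

lemma mean_count_above_bounds:
  assumes A: "A \<in> sets (borel_of torus_topology)"
  shows "eventually (\<lambda>n. 1 \<le> n \<and> integrable \<Omega> (\<lambda>\<omega>. measure (L n \<omega>) (A \<times> {ereal u..})) \<and>
     mean_count_above A u n \<le> real n * vol A * pois_lt k (a n + u) \<and>
     real n * vol A * pois_lt k (a n + u) \<le> mean_count_above A u n + real k * pois_lt (Suc k) (real n)) sequentially"
  using radius_properties[where u = u and T = "TYPE('d)"]
proof eventually_elim
  case (elim n)
  define r where "r = radius TYPE('d) u n"
  have n: "1 \<le> n" and r: "0 < r" "r \<le> 1 / 8" and u: "real n * unit_ball_volume TYPE('d) * r ^ CARD('d) = a n + u"
    using elim by (auto simp: r_def)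
  interpret torus_poisson \<Omega> "P n" "real n" by (rule torus_poisson[OF n])
  have au: "0 \<le> a n + u" unfolding u[symmetric] using r unit_ball_volume_pos[where 'd = 'd] by simp
  note Lm = L_emeasure_measurable[OF n A, of u]
  note [measurable] = count_measurable[OF torus_sets] Lm
  let ?E = "\<integral>\<^sup>+\<omega>. emeasure (L n \<omega>) (A \<times> {ereal u..}) \<partial>\<Omega>"
  let ?R = "real n * vol A * pois_lt k (a n + u)"
  have iso: "(\<integral>\<^sup>+\<omega>. emeasure (P n \<omega>) (A \<inter> isolated k r (P n \<omega>)) \<partial>\<Omega>) = ennreal ?R"
    using mean_isolated_count[OF A r(1)] r(2) u by simp
  have le: "?E \<le> ennreal ?R"
    unfolding iso[symmetric] by (intro nn_integral_mono L_bounds(1)[OF n _ A r(1) u])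
  have ge: "ennreal ?R \<le> ?E + ennreal (real k * pois_lt (Suc k) (real n))"
  proof -
    have "ennreal ?R \<le> (\<integral>\<^sup>+\<omega>. emeasure (L n \<omega>) (A \<times> {ereal u..}) + of_nat k * ind_lt (Suc k) (emeasure (P n \<omega>) torus) \<partial>\<Omega>)"
      unfolding iso[symmetric] by (intro nn_integral_mono L_bounds(2)[OF n _ A r(1) u])
    also have "\<dots> = ?E + of_nat k * (\<integral>\<^sup>+\<omega>. ind_lt (Suc k) (emeasure (P n \<omega>) torus) \<partial>\<Omega>)"
      by (subst nn_integral_add) (auto simp: nn_integral_cmult)
    also have "\<dots> = ?E + ennreal (real k * pois_lt (Suc k) (real n))"
      by (simp add: prob_count_lt[OF torus_sets] vol_torus ennreal_mult pois_lt_nonneg ennreal_of_nat_eq_real_of_nat)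
    finally show ?thesis .
  qed
  have eqE: "(\<integral>\<^sup>+\<omega>. ennreal (measure (L n \<omega>) (A \<times> {ereal u..})) \<partial>\<Omega>) = ?E"
    by (intro nn_integral_cong L_finite[OF n _ A])
  have fin: "?E < \<infinity>" using le by (rule le_less_trans) simp
  have mean: "mean_count_above A u n = enn2real ?E"
    unfolding mean_count_above_def eqE[symmetric]
    using L_measure_measurable[OF n A] by (intro integral_eq_nn_integral) auto
  have int: "integrable \<Omega> (\<lambda>\<omega>. measure (L n \<omega>) (A \<times> {ereal u..}))"
    using L_measure_measurable[OF n A] fin eqE by (intro integrableI_nonneg) auto
  have R0: "0 \<le> ?R" using au by (simp add: pois_lt_nonneg)
  have "ennreal (enn2real ?E) = ?E" using fin by simp
  then have Em: "?E = ennreal (mean_count_above A u n)" unfolding mean by simp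
  have m0: "0 \<le> mean_count_above A u n" unfolding mean by simp
  have "mean_count_above A u n \<le> ?R" using le R0 unfolding Em by simp
  moreover have "?R \<le> mean_count_above A u n + real k * pois_lt (Suc k) (real n)"
    using ge m0 unfolding Em by (simp add: ennreal_plus[symmetric] pois_lt_nonneg del: ennreal_plus)
  ultimately show ?case using n int by blast
qed

lemma mean_count_above_limit:
  assumes A: "A \<in> sets (borel_of torus_topology)"
  shows "(\<lambda>n. mean_count_above A u n / b n) \<longlonglongrightarrow> vol A * exp (- u) / fact (k - 1)"
proof (rule tendsto_sandwich[where f = "\<lambda>n. vol A * (real n * pois_lt k (a n + u) / b n) - real k * (pois_lt (Suc k) (real n) / b n)"
      and h = "\<lambda>n. vol A * (real n * pois_lt k (a n + u) / b n)"])
  have i: "(\<lambda>n. vol A * (real n * pois_lt k (a n + u) / b n)) \<longlonglongrightarrow> vol A * (exp (- u) / fact (k - 1))"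
    by (intro tendsto_intros intensity_ratio)
  then show "(\<lambda>n. vol A * (real n * pois_lt k (a n + u) / b n)) \<longlonglongrightarrow> vol A * exp (- u) / fact (k - 1)" by simp
  have "(\<lambda>n. vol A * (real n * pois_lt k (a n + u) / b n) - real k * (pois_lt (Suc k) (real n) / b n))
      \<longlonglongrightarrow> vol A * (exp (- u) / fact (k - 1)) - real k * 0"
    by (intro tendsto_diff i tendsto_mult tendsto_const few_points_ratio)
  then show "(\<lambda>n. vol A * (real n * pois_lt k (a n + u) / b n) - real k * (pois_lt (Suc k) (real n) / b n))
      \<longlonglongrightarrow> vol A * exp (- u) / fact (k - 1)" by simp
  show "eventually (\<lambda>n. mean_count_above A u n / b n \<le> vol A * (real n * pois_lt k (a n + u) / b n)) sequentially"
    using mean_count_above_bounds[OF A, of u] eventually_b_pos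
  proof eventually_elim
    case (elim n)
    then have "mean_count_above A u n / b n \<le> real n * vol A * pois_lt k (a n + u) / b n"
      by (intro divide_right_mono) auto
    then show ?case by (simp add: mult_ac)
  qed
  show "eventually (\<lambda>n. vol A * (real n * pois_lt k (a n + u) / b n) - real k * (pois_lt (Suc k) (real n) / b n) \<le> mean_count_above A u n / b n) sequentially"
    using mean_count_above_bounds[OF A, of u] eventually_b_pos
  proof eventually_elim
    case (elim n)
    then have "real n * vol A * pois_lt k (a n + u) / b n \<le> (mean_count_above A u n + real k * pois_lt (Suc k) (real n)) / b n"
      by (intro divide_right_mono) auto
    then show ?case by (simp add: mult_ac add_divide_distrib)
  qed
qed

definition mean_multiple :: "real \<Rightarrow> nat \<Rightarrow> real" where
  "mean_multiple u n = (\<integral>\<omega>. enn2real (ge2 (emeasure (L n \<omega>) (strip u))) \<partial>\<Omega>)"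

lemma ge2_mono: "x \<le> y \<Longrightarrow> ge2 x \<le> ge2 y"
  by (auto simp: ge2_def)

lemma mean_multiple_bound:
  assumes e: "0 < e" "e \<le> 1 / 2"
  shows "eventually (\<lambda>n. integrable \<Omega> (\<lambda>\<omega>. enn2real (ge2 (emeasure (L n \<omega>) (strip u)))) \<and> 0 \<le> mean_multiple u n \<and>
     mean_multiple u n \<le> real n * (e ^ CARD('d) * (a n + u) * pois_lt (k - 1) (a n + u) +
      2 ^ CARD('d) * (a n + u) * pois_lt k (a n + u) * pois_lt k ((a n + u) * e / 4)) + (real n * pois_lt k (a n + u))\<^sup>2) sequentially"
  using radius_properties[where u = u and T = "TYPE('d)"]
proof eventually_elim
  case (elim n)
  define r where "r = radius TYPE('d) u n"
  have n: "1 \<le> n" and r: "0 < r" "r \<le> 1 / 8" and u: "real n * unit_ball_volume TYPE('d) * r ^ CARD('d) = a n + u"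
    using elim by (auto simp: r_def)
  interpret torus_poisson \<Omega> "P n" "real n" by (rule torus_poisson[OF n])
  have au: "0 \<le> a n + u" unfolding u[symmetric] using r unit_ball_volume_pos[where 'd = 'd] by simp
  let ?R = "real n * (e ^ CARD('d) * (a n + u) * pois_lt (k - 1) (a n + u) +
      2 ^ CARD('d) * (a n + u) * pois_lt k (a n + u) * pois_lt k ((a n + u) * e / 4)) + (real n * pois_lt k (a n + u))\<^sup>2"
  have "0 \<le> real n * (e ^ CARD('d) * x * pois_lt (k - 1) x + 2 ^ CARD('d) * x * pois_lt k x * pois_lt k (x * e / 4)) +
      (real n * pois_lt k x)\<^sup>2" if "0 \<le> x" for x
    using that e by (intro add_nonneg_nonneg mult_nonneg_nonneg pois_lt_nonneg) auto
  from this[OF au] have R0: "0 \<le> ?R" .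
  have Lm [measurable]: "(\<lambda>\<omega>. emeasure (L n \<omega>) (strip u)) \<in> borel_measurable \<Omega>"
    using L_emeasure_measurable[OF n torus_sets, of u] by (simp add: strip_def)
  have "(\<integral>\<^sup>+\<omega>. ge2 (emeasure (L n \<omega>) (strip u)) \<partial>\<Omega>) \<le> (\<integral>\<^sup>+\<omega>. ge2 (emeasure (P n \<omega>) (isolated k r (P n \<omega>))) \<partial>\<Omega>)"
  proof (intro nn_integral_mono ge2_mono)
    fix \<omega> assume "\<omega> \<in> space \<Omega>"
    from L_bounds(1)[OF n this torus_sets r(1) u]
    show "emeasure (L n \<omega>) (strip u) \<le> emeasure (P n \<omega>) (isolated k r (P n \<omega>))"
      by (simp add: strip_def Int_absorb1 isolated_def subset_iff)
  qed
  also have "\<dots> \<le> ennreal ?R"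
    using mean_isolated_pairs[OF r e, of k] unfolding u by simp
  finally have le: "(\<integral>\<^sup>+\<omega>. ge2 (emeasure (L n \<omega>) (strip u)) \<partial>\<Omega>) \<le> ennreal ?R" .
  have eqE: "(\<integral>\<^sup>+\<omega>. ennreal (enn2real (ge2 (emeasure (L n \<omega>) (strip u)))) \<partial>\<Omega>) = (\<integral>\<^sup>+\<omega>. ge2 (emeasure (L n \<omega>) (strip u)) \<partial>\<Omega>)"
  proof (rule nn_integral_cong)
    fix \<omega> assume \<omega>: "\<omega> \<in> space \<Omega>"
    have "emeasure (L n \<omega>) (strip u) < \<infinity>"
      by (rule point_measures_compact_finite[OF L_point_measure[OF n \<omega>] compactin_strip])
    then show "ennreal (enn2real (ge2 (emeasure (L n \<omega>) (strip u)))) = ge2 (emeasure (L n \<omega>) (strip u))"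
      by (simp add: ge2_def)
  qed
  have m: "(\<lambda>\<omega>. enn2real (ge2 (emeasure (L n \<omega>) (strip u)))) \<in> borel_measurable \<Omega>" by measurable
  have fin: "(\<integral>\<^sup>+\<omega>. ge2 (emeasure (L n \<omega>) (strip u)) \<partial>\<Omega>) < \<infinity>" using le by (rule le_less_trans) simp
  have mean: "mean_multiple u n = enn2real (\<integral>\<^sup>+\<omega>. ge2 (emeasure (L n \<omega>) (strip u)) \<partial>\<Omega>)"
    unfolding mean_multiple_def eqE[symmetric] using m by (intro integral_eq_nn_integral) auto
  have "integrable \<Omega> (\<lambda>\<omega>. enn2real (ge2 (emeasure (L n \<omega>) (strip u))))"
    using m fin eqE by (intro integrableI_nonneg) auto
  moreover have "mean_multiple u n \<le> ?R" unfolding mean using le R0 by (rule enn2real_leI[rotated])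
  moreover have "0 \<le> mean_multiple u n" unfolding mean by simp
  ultimately show ?case by blast
qed

text \<open>After division by \<open>b n\<close> the bound on pairs tends to \<open>e ^ d * C\<close> with \<open>C\<close> independent of \<open>e\<close>, and \<open>e\<close>
can be chosen arbitrarily small.\<close>

lemma mean_multiple_limit: "(\<lambda>n. mean_multiple u n / b n) \<longlonglongrightarrow> 0"
proof (rule LIMSEQ_I)
  fix \<epsilon> :: real assume \<epsilon>: "0 < \<epsilon>"
  obtain C where C: "(\<lambda>n. real n * ((a n + u) * pois_lt (k - 1) (a n + u)) / b n) \<longlonglongrightarrow> C"
    using close_pairs_ratio by blast
  \<comment> \<open>This choice makes \<open>e * \<bar>C\<bar>\<close> at most \<open>\<epsilon> / 2\<close>.\<close>
  define e where "e = min (1 / 2) (\<epsilon> / (2 * (\<bar>C\<bar> + 1)))"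
  have e: "0 < e" "e \<le> 1 / 2" using \<epsilon> unfolding e_def by simp (rule min.cobounded1)
  obtain C' where C': "(\<lambda>n. (real n * (e ^ CARD('d) * (a n + u) * pois_lt (k - 1) (a n + u) +
      2 ^ CARD('d) * (a n + u) * pois_lt k (a n + u) * pois_lt k ((a n + u) * e / 4)) + (real n * pois_lt k (a n + u))\<^sup>2) / b n)
    \<longlonglongrightarrow> e ^ CARD('d) * C'" "(\<lambda>n. real n * ((a n + u) * pois_lt (k - 1) (a n + u)) / b n) \<longlonglongrightarrow> C'"
    by (rule pairs_ratio[OF e(1)])
  have "C' = C" by (rule LIMSEQ_unique[OF C'(2) C])
  have "e ^ CARD('d) \<le> e ^ 1" using e by (intro power_decreasing) (auto simp: Suc_le_eq)
  then have "e ^ CARD('d) * C' \<le> e * \<bar>C\<bar>"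
    unfolding \<open>C' = C\<close> using e by (intro order_trans[OF mult_left_mono[OF abs_ge_self] mult_right_mono]) auto
  also have "\<dots> \<le> \<epsilon> / (2 * (\<bar>C\<bar> + 1)) * (\<bar>C\<bar> + 1)" using \<epsilon> e by (intro mult_mono) (auto simp: e_def)
  also have "\<dots> = \<epsilon> / 2" by (simp add: field_simps add_pos_nonneg)
  also have "\<dots> < \<epsilon>" using \<epsilon> by simp
  finally have "e ^ CARD('d) * C' < \<epsilon>" .
  from order_tendstoD(2)[OF C'(1) this] mean_multiple_bound[OF e, of u] eventually_b_pos
  have "eventually (\<lambda>n. norm (mean_multiple u n / b n - 0) < \<epsilon>) sequentially"
  proof eventually_elim
    case (elim n)
    have "mean_multiple u n / b n \<le> (real n * (e ^ CARD('d) * (a n + u) * pois_lt (k - 1) (a n + u) +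
      2 ^ CARD('d) * (a n + u) * pois_lt k (a n + u) * pois_lt k ((a n + u) * e / 4)) + (real n * pois_lt k (a n + u))\<^sup>2) / b n"
      using elim(2,3) by (intro divide_right_mono) auto
    moreover have "0 \<le> mean_multiple u n / b n" using elim(2,3) by simp
    ultimately show ?case using elim(1) by simp
  qed
  then show "\<exists>N. \<forall>n\<ge>N. norm (mean_multiple u n / b n - 0) < \<epsilon>" by (simp add: eventually_sequentially)
qed

end

section \<open>Convergence\<close>

context knn_setting
begin

lemma L_integral_approx:
  fixes f :: "(real ^ 'd) \<times> ereal \<Rightarrow> real"
  assumes n: "1 \<le> n" and f: "continuous_map E_topology euclideanreal f"
    and f0: "\<forall>y\<in>topspace E_topology - strip s. f y = 0" and \<eta>: "0 < \<eta>"
  shows "\<exists>S\<in>borel_measurable \<Omega>. \<forall>\<omega>\<in>space \<Omega>. \<bar>(\<integral>y. f y \<partial>L n \<omega>) - S \<omega>\<bar> \<le> \<eta> * measure (L n \<omega>) (strip s)"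
proof -
  obtain J :: "((real ^ 'd) \<times> nat) set" and c A u where J: "finite J"
    "\<forall>j\<in>J. A j \<in> sets (borel_of torus_topology) \<and> s \<le> u j"
    "\<forall>y\<in>topspace E_topology. \<bar>f y - (\<Sum>j\<in>J. c j * indicator (A j \<times> {ereal (u j)..}) y)\<bar> \<le> \<eta> * indicator (strip s) y"
    using step_approximation[OF f f0 \<eta>] by blast
  have "(\<lambda>\<omega>. \<Sum>j\<in>J. c j * measure (L n \<omega>) (A j \<times> {ereal (u j)..})) \<in> borel_measurable \<Omega>"
    using J(2) L_measure_measurable[OF n] by (intro borel_measurable_sum borel_measurable_times borel_measurable_const) auto
  then show ?thesis
  proof (rule bexI[rotated], intro ballI)
    fix \<omega> assume \<omega>: "\<omega> \<in> space \<Omega>"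
    note Lp = L_point_measure[OF n \<omega>]
    show "\<bar>(\<integral>y. f y \<partial>L n \<omega>) - (\<Sum>j\<in>J. c j * measure (L n \<omega>) (A j \<times> {ereal (u j)..}))\<bar> \<le> \<eta> * measure (L n \<omega>) (strip s)"
      by (rule step_integral(2)[OF point_measures_sets[OF Lp] point_measures_compact_finite[OF Lp compactin_strip]
            borel_measurable_continuous_map[OF f] J])
  qed
qed

text \<open>Integrals of test functions are limits of integrals of step functions, and the latter are
combinations of counts of isolated points.\<close>

lemma L_measurable:
  assumes vm: "vague_metric (E_topology :: ((real ^ 'd) \<times> ereal) topology) \<rho>" and n: "1 \<le> n"
  shows "L n \<in> measurable \<Omega> (borel_of (vague_topology E_topology))"
proof (rule measurable_vagueI[OF vm L_point_measure[OF n]])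
  fix f :: "(real ^ 'd) \<times> ereal \<Rightarrow> real" assume f: "f \<in> Cc_nonneg E_topology"
  obtain s where s: "\<forall>y\<in>topspace E_topology - strip s. f y = 0" using Cc_nonneg_support_strip[OF f] by blast
  have "\<forall>m. \<exists>S. S \<in> borel_measurable \<Omega> \<and> (\<forall>\<omega>\<in>space \<Omega>. \<bar>(\<integral>y. f y \<partial>L n \<omega>) - S \<omega>\<bar> \<le> 1 / real (Suc m) * measure (L n \<omega>) (strip s))"
  proof
    fix m
    show "\<exists>S. S \<in> borel_measurable \<Omega> \<and> (\<forall>\<omega>\<in>space \<Omega>. \<bar>(\<integral>y. f y \<partial>L n \<omega>) - S \<omega>\<bar> \<le> 1 / real (Suc m) * measure (L n \<omega>) (strip s))"
      using L_integral_approx[OF n Cc_nonneg_continuous[OF f] s, of "1 / real (Suc m)"] by auto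
  qed
  then obtain S where S: "\<forall>m. S m \<in> borel_measurable \<Omega> \<and>
      (\<forall>\<omega>\<in>space \<Omega>. \<bar>(\<integral>y. f y \<partial>L n \<omega>) - S m \<omega>\<bar> \<le> 1 / real (Suc m) * measure (L n \<omega>) (strip s))"
    by (rule choice[THEN exE])
  show "(\<lambda>\<omega>. \<integral>y. f y \<partial>L n \<omega>) \<in> borel_measurable \<Omega>"
  proof (rule borel_measurable_LIMSEQ_real[of \<Omega> S])
    fix \<omega> assume \<omega>: "\<omega> \<in> space \<Omega>"
    have "(\<lambda>m. 1 / real (Suc m) * measure (L n \<omega>) (strip s)) \<longlonglongrightarrow> 0 * measure (L n \<omega>) (strip s)"
      by (intro tendsto_intros mesh_tendsto)
    then have lim: "(\<lambda>m. 1 / real (Suc m) * measure (L n \<omega>) (strip s)) \<longlonglongrightarrow> 0" by simp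
    have "(\<lambda>m. S m \<omega> - (\<integral>y. f y \<partial>L n \<omega>)) \<longlonglongrightarrow> 0"
    proof (rule Lim_null_comparison[OF _ lim], intro always_eventually allI)
      fix m
      show "norm (S m \<omega> - (\<integral>y. f y \<partial>L n \<omega>)) \<le> 1 / real (Suc m) * measure (L n \<omega>) (strip s)"
        unfolding real_norm_def by (subst abs_minus_commute) (use S \<omega> in blast)
    qed
    then show "(\<lambda>m. S m \<omega>) \<longlonglongrightarrow> (\<integral>y. f y \<partial>L n \<omega>)" by (rule LIM_zero_cancel)
  qed (use S in blast)
qed

text \<open>On each path, \<open>g (L n \<omega>)\<close> differs from the sum of \<open>g (dirac y)\<close> over the atoms \<open>y\<close> by little, except
when there are several atoms in a strip. The sum is replaced by a combination of counts in
rectangles, whose means are known; the same combination approximates the limit.\<close>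

lemma mean_test_function_limit:
  fixes g :: "((real ^ 'd) \<times> ereal) measure \<Rightarrow> real"
  assumes vm: "vague_metric (E_topology :: ((real ^ 'd) \<times> ereal) topology) \<rho>" and g: "g \<in> C0 E_topology"
  shows "(\<lambda>n. (\<integral>\<omega>. g (L n \<omega>) \<partial>\<Omega>) / b n) \<longlonglongrightarrow>
    1 / fact (k - 1) * (\<integral>y. g (dirac E_topology y) \<partial>limit_intensity)"
proof (rule LIMSEQ_I)
  fix \<epsilon> :: real assume \<epsilon>: "0 < \<epsilon>"
  have gc: "continuous_map (vague_topology E_topology) euclideanreal g" using g by (simp add: C0_def)
  obtain B where B: "\<forall>\<mu>\<in>point_measures E_topology. \<bar>g \<mu>\<bar> \<le> B" using g by (auto simp: C0_def)
  obtain U where U: "openin (vague_topology E_topology) U" "null_measure (borel_of E_topology) \<in> U" "\<forall>\<mu>\<in>U. g \<mu> = 0"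
    using g unfolding C0_def by blast
  obtain s where s: "\<forall>\<mu>\<in>point_measures E_topology. emeasure \<mu> (strip s) = 0 \<longrightarrow> \<mu> \<in> U"
    using vague_nbhd_null[OF U(1,2)] by blast
  have g0: "\<forall>\<mu>\<in>point_measures E_topology. emeasure \<mu> (strip s) = 0 \<longrightarrow> g \<mu> = 0" using s U(3) by blast
  have B0: "0 \<le> B" using B null_in_point_measures by force
  define h where "h = (\<lambda>y. g (dirac E_topology y))"
  have hc: "continuous_map E_topology euclideanreal h"
    unfolding h_def by (rule continuous_map_compose[OF continuous_map_dirac gc, unfolded comp_def])
  have hm: "h \<in> borel_measurable (borel_of E_topology)" by (rule borel_measurable_continuous_map[OF hc])
  have h0: "\<forall>y\<in>topspace E_topology - strip s. h y = 0"
  proof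
    fix y :: "(real ^ 'd) \<times> ereal" assume y: "y \<in> topspace E_topology - strip s"
    then have "dirac E_topology y \<in> point_measures E_topology" by (intro dirac_in_point_measures) blast
    moreover have "emeasure (dirac E_topology y) (strip s) = 0" using y by simp
    ultimately show "h y = 0" unfolding h_def using g0 by blast
  qed
  define F where "F = fact (k - 1) * exp s"
  have F: "0 < F" by (simp add: F_def)
  \<comment> \<open>Here \<open>1 / F\<close> is the limiting mass of the strip. The errors add up to \<open>3 * \<eta> / F\<close>, of which
  \<open>2 * \<eta> / F\<close> come from the paths and \<open>\<eta> / F\<close> from the limit.\<close>
  define \<eta> where "\<eta> = \<epsilon> * F / 6"
  have \<eta>: "0 < \<eta>" using \<epsilon> F by (simp add: \<eta>_def)
  obtain t where ts: "t \<le> s" and loc: "\<forall>y\<in>strip s. \<forall>\<mu>\<in>point_measures E_topology.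
     emeasure \<mu> {y} = 1 \<and> emeasure \<mu> (strip t - {y}) = 0 \<longrightarrow> \<bar>g \<mu> - g (dirac E_topology y)\<bar> \<le> \<eta>"
    using uniform_locality[OF gc \<eta>, of s] by blast
  obtain J :: "((real ^ 'd) \<times> nat) set" and c A u where J: "finite J"
    "\<forall>j\<in>J. A j \<in> sets (borel_of torus_topology) \<and> s \<le> u j"
    "\<forall>y\<in>topspace E_topology. \<bar>h y - (\<Sum>j\<in>J. c j * indicator (A j \<times> {ereal (u j)..}) y)\<bar> \<le> \<eta> * indicator (strip s) y"
    using step_approximation[OF hc h0 \<eta>] by blast
  define I where "I = 1 / fact (k - 1) * (\<integral>y. h y \<partial>limit_intensity)"
  define S where "S n = (\<Sum>j\<in>J. c j * mean_count_above (A j) (u j) n)" for n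
  define Sl where "Sl = (\<Sum>j\<in>J. c j * (vol (A j) * exp (- u j) / fact (k - 1)))"
  have Slim: "(\<lambda>n. S n / b n) \<longlonglongrightarrow> Sl"
    unfolding S_def Sl_def sum_divide_distrib times_divide_eq_right[symmetric]
    using J(2) mean_count_above_limit
    by (intro tendsto_sum tendsto_mult tendsto_const) (auto simp: times_divide_eq_right)
  have Mlim: "(\<lambda>n. mean_count_above torus s n / b n) \<longlonglongrightarrow> 1 / F"
    using mean_count_above_limit[OF torus_sets, of s] by (simp add: vol_torus F_def exp_minus field_simps)
  have IS: "\<bar>I - Sl\<bar> \<le> \<eta> / F"
  proof -
    let ?\<Lambda> = "limit_intensity :: ((real ^ 'd) \<times> ereal) measure"
    have "\<bar>(\<integral>y. h y \<partial>?\<Lambda>) - (\<Sum>j\<in>J. c j * measure ?\<Lambda> (A j \<times> {ereal (u j)..}))\<bar> \<le> \<eta> * measure ?\<Lambda> (strip s)"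
      by (rule step_integral(2)[OF sets_limit_intensity _ hm J]) (simp add: emeasure_limit_intensity_strip)
    moreover have "measure ?\<Lambda> (strip s) = exp (- s)" by (simp add: measure_def emeasure_limit_intensity_strip)
    moreover have "(\<Sum>j\<in>J. c j * measure ?\<Lambda> (A j \<times> {ereal (u j)..})) = fact (k - 1) * Sl"
      unfolding Sl_def sum_distrib_left
      using J(2) by (intro sum.cong refl) (simp add: measure_def[of ?\<Lambda>] emeasure_limit_intensity)
    moreover have "(\<integral>y. h y \<partial>?\<Lambda>) = fact (k - 1) * I" by (simp add: I_def)
    ultimately have "\<bar>fact (k - 1) * (I - Sl)\<bar> \<le> \<eta> * exp (- s)" by (simp add: right_diff_distrib)
    then have "fact (k - 1) * \<bar>I - Sl\<bar> \<le> \<eta> * exp (- s)" by (simp add: abs_mult)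
    then show ?thesis by (simp add: F_def exp_minus field_simps)
  qed
  have ES: "eventually (\<lambda>n. \<bar>(\<integral>\<omega>. g (L n \<omega>) \<partial>\<Omega>) - S n\<bar> \<le> 2 * \<eta> * mean_count_above torus s n + 2 * B * mean_multiple t n) sequentially"
  proof -
    have "eventually (\<lambda>n. \<forall>j\<in>J. integrable \<Omega> (\<lambda>\<omega>. measure (L n \<omega>) (A j \<times> {ereal (u j)..}))) sequentially"
    proof (unfold eventually_ball_finite_distrib[OF J(1)], intro ballI)
      fix j assume "j \<in> J"
      then have "A j \<in> sets (borel_of torus_topology)" using J(2) by blast
      from mean_count_above_bounds[OF this, of "u j"]
      show "eventually (\<lambda>n. integrable \<Omega> (\<lambda>\<omega>. measure (L n \<omega>) (A j \<times> {ereal (u j)..}))) sequentially"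
        by (rule eventually_mono) blast
    qed
    moreover have "eventually (\<lambda>n. integrable \<Omega> (\<lambda>\<omega>. enn2real (ge2 (emeasure (L n \<omega>) (strip t))))) sequentially"
      by (rule eventually_mono[OF mean_multiple_bound[of "1 / 2" t]]) auto
    ultimately show ?thesis
      using mean_count_above_bounds[OF torus_sets, of s]
    proof eventually_elim
      case (elim n)
      have n: "1 \<le> n" and intM: "integrable \<Omega> (\<lambda>\<omega>. measure (L n \<omega>) (strip s))" using elim(3) by (auto simp: strip_def)
      have Lm: "L n \<in> measurable \<Omega> (borel_of (vague_topology E_topology))" by (rule L_measurable[OF vm n])
      have gm: "(\<lambda>\<omega>. g (L n \<omega>)) \<in> borel_measurable \<Omega>"
        by (rule measurable_compose[OF Lm borel_measurable_continuous_map[OF gc]])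
      have intg: "integrable \<Omega> (\<lambda>\<omega>. g (L n \<omega>))"
        using gm B L_point_measure[OF n] by (intro integrable_const_bound[where B = B] AE_I2) auto
      have intS: "integrable \<Omega> (\<lambda>\<omega>. \<Sum>j\<in>J. c j * measure (L n \<omega>) (A j \<times> {ereal (u j)..}))"
        using elim(1) by (intro Bochner_Integration.integrable_sum integrable_mult_right) auto
      have S: "S n = (\<integral>\<omega>. (\<Sum>j\<in>J. c j * measure (L n \<omega>) (A j \<times> {ereal (u j)..})) \<partial>\<Omega>)"
        unfolding S_def mean_count_above_def
        using elim(1) by (subst Bochner_Integration.integral_sum) auto
      have intR: "integrable \<Omega> (\<lambda>\<omega>. 2 * \<eta> * measure (L n \<omega>) (strip s) + 2 * B * enn2real (ge2 (emeasure (L n \<omega>) (strip t))))"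
        by (intro Bochner_Integration.integrable_add integrable_mult_right intM elim(2))
      have bound: "\<bar>g (L n \<omega>) - (\<Sum>j\<in>J. c j * measure (L n \<omega>) (A j \<times> {ereal (u j)..}))\<bar> \<le>
          2 * \<eta> * measure (L n \<omega>) (strip s) + 2 * B * enn2real (ge2 (emeasure (L n \<omega>) (strip t)))" if \<omega>: "\<omega> \<in> space \<Omega>" for \<omega>
      proof -
        note Lp = L_point_measure[OF n \<omega>]
        have "\<bar>(\<integral>y. h y \<partial>L n \<omega>) - (\<Sum>j\<in>J. c j * measure (L n \<omega>) (A j \<times> {ereal (u j)..}))\<bar> \<le> \<eta> * measure (L n \<omega>) (strip s)"
          by (rule step_integral(2)[OF point_measures_sets[OF Lp] point_measures_compact_finite[OF Lp compactin_strip] hm J])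
        moreover have "\<bar>g (L n \<omega>) - (\<integral>y. h y \<partial>L n \<omega>)\<bar> \<le> \<eta> * measure (L n \<omega>) (strip s) + 2 * B * enn2real (ge2 (emeasure (L n \<omega>) (strip t)))"
          by (rule pathwise_bound[OF Lp B g0 ts \<eta> loc h_def hm])
        ultimately show ?thesis by linarith
      qed
      have "\<bar>(\<integral>\<omega>. g (L n \<omega>) \<partial>\<Omega>) - S n\<bar> = \<bar>\<integral>\<omega>. g (L n \<omega>) - (\<Sum>j\<in>J. c j * measure (L n \<omega>) (A j \<times> {ereal (u j)..})) \<partial>\<Omega>\<bar>"
        unfolding S by (simp only: Bochner_Integration.integral_diff[OF intg intS])
      also have "\<dots> \<le> (\<integral>\<omega>. \<bar>g (L n \<omega>) - (\<Sum>j\<in>J. c j * measure (L n \<omega>) (A j \<times> {ereal (u j)..}))\<bar> \<partial>\<Omega>)"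
        by (rule integral_abs_bound)
      also have "\<dots> \<le> (\<integral>\<omega>. 2 * \<eta> * measure (L n \<omega>) (strip s) + 2 * B * enn2real (ge2 (emeasure (L n \<omega>) (strip t))) \<partial>\<Omega>)"
        by (intro integral_mono integrable_abs Bochner_Integration.integrable_diff intg intS intR bound)
      also have "\<dots> = 2 * \<eta> * mean_count_above torus s n + 2 * B * mean_multiple t n"
        unfolding mean_count_above_def mean_multiple_def strip_def[of s, symmetric]
        using intM elim(2) by simp
      finally show ?case .
    qed
  qed
  have "(\<lambda>n. \<bar>S n / b n - Sl\<bar> + 2 * \<eta> * (mean_count_above torus s n / b n) + 2 * B * (mean_multiple t n / b n))
      \<longlonglongrightarrow> \<bar>Sl - Sl\<bar> + 2 * \<eta> * (1 / F) + 2 * B * 0"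
    by (intro tendsto_intros Slim Mlim mean_multiple_limit)
  moreover have "\<bar>Sl - Sl\<bar> + 2 * \<eta> * (1 / F) + 2 * B * 0 < \<epsilon> - \<eta> / F"
    using F \<epsilon> by (simp add: \<eta>_def)
  ultimately have "eventually (\<lambda>n. \<bar>S n / b n - Sl\<bar> + 2 * \<eta> * (mean_count_above torus s n / b n) + 2 * B * (mean_multiple t n / b n)
      < \<epsilon> - \<eta> / F) sequentially" by (rule order_tendstoD(2))
  then have "eventually (\<lambda>n. norm ((\<integral>\<omega>. g (L n \<omega>) \<partial>\<Omega>) / b n - I) < \<epsilon>) sequentially"
    using ES eventually_b_pos
  proof eventually_elim
    case (elim n)
    have "\<bar>(\<integral>\<omega>. g (L n \<omega>) \<partial>\<Omega>) / b n - S n / b n\<bar> = \<bar>(\<integral>\<omega>. g (L n \<omega>) \<partial>\<Omega>) - S n\<bar> / b n"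
      using elim(3) by (simp add: diff_divide_distrib[symmetric] abs_divide)
    also have "\<dots> \<le> (2 * \<eta> * mean_count_above torus s n + 2 * B * mean_multiple t n) / b n"
      using elim(2,3) by (intro divide_right_mono) auto
    also have "\<dots> = 2 * \<eta> * (mean_count_above torus s n / b n) + 2 * B * (mean_multiple t n / b n)"
      by (simp add: add_divide_distrib)
    finally show ?case using elim(1) IS unfolding real_norm_def by linarith
  qed
  then show "\<exists>N. \<forall>n\<ge>N. norm ((\<integral>\<omega>. g (L n \<omega>) \<partial>\<Omega>) / b n - 1 / fact (k - 1) * (\<integral>y. g (dirac E_topology y) \<partial>limit_intensity)) < \<epsilon>"
    unfolding I_def h_def by (simp add: eventually_sequentially)
qed

end

theorem theorem3p1:
  fixes \<Omega> :: "'w measure"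
    and P :: "nat \<Rightarrow> 'w \<Rightarrow> (real ^ 'd) measure"
    and \<rho> :: "((real ^ 'd) \<times> ereal) measure \<Rightarrow> ((real ^ 'd) \<times> ereal) measure \<Rightarrow> real"
    and k :: nat
    and a b :: "nat \<Rightarrow> real"
  assumes "k \<ge> 1"
    and "prob_space \<Omega>"
    and "\<And>n. n \<ge> 1 \<Longrightarrow> homogeneous_poisson \<Omega> (real n) (P n)"
    and "vague_metric E_topology \<rho>"
    and "filterlim (\<lambda>n. a n - ln (real n) - (real k - 1) * ln (ln (real n))) at_top sequentially"
    and "a \<in> o(\<lambda>n. real n)"
    and "\<And>n. n \<ge> 1 \<Longrightarrow> b n = real n * a n ^ (k - 1) * exp (- a n)"
  shows "tendsto_M0 E_topology \<rho>
           (\<lambda>n. scale_measure (ennreal (1 / b n))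
                  (distr \<Omega> (borel_of (vague_topology E_topology)) (\<lambda>\<omega>. L_process k a n (P n \<omega>))))
           (xi_limit k)"
proof -
  interpret prob_space \<Omega> by fact
  interpret knn_setting k a b \<Omega> P
    by unfold_locales (use assms in auto)
  let ?V = "borel_of (vague_topology (E_topology :: ((real ^ 'd) \<times> ereal) topology))"
  let ?\<xi> = "\<lambda>n. scale_measure (ennreal (1 / b n)) (distr \<Omega> ?V (L n))"
  have "?\<xi> n \<in> M0 E_topology \<rho>" if n: "1 \<le> n" for n
    unfolding M0_def
  proof (intro CollectI conjI allI impI)
    interpret D: prob_space "distr \<Omega> ?V (L n)"
      by (rule prob_space_distr[OF L_measurable[OF assms(4) n]])
    fix X
    have "emeasure (distr \<Omega> ?V (L n)) X < \<top>"
      using D.emeasure_finite[of X] by (simp only: top.not_eq_extremum)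
    then show "emeasure (?\<xi> n) X < \<infinity>" by (simp add: ennreal_mult_less_top)
  qed simp
  then have "\<forall>\<^sub>F n in sequentially. ?\<xi> n \<in> M0 E_topology \<rho>"
    by (intro eventually_mono[OF eventually_ge_at_top[of 1]])
  moreover have "(\<lambda>n. \<integral>\<mu>. g \<mu> \<partial>?\<xi> n) \<longlonglongrightarrow> (\<integral>\<mu>. g \<mu> \<partial>xi_limit k)" if g: "g \<in> C0 E_topology" for g
  proof -
    have gm: "g \<in> borel_measurable ?V"
      using g by (intro borel_measurable_continuous_map) (simp add: C0_def)
    have "(\<integral>\<mu>. g \<mu> \<partial>xi_limit k) = 1 / fact (k - 1) * (\<integral>\<mu>. g \<mu> \<partial>distr limit_intensity ?V (dirac E_topology))"
      unfolding xi_limit_alt using gm by (intro integral_scale_measure) auto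
    also have "\<dots> = 1 / fact (k - 1) * (\<integral>y. g (dirac E_topology y) \<partial>limit_intensity)"
      using measurable_continuous_map[OF continuous_map_dirac[where 'd = 'd]] gm
      by (subst integral_distr) (auto cong: measurable_cong_sets)
    finally have lim: "(\<lambda>n. (\<integral>\<omega>. g (L n \<omega>) \<partial>\<Omega>) / b n) \<longlonglongrightarrow> (\<integral>\<mu>. g \<mu> \<partial>xi_limit k)"
      using mean_test_function_limit[OF assms(4) g] by simp
    have "eventually (\<lambda>n. (\<integral>\<omega>. g (L n \<omega>) \<partial>\<Omega>) / b n = (\<integral>\<mu>. g \<mu> \<partial>?\<xi> n)) sequentially"
      using eventually_b_pos eventually_ge_at_top[of 1]
    proof eventually_elim
      case (elim n)
      have "(\<integral>\<mu>. g \<mu> \<partial>?\<xi> n) = 1 / b n * (\<integral>\<mu>. g \<mu> \<partial>distr \<Omega> ?V (L n))"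
        using elim gm by (intro integral_scale_measure) auto
      also have "(\<integral>\<mu>. g \<mu> \<partial>distr \<Omega> ?V (L n)) = (\<integral>\<omega>. g (L n \<omega>) \<partial>\<Omega>)"
        by (rule integral_distr[OF L_measurable[OF assms(4) elim(2)] gm])
      finally show ?case by simp
    qed
    with lim show ?thesis by (rule Lim_transform_eventually)
  qed
  ultimately show ?thesis
    unfolding tendsto_M0_def using xi_limit_in_M0[OF assms(4)] by blast
qed

end
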